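(* Assume the Riemann hypothesis. Let $A\geqslant 1$ be an arbitrary (arbitrarily large) fixed constant. Then there exist constants $c_{0}=c_{0}(A)>0$ and $T_{0}=T_{0}(A)$ such that for every $T>T_{0}$ the interval $(T-H,T+H)$, where $H=\frac{1}{\pi}\ln\ln\ln T+c_{0}$, contains at least one point $t$ with $|\zeta(0.5+it)|>A$.
   Context: $\zeta(s)$ denotes the Riemann zeta function. *)

theory Defs
  imports "HOL-Complex_Analysis.Complex_Analysis"
begin

(* The Riemann zeta function as the analytic continuation of the Dirichlet series.  By the
   identity theorem the continuation is determined at every s \<noteq> 1; the value at the
   pole s = 1 is left unspecified and is never used. *)
definition zeta :: "complex \<Rightarrow> complex" where
  "zeta = (SOME f. f holomorphic_on (- {1}) \<and>
             (\<forall>s. Re s > 1 \<longrightarrow> (\<lambda>n. 1 / (of_nat (Suc n) powr s)) sums f s))"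

(* The zeros outside the open critical strip are exactly the trivial ones s = -2, -4, ... *)
definition riemann_hypothesis :: bool where
  "riemann_hypothesis \<longleftrightarrow>
     (\<forall>s. 0 < Re s \<and> Re s < 1 \<and> zeta s = 0 \<longrightarrow> Re s = 1 / 2)"

end

theory Submission
  imports Defs "HOL-Number_Theory.Prime_Powers" "HOL-Probability.Distributions"
    "HOL-Real_Asymp.Real_Asymp"
begin

text \<open>
  Under the Riemann hypothesis \<open>log \<zeta>\<close> is holomorphic to the right of the critical line (away from the
  pole), so only \<^emph>\<open>upper\<close> bounds for \<open>log |\<zeta>|\<close> are needed to control an average of it against a positive
  kernel. Take the kernel \<open>k(u) = exp(-\<eta> cosh(\<pi> u) - B u\<^sup>2)\<close>: it is bounded by a Gaussian in the strip
  \<open>|Im u| \<le> 1/2\<close>, which is exactly what is needed to move the line of integration from \<open>Re s = 1/2\<close> to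
  \<open>Re s = 1\<close>, and on the real line it decays doubly exponentially, so that beyond
  \<open>|u| = (1/\<pi>) ln ln ln T + O(1)\<close> it is smaller than any power of \<open>1 / ln T\<close> and kills the trivial bound
  \<open>log |\<zeta>| \<le> O(ln T)\<close>. Hence, if \<open>|\<zeta>| \<le> A\<close> on the interval, then
  \<open>\<integral> log |\<zeta>(1/2 + i(\<tau> + x))| k(x) dx \<le> (ln (A + 1) + o(1)) \<integral> k\<close> for \<open>\<tau>\<close> within \<open>O(1)\<close> of \<open>T\<close>.

  After the shift the same integral is \<open>Re \<Sum> \<Lambda>(n) / ln n \<cdot> n\<^bsup>-1/2-i\<tau>\<^esup> K(ln n)\<close> up to a negligible
  contribution of the pole, where \<open>K\<close> is the Fourier transform of \<open>k\<close>. Two integrations by parts on \<open>Im u = -1/2\<close> give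
  \<open>K(\<xi>) = O(exp(-\<xi>/2) / \<xi>\<^sup>2)\<close> uniformly in \<open>\<eta> \<le> 1\<close>, so the tail of the series is small; for
  \<open>\<eta> \<rightarrow> 0\<close> the function \<open>K\<close> tends to the transform of a Gaussian, which is positive. Since \<open>\<Sum> \<Lambda>(n) / (\<surd>n ln n)\<close>
  diverges, a narrow enough Gaussian makes the sum as large as desired as soon as \<open>n\<^bsup>-i\<tau>\<^esup> \<approx> 1\<close> for
  finitely many \<open>n\<close>, and such \<open>\<tau>\<close> are relatively dense by pigeonhole. This contradicts the upper bound.
\<close>

section \<open>Analytic continuation of the zeta function\<close>

text \<open>The factor 1/pi of the theorem is forced by the geometry. The shift from the critical
  line to the line of absolute convergence has length 1/2, and cosh(pi u) is the fastest cosh whose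
  real part stays nonnegative up to |Im u| = 1/2. At that edge its real part vanishes, so the
  Gaussian factor alone ensures convergence there. The delicate point is the order of the choices.
  \<open>A\<close> fixes a finite piece of the divergent series, this piece fixes \<open>B\<close>,
  and \<open>B\<close> fixes all constants of the estimates; then come the cut \<open>M\<close> of
  the tail, the parameter \<eta>, the radius \<open>R\<close> of the pigeonhole argument and finally
  \<open>c0\<close>. Only then is T allowed to grow, so each bound has to be uniform in whatever is
  chosen after it. The logarithm is known only to the right of the critical line, so the average is
  taken on Re s = 1/2 + \<epsilon> with \<epsilon> = 1/\<tau>^3. Bounds for its modulus deteriorate
  as \<epsilon> \<rightarrow> 0, but they serve only to justify the exact identity given by the
  shift and enter no final inequality.\<close>

lemma norm_Suc_powr: "cmod (of_nat (Suc n) powr s) = real (Suc n) powr Re s"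
  by (subst norm_powr_real_powr) auto

lemma summable_Suc_powr:
  assumes "a < -1"
  shows "summable (\<lambda>n. real (Suc n) powr a)"
proof -
  have "summable (\<lambda>n. real n powr a)" using assms by (simp add: summable_real_powr_iff)
  thus ?thesis by (subst summable_Suc_iff[where f="\<lambda>n. real n powr a"])
qed

lemma holomorphic_on_series:
  fixes f :: "nat \<Rightarrow> complex \<Rightarrow> complex"
  assumes "open S" and hol: "\<And>n. f n holomorphic_on S"
    and bd: "\<And>x. x \<in> S \<Longrightarrow> \<exists>d M. d > 0 \<and> cball x d \<subseteq> S \<and> summable M \<and>
               (\<forall>n. \<forall>y\<in>cball x d. norm (f n y) \<le> M n)"
  shows "(\<lambda>s. \<Sum>n. f n s) holomorphic_on S"
proof (rule holomorphic_uniform_sequence[OF \<open>open S\<close>, where f="\<lambda>N s. \<Sum>n<N. f n s"])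
  show "(\<lambda>s. \<Sum>n<N. f n s) holomorphic_on S" for N
    by (intro holomorphic_intros hol)
next
  fix x assume "x \<in> S"
  from bd[OF this] obtain d M where d: "d > 0" "cball x d \<subseteq> S" "summable M"
    "\<And>n y. y \<in> cball x d \<Longrightarrow> norm (f n y) \<le> M n" by blast
  have "uniform_limit (cball x d) (\<lambda>N s. \<Sum>n<N. f n s) (\<lambda>s. \<Sum>n. f n s) sequentially"
    using d by (intro Weierstrass_m_test) auto
  with d show "\<exists>d>0. cball x d \<subseteq> S \<and> uniform_limit (cball x d) (\<lambda>N s. \<Sum>n<N. f n s) (\<lambda>s. \<Sum>n. f n s) sequentially"
    by blast
qed

text \<open>The hypothesis makes the real part of the exponent in the derivative of order m + 1
  nonpositive, so this derivative is largest at the left end of the unit segment. The factorial in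
  the remainder is simply dropped.\<close>

lemma powr_Suc_Taylor:
  fixes a :: complex
  assumes "Re a \<le> real m + 1"
  shows "cmod (of_nat (Suc (Suc n)) powr a -
           (\<Sum>j\<le>m. (\<Prod>l<j. a - of_nat l) / fact j * of_nat (Suc n) powr (a - of_nat j)))
         \<le> cmod (\<Prod>l<Suc m. a - of_nat l) * real (Suc n) powr (Re a - real m - 1)"
proof -
  define S where "S = complex_of_real ` {real (Suc n)..real (Suc (Suc n))}"
  define f where "f = (\<lambda>i x. (\<Prod>l<i. a - of_nat l) * x powr (a - of_nat i))"
  define B where "B = cmod (\<Prod>l<Suc m. a - of_nat l) * real (Suc n) powr (Re a - real m - 1)"
  have "convex S" unfolding S_def
    by (intro convex_linear_image) (auto simp: linear_of_real)
  have der: "(f i has_field_derivative f (Suc i) x) (at x within S)" if "x \<in> S" for i x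
  proof -
    have "x \<notin> \<real>\<^sub>\<le>\<^sub>0" using that by (auto simp: S_def)
    hence "((\<lambda>x. x powr (a - of_nat i)) has_field_derivative (a - of_nat i) * x powr (a - of_nat i - 1)) (at x)"
      by (rule has_field_derivative_powr)
    hence "(f i has_field_derivative (\<Prod>l<i. a - of_nat l) * ((a - of_nat i) * x powr (a - of_nat i - 1))) (at x within S)"
      unfolding f_def by (intro DERIV_cmult) (rule has_field_derivative_at_within)
    thus ?thesis by (simp add: f_def algebra_simps)
  qed
  have bd: "cmod (f (Suc m) x) \<le> B" if "x \<in> S" for x
  proof -
    from that obtain t where t: "x = of_real t" "t \<ge> real (Suc n)" by (auto simp: S_def)
    hence "cmod (x powr (a - of_nat (Suc m))) = t powr (Re a - real m - 1)"
      by (subst norm_powr_real_powr) (auto simp: algebra_simps)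
    also have "\<dots> \<le> real (Suc n) powr (Re a - real m - 1)"
      using t assms by (intro powr_mono2') auto
    finally show ?thesis unfolding f_def B_def norm_mult by (intro mult_left_mono) auto
  qed
  have "cmod (f 0 (of_nat (Suc (Suc n))) - (\<Sum>i\<le>m. f i (of_nat (Suc n)) * (of_nat (Suc (Suc n)) - of_nat (Suc n)) ^ i / fact i))
       \<le> B * cmod (of_nat (Suc (Suc n)) - of_nat (Suc n)) ^ (Suc m) / fact m"
  proof (rule complex_Taylor[OF \<open>convex S\<close>])
    show "of_nat (Suc n) \<in> S" "of_nat (Suc (Suc n)) \<in> S"
      unfolding S_def by (rule image_eqI[where x="real (Suc n)"]; simp)
        (rule image_eqI[where x="real (Suc (Suc n))"]; simp)
  qed (use der bd in auto)
  moreover have "(of_nat (Suc (Suc n)) - of_nat (Suc n) :: complex) = 1" by simp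
  ultimately have "cmod (f 0 (of_nat (Suc (Suc n))) - (\<Sum>i\<le>m. f i (of_nat (Suc n)) / fact i)) \<le> B / fact m"
    by (simp only: power_one norm_one mult_1_right)
  also have "\<dots> \<le> B / 1" by (intro divide_left_mono) (auto simp: B_def)
  finally show ?thesis by (simp add: f_def B_def)
qed

text \<open>Taylor remainder of \<open>x\<^bsup>1-s\<^esup>\<close> at the integers. Since \<open>\<Sum>\<^sub>n ((n+1)\<^bsup>1-s\<^esup> - n\<^bsup>1-s\<^esup>)\<close> telescopes, summing the
  expansion expresses \<open>(s - 1) \<zeta>(s)\<close> through \<open>\<zeta>(s+1), \<dots>, \<zeta>(s+m-1)\<close> and a series converging for
  \<open>Re s > 1 - m\<close>.\<close>

definition zeta_rem :: "nat \<Rightarrow> complex \<Rightarrow> nat \<Rightarrow> complex" where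
  "zeta_rem m s n = of_nat (Suc (Suc n)) powr (1 - s) -
     (\<Sum>j\<le>m. (\<Prod>l<j. 1 - s - of_nat l) / fact j * of_nat (Suc n) powr (1 - s - of_nat j))"

lemma norm_zeta_rem:
  assumes "Re s \<ge> - real m"
  shows "cmod (zeta_rem m s n) \<le> cmod (\<Prod>l<Suc m. 1 - s - of_nat l) * real (Suc n) powr (- Re s - real m)"
  using powr_Suc_Taylor[of "1 - s" m n] assms by (simp add: zeta_rem_def)

text \<open>The remainder is O(n^(-Re s - m)) locally uniformly in s, so every further Taylor term
  moves the half-plane of convergence one unit to the left.\<close>

lemma holomorphic_zeta_rem_sum:
  "(\<lambda>s. \<Sum>n. zeta_rem m s n) holomorphic_on {s. Re s > 1 - real m}"
proof (rule holomorphic_on_series)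
  show "open {s. Re s > 1 - real m}" by (rule open_halfspace_Re_gt)
  show "(\<lambda>s. zeta_rem m s n) holomorphic_on {s. Re s > 1 - real m}" for n
    unfolding zeta_rem_def by (intro holomorphic_intros) auto
  fix x assume x: "x \<in> {s. Re s > 1 - real m}"
  define d where "d = (Re x - (1 - real m)) / 2"
  have d: "d > 0" using x by (simp add: d_def)
  have Re_ge: "Re y \<ge> 1 - real m + d" if "y \<in> cball x d" for y
  proof -
    have "\<bar>Re x - Re y\<bar> \<le> d" using that abs_Re_le_cmod[of "x - y"] by (simp add: dist_norm)
    moreover have "Re x = 1 - real m + 2 * d" unfolding d_def by (simp add: field_simps)
    ultimately show ?thesis by linarith
  qed
  have "continuous_on (cball x d) (\<lambda>s. \<Prod>l<Suc m. 1 - s - of_nat l :: complex)"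
    by (intro continuous_intros)
  hence "bounded ((\<lambda>s. \<Prod>l<Suc m. 1 - s - of_nat l :: complex) ` cball x d)"
    by (intro compact_imp_bounded compact_continuous_image) auto
  then obtain C where C: "C > 0" "\<And>y. y \<in> cball x d \<Longrightarrow> cmod (\<Prod>l<Suc m. 1 - y - of_nat l) \<le> C"
    by (auto simp: bounded_pos)
  show "\<exists>d M. 0 < d \<and> cball x d \<subseteq> {s. 1 - real m < Re s} \<and> summable M \<and> (\<forall>n. \<forall>y\<in>cball x d. cmod (zeta_rem m y n) \<le> M n)"
  proof (intro exI conjI allI ballI)
    show "d > 0" by fact
    show "cball x d \<subseteq> {s. 1 - real m < Re s}" using Re_ge d by force
    show "summable (\<lambda>n. C * real (Suc n) powr (-1 - d))"
      using d by (intro summable_mult summable_Suc_powr) auto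
    fix n y assume y: "y \<in> cball x d"
    have "cmod (zeta_rem m y n) \<le> cmod (\<Prod>l<Suc m. 1 - y - of_nat l) * real (Suc n) powr (- Re y - real m)"
      using Re_ge[OF y] d by (intro norm_zeta_rem) auto
    also have "\<dots> \<le> C * real (Suc n) powr (-1 - d)"
      using Re_ge[OF y] C(1) by (intro mult_mono C y powr_mono) auto
    finally show "cmod (zeta_rem m y n) \<le> C * real (Suc n) powr (-1 - d)" .
  qed
qed

definition zeta_series :: "complex \<Rightarrow> complex" where
  "zeta_series s = (\<Sum>n. 1 / of_nat (Suc n) powr s)"

lemma zeta_series_sums:
  assumes "Re s > 1"
  shows "(\<lambda>n. 1 / of_nat (Suc n) powr s) sums zeta_series s"
proof -
  have "summable (\<lambda>n. cmod (1 / of_nat (Suc n) powr s))"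
    using summable_Suc_powr[of "- Re s"] assms
    by (simp only: norm_divide norm_Suc_powr norm_one powr_minus_divide)
  thus ?thesis unfolding zeta_series_def by (rule summable_sums[OF summable_norm_cancel])
qed

text \<open>The term j = 1 of the expansion is (1 - s) \<zeta>(s) and becomes the left-hand side.
  For j \<ge> 2 put w = s + j - 1: the last factor of the product is -(w - 1) and is pulled out, so
  that \<zeta> enters only through the pole-free combination (w - 1) \<zeta>(w).\<close>

lemma zeta_series_recursion:
  assumes s: "Re s > 1" and m: "m \<ge> 1"
  shows "(s - 1) * zeta_series s =
    1 - (\<Sum>j=2..m. (\<Prod>l<j-1. 1 - s - of_nat l) / fact j * ((s + of_nat j - 2) * zeta_series (s + of_nat j - 1)))
      + (\<Sum>n. zeta_rem m s n)"
proof -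
  have lim: "(\<lambda>n. of_nat (Suc n) powr (1 - s)) \<longlonglongrightarrow> (0::complex)"
  proof (rule tendsto_norm_zero_cancel)
    have "(\<lambda>n. real (Suc n) powr (1 - Re s)) \<longlonglongrightarrow> 0"
      using s by real_asymp
    thus "(\<lambda>n. cmod (of_nat (Suc n) powr (1 - s))) \<longlonglongrightarrow> 0"
      by (simp only: norm_Suc_powr minus_complex.simps one_complex.simps)
  qed
  have "(\<lambda>n. of_nat (Suc (Suc n)) powr (1 - s) - of_nat (Suc n) powr (1 - s)) sums (0 - of_nat (Suc 0) powr (1-s) :: complex)"
    by (rule telescope_sums[OF lim])
  hence 1: "(\<lambda>n. of_nat (Suc (Suc n)) powr (1 - s) - of_nat (Suc n) powr (1 - s)) sums (-1::complex)" by simp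
  have 2: "(\<lambda>n. of_nat (Suc n) powr (1 - s - of_nat j)) sums (zeta_series (s + of_nat j - 1) :: complex)" if "j \<ge> 1" for j
  proof -
    have "(\<lambda>n. 1 / of_nat (Suc n) powr (s + of_nat j - 1)) sums zeta_series (s + of_nat j - 1)"
      using s that by (intro zeta_series_sums) auto
    moreover have "1 / of_nat (Suc n) powr (s + of_nat j - 1) = (of_nat (Suc n) powr (1 - s - of_nat j) :: complex)" for n
      by (subst powr_minus_divide[symmetric]) (simp add: algebra_simps)
    ultimately show ?thesis by simp
  qed
  let ?c = "\<lambda>j. (\<Prod>l<j. 1 - s - of_nat l) / fact j"
  have "(\<lambda>n. of_nat (Suc (Suc n)) powr (1 - s) - of_nat (Suc n) powr (1 - s) -
           (\<Sum>j\<in>{1..m}. ?c j * of_nat (Suc n) powr (1 - s - of_nat j))) sums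
         (-1 - (\<Sum>j\<in>{1..m}. ?c j * zeta_series (s + of_nat j - 1)))"
    by (intro sums_diff 1 sums_sum sums_mult 2) auto
  moreover have "of_nat (Suc (Suc n)) powr (1 - s) - of_nat (Suc n) powr (1 - s) -
           (\<Sum>j\<in>{1..m}. ?c j * of_nat (Suc n) powr (1 - s - of_nat j)) = zeta_rem m s n" for n
  proof -
    have "{..m} = insert 0 {1..m}" by auto
    thus ?thesis unfolding zeta_rem_def by simp
  qed
  ultimately have R: "(\<Sum>n. zeta_rem m s n) = -1 - (\<Sum>j\<in>{1..m}. ?c j * zeta_series (s + of_nat j - 1))"
    by (simp add: sums_iff)
  have "{1..m} = insert 1 {2..m}" using m by auto
  hence "(\<Sum>j\<in>{1..m}. ?c j * zeta_series (s + of_nat j - 1)) = (1 - s) * zeta_series s + (\<Sum>j\<in>{2..m}. ?c j * zeta_series (s + of_nat j - 1))"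
    by simp
  also have "(\<Sum>j\<in>{2..m}. ?c j * zeta_series (s + of_nat j - 1)) =
      (\<Sum>j\<in>{2..m}. - ((\<Prod>l<j-1. 1 - s - of_nat l) / fact j * ((s + of_nat j - 2) * zeta_series (s + of_nat j - 1))))"
  proof (rule sum.cong)
    fix j assume "j \<in> {2..m}"
    then obtain i where i: "j = Suc i" by (cases j) auto
    have gen: "P * (1 - s - k) / f * z = - (P / f * ((s + (1 + k) - 2) * z))" for P k f z :: complex
      by (cases "f = 0") (auto simp: field_simps)
    show "?c j * zeta_series (s + of_nat j - 1) = - ((\<Prod>l<j-1. 1 - s - of_nat l) / fact j * ((s + of_nat j - 2) * zeta_series (s + of_nat j - 1)))"
      unfolding i prod.lessThan_Suc diff_Suc_1 of_nat_Suc by (rule gen)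
  qed simp
  finally have T: "(\<Sum>j\<in>{1..m}. ?c j * zeta_series (s + of_nat j - 1)) = (1 - s) * zeta_series s +
      - (\<Sum>j=2..m. (\<Prod>l<j-1. 1 - s - of_nat l) / fact j * ((s + of_nat j - 2) * zeta_series (s + of_nat j - 1)))"
    by (simp only: sum_negf)
  have "(s - 1) * z = 1 - q + r" if "r = -1 - t" "t = (1 - s) * z + - q" for r t z q :: complex
    using that by (simp add: algebra_simps)
  from this[OF R T] show ?thesis .
qed

section \<open>Dirichlet series with coefficients bounded by 1\<close>

definition dirichlet :: "(nat \<Rightarrow> real) \<Rightarrow> complex \<Rightarrow> complex" where
  "dirichlet c s = (\<Sum>n. of_real (c n) * of_nat (Suc n) powr (-s))"

lemma norm_dirichlet_term:
  "cmod (of_real c * of_nat (Suc n) powr (-s)) = \<bar>c\<bar> * real (Suc n) powr (- Re s)"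
  unfolding norm_mult norm_Suc_powr by simp

lemma summable_dirichlet:
  assumes c: "\<And>n. \<bar>c n\<bar> \<le> 1" and s: "Re s > 1"
  shows "summable (\<lambda>n. cmod (of_real (c n) * of_nat (Suc n) powr (-s)))"
    "(\<lambda>n. of_real (c n) * of_nat (Suc n) powr (-s)) sums dirichlet c s"
proof -
  show *: "summable (\<lambda>n. cmod (of_real (c n) * of_nat (Suc n) powr (-s)))"
  proof (rule summable_comparison_test'[where g="\<lambda>n. real (Suc n) powr (- Re s)" and N=0])
    show "summable (\<lambda>n. real (Suc n) powr (- Re s))" using s by (intro summable_Suc_powr) auto
    show "norm (cmod (of_real (c n) * of_nat (Suc n) powr (-s))) \<le> real (Suc n) powr (- Re s)" for n
      unfolding norm_dirichlet_term using mult_right_mono[OF c[of n], of "real (Suc n) powr (- Re s)"] by simp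
  qed
  show "(\<lambda>n. of_real (c n) * of_nat (Suc n) powr (-s)) sums dirichlet c s"
    unfolding dirichlet_def by (rule summable_sums[OF summable_norm_cancel[OF *]])
qed

text \<open>Termwise differentiation under locally uniform convergence. The derivative is delivered
  together with its series, because its coefficients carry an extra logarithm and
  \<open>summable_dirichlet\<close> does not cover them.\<close>

lemma dirichlet_deriv:
  assumes c: "\<And>n. \<bar>c n\<bar> \<le> 1"
  shows "\<exists>D. \<forall>s. Re s > 1 \<longrightarrow>
    (\<lambda>n. - of_real (c n * ln (real (Suc n))) * of_nat (Suc n) powr (-s)) sums D s \<and>
    (dirichlet c has_field_derivative D s) (at s)"
proof -
  let ?S = "{s. Re s > 1}"
  have opn: "open ?S" by (rule open_halfspace_Re_gt)
  have "\<exists>g g'. \<forall>x\<in>?S. (\<lambda>n. of_real (c n) * of_nat (Suc n) powr (-x)) sums g x \<and>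
     (\<lambda>n. - of_real (c n * ln (real (Suc n))) * of_nat (Suc n) powr (-x)) sums g' x \<and>
     (g has_field_derivative g' x) (at x)"
  proof (rule series_and_derivative_comparison_complex[OF opn])
    fix n and x :: complex
    show "((\<lambda>x. of_real (c n) * of_nat (Suc n) powr (-x)) has_field_derivative
            - of_real (c n * ln (real (Suc n))) * of_nat (Suc n) powr (-x)) (at x)"
    proof -
      have Ln: "Ln (of_nat (Suc n)) = of_real (ln (real (Suc n)))" by (rule Ln_of_nat) simp
      have "((\<lambda>x. of_real (c n) * exp (- x * of_real (ln (real (Suc n))))) has_field_derivative
            - of_real (c n * ln (real (Suc n))) * exp (- x * of_real (ln (real (Suc n))))) (at x)"
        by (auto intro!: derivative_eq_intros simp del: of_nat_Suc)
      thus ?thesis unfolding powr_def Ln by (simp del: of_nat_Suc)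
    qed
  next
    fix x assume x: "x \<in> ?S"
    define d where "d = (Re x - 1) / 2"
    have d: "d > 0" "Re x = 1 + 2 * d" using x by (auto simp: d_def field_simps)
    have Re_ge: "Re y \<ge> 1 + d" if "y \<in> ball x d" for y
    proof -
      have "\<bar>Re x - Re y\<bar> \<le> d" using that abs_Re_le_cmod[of "x - y"] by (simp add: dist_norm)
      thus ?thesis using d by linarith
    qed
    show "\<exists>d h. 0 < d \<and> summable h \<and> range h \<subseteq> \<real>\<^sub>\<ge>\<^sub>0 \<and> (\<forall>\<^sub>F n in sequentially. \<forall>y\<in>ball x d \<inter> ?S.
      cmod (of_real (c n) * of_nat (Suc n) powr (-y)) \<le> cmod (h n))"
    proof (intro exI conjI always_eventually allI ballI)
      show "d > 0" by fact
      show "summable (\<lambda>n. complex_of_real (real (Suc n) powr (-1 - d)))"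
        using d by (intro summable_of_real summable_Suc_powr) auto
      show "range (\<lambda>n. complex_of_real (real (Suc n) powr (-1 - d))) \<subseteq> \<real>\<^sub>\<ge>\<^sub>0"
        by (auto simp del: of_nat_Suc)
      fix n y assume y: "y \<in> ball x d \<inter> ?S"
      have "cmod (of_real (c n) * of_nat (Suc n) powr (-y)) \<le> 1 * real (Suc n) powr (- Re y)"
        unfolding norm_dirichlet_term by (intro mult_right_mono c) auto
      also have "\<dots> \<le> real (Suc n) powr (-1 - d)"
        using Re_ge[of y] y by (simp del: of_nat_Suc) (intro powr_mono; simp)
      finally show "cmod (of_real (c n) * of_nat (Suc n) powr (-y)) \<le> cmod (complex_of_real (real (Suc n) powr (-1 - d)))"
        by simp
    qed
  qed
  then obtain g g' where g: "\<And>x. Re x > 1 \<Longrightarrow> (\<lambda>n. of_real (c n) * of_nat (Suc n) powr (-x)) sums g x"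
    "\<And>x. Re x > 1 \<Longrightarrow> (\<lambda>n. - of_real (c n * ln (real (Suc n))) * of_nat (Suc n) powr (-x)) sums g' x"
    "\<And>x. Re x > 1 \<Longrightarrow> (g has_field_derivative g' x) (at x)" by (auto simp del: of_nat_Suc)
  have eq: "g x = dirichlet c x" if "Re x > 1" for x
    using g(1)[OF that] summable_dirichlet(2)[OF c that] by (rule sums_unique2)
  have "(dirichlet c has_field_derivative g' s) (at s)" if "Re s > 1" for s
    by (rule DERIV_cong_ev[THEN iffD1, OF refl _ refl g(3)[OF that]])
       (use that eq in \<open>auto intro!: eventually_nhds_in_open[THEN eventually_mono, OF opn]\<close>)
  thus ?thesis using g(2) by blast
qed

lemma dirichlet_holomorphic:
  assumes "\<And>n. \<bar>c n\<bar> \<le> 1"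
  shows "dirichlet c holomorphic_on {s. Re s > 1}"
  using dirichlet_deriv[of c, OF assms] by (auto simp: holomorphic_on_open open_halfspace_Re_gt)

lemma zeta_series_eq_dirichlet: "zeta_series s = dirichlet (\<lambda>_. 1) s"
  unfolding zeta_series_def dirichlet_def by (simp add: powr_minus_divide)

text \<open>Induction on k: the recursion at s with m = k + 1 needs the earlier extension only at s
  + j - 1 with j \<ge> 2, at least one unit further right, where it is already holomorphic.\<close>

lemma zeta_series_continuation_halfplane:
  "\<exists>F. F holomorphic_on {s. Re s > 1 - real k} \<and> (\<forall>s. Re s > 1 \<longrightarrow> F s = (s - 1) * zeta_series s)"
proof (induction k)
  case 0
  have "zeta_series holomorphic_on {s. Re s > 1}"
    unfolding zeta_series_eq_dirichlet[abs_def] by (rule dirichlet_holomorphic) simp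
  hence "(\<lambda>s. (s - 1) * zeta_series s) holomorphic_on {s. Re s > 1 - real 0}"
    by (intro holomorphic_intros) auto
  thus ?case by blast
next
  case (Suc k)
  then obtain F where F: "F holomorphic_on {s. Re s > 1 - real k}"
    "\<And>s. Re s > 1 \<Longrightarrow> F s = (s - 1) * zeta_series s" by blast
  define G where "G = (\<lambda>s. 1 - (\<Sum>j=2..Suc k. (\<Prod>l<j-1. 1 - s - of_nat l) / fact j * F (s + of_nat j - 1))
      + (\<Sum>n. zeta_rem (Suc k) s n))"
  have "(\<lambda>s. F (s + of_nat j - 1)) holomorphic_on {s. Re s > 1 - real (Suc k)}" if "j \<in> {2..Suc k}" for j
    by (rule holomorphic_on_compose_gen[OF _ F(1), unfolded o_def, where f="\<lambda>s. s + of_nat j - 1"])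
       (use that in \<open>auto intro!: holomorphic_intros\<close>)
  hence "G holomorphic_on {s. Re s > 1 - real (Suc k)}"
    unfolding G_def by (intro holomorphic_intros holomorphic_zeta_rem_sum) auto
  moreover have "G s = (s - 1) * zeta_series s" if s: "Re s > 1" for s
  proof -
    have "F (s + of_nat j - 1) = (s + of_nat j - 2) * zeta_series (s + of_nat j - 1)" if "j \<in> {2..Suc k}" for j
      using that s by (subst F(2)) (auto simp: algebra_simps)
    thus ?thesis unfolding G_def by (subst zeta_series_recursion[OF s, of "Suc k"]) auto
  qed
  ultimately show ?case by blast
qed

lemma zeta_series_continuation:
  "\<exists>F. F holomorphic_on UNIV \<and> (\<forall>s. Re s > 1 \<longrightarrow> F s = (s - 1) * zeta_series s)"
proof -
  let ?H = "\<lambda>k. {s. Re s > 1 - real k}"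
  obtain F where F: "\<And>k. F k holomorphic_on ?H k"
    "\<And>k s. Re s > 1 \<Longrightarrow> F k s = (s - 1) * zeta_series s"
    using zeta_series_continuation_halfplane by metis
  have agree: "F k s = F l s" if "k \<le> l" "Re s > 1 - real k" for k l s
  proof (rule analytic_continuation_open[where s="{s. Re s > 1}" and s'="?H k" and f="F k" and g="F l" and z=s])
    show "F l holomorphic_on ?H k"
      by (rule holomorphic_on_subset[OF F(1)]) (use that in auto)
    show "connected (?H k)" by (intro convex_connected convex_halfspace_Re_gt)
    show "{s. 1 < Re s} \<noteq> {}" by (auto intro!: exI[of _ 2])
  qed (use that F in \<open>auto simp: open_halfspace_Re_gt\<close>)
  \<comment> \<open>For this k one has 1 - k \<le> Re s - 1, so s lies inside the k-th half-plane;
    by \<open>agree\<close> any other admissible k gives the same value.\<close>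
  define G where "G = (\<lambda>s. F (nat \<lceil>2 - Re s\<rceil>) s)"
  have G: "G s = F k s" if "Re s > 1 - real k" for k s
  proof (cases "k \<le> nat \<lceil>2 - Re s\<rceil>")
    case True thus ?thesis unfolding G_def using agree[OF True that] by simp
  next
    case False
    have "Re s > 1 - real (nat \<lceil>2 - Re s\<rceil>)" by linarith
    thus ?thesis unfolding G_def using agree[of "nat \<lceil>2 - Re s\<rceil>" k s] False by simp
  qed
  have "G field_differentiable (at s)" for s
  proof -
    define k where "k = nat \<lceil>2 - Re s\<rceil>"
    have s: "s \<in> ?H k" unfolding k_def mem_Collect_eq by linarith
    have "G holomorphic_on ?H k"
      by (rule holomorphic_transform[OF F(1)]) (simp add: G)
    thus ?thesis using s by (auto simp: holomorphic_on_open open_halfspace_Re_gt field_differentiable_def)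
  qed
  hence "G holomorphic_on UNIV" by (simp add: holomorphic_on_def field_differentiable_at_within)
  moreover have "G s = (s - 1) * zeta_series s" if "Re s > 1" for s
    using G[where k=0 and s=s] F(2)[where k=0 and s=s] that by simp
  ultimately show ?thesis by blast
qed

text \<open>\<open>zeta\<close> is obtained by choice, so its properties rest on exhibiting one
  continuation: the entire extension of (s - 1) \<zeta>(s), divided by s - 1.\<close>

lemma zeta_spec:
  "zeta holomorphic_on (- {1})"
  "Re s > 1 \<Longrightarrow> zeta s = zeta_series s"
proof -
  obtain F where F: "F holomorphic_on UNIV" "\<And>s. Re s > 1 \<Longrightarrow> F s = (s - 1) * zeta_series s"
    using zeta_series_continuation by blast
  have "(\<lambda>s. F s / (s - 1)) holomorphic_on (- {1})"
    by (intro holomorphic_intros holomorphic_on_subset[OF F(1)]) auto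
  moreover have "(\<lambda>n. 1 / (of_nat (Suc n) powr s)) sums (F s / (s - 1))" if "Re s > 1" for s
    using zeta_series_sums[OF that] F(2)[OF that] that by auto
  ultimately have "\<exists>f. f holomorphic_on (- {1}) \<and>
             (\<forall>s. Re s > 1 \<longrightarrow> (\<lambda>n. 1 / (of_nat (Suc n) powr s)) sums f s)" by blast
  from someI_ex[OF this] have *: "zeta holomorphic_on (- {1})"
    "\<And>s. Re s > 1 \<Longrightarrow> (\<lambda>n. 1 / (of_nat (Suc n) powr s)) sums zeta s"
    unfolding zeta_def[symmetric] by blast+
  show "zeta holomorphic_on (- {1})" by fact
  show "zeta s = zeta_series s" if "Re s > 1"
    using *(2)[OF that] zeta_series_sums[OF that] by (rule sums_unique2)
qed

text \<open>The value of \<open>(s - 1) \<zeta>(s)\<close>, including at \<open>s = 1\<close>, where \<open>zeta\<close> itself is unspecified.\<close>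

definition zeta_reg :: "complex \<Rightarrow> complex" where
  "zeta_reg s = 1 + (\<Sum>n. zeta_rem 1 s n)"

lemma holomorphic_zeta_reg: "zeta_reg holomorphic_on {s. Re s > 0}"
  unfolding zeta_reg_def using holomorphic_zeta_rem_sum[of 1] by (intro holomorphic_intros) auto

lemma zeta_reg_eq:
  assumes "Re s > 0" "s \<noteq> 1"
  shows "zeta_reg s = (s - 1) * zeta s"
proof (rule analytic_continuation_open[where s="{s. Re s > 1}" and s'="{s. Re s > 0} - {1}"
      and g="\<lambda>s. (s - 1) * zeta s"])
  show "{s. 1 < Re s} \<noteq> {}" by (auto intro!: exI[of _ 2])
  show "connected ({s. 0 < Re s} - {1})"
    by (intro connected_open_delete convex_connected convex_halfspace_Re_gt) (auto simp: open_halfspace_Re_gt)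
  show "zeta_reg holomorphic_on {s. 0 < Re s} - {1}"
    by (rule holomorphic_on_subset[OF holomorphic_zeta_reg]) auto
  show "(\<lambda>s. (s - 1) * zeta s) holomorphic_on {s. 0 < Re s} - {1}"
    by (intro holomorphic_intros holomorphic_on_subset[OF zeta_spec(1)]) auto
  show "zeta_reg z = (z - 1) * zeta z" if "z \<in> {s. 1 < Re s}" for z
    using zeta_series_recursion[of z 1] that zeta_spec(2)[of z] by (simp add: zeta_reg_def)
qed (use assms in \<open>auto simp: open_halfspace_Re_gt\<close>)

lemma zeta_reg_1 [simp]: "zeta_reg 1 = 1"
proof -
  have "of_nat (Suc m) \<noteq> (0::complex)" for m by (rule of_nat_neq_0)
  thus ?thesis by (simp add: zeta_reg_def zeta_rem_def del: of_nat_Suc) simp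
qed

text \<open>With m = 1 the remainder carries the coefficient (1 - s)(-s), whence the quadratic
  growth. The half-plane starts at 1/4 so that discs of radius 1/4 around points with Re s \<ge> 1/2
  are covered as well.\<close>

lemma norm_zeta_reg_le:
  "\<exists>C>0. \<forall>s. Re s \<ge> 1/4 \<longrightarrow> cmod (zeta_reg s) \<le> C * (1 + cmod s)^2"
proof -
  define K where "K = (\<Sum>n. real (Suc n) powr (- (5/4)))"
  have sum: "summable (\<lambda>n. real (Suc n) powr (- (5/4)))" by (rule summable_Suc_powr) auto
  have K: "K \<ge> 0" unfolding K_def by (rule suminf_nonneg[OF sum]) auto
  have "cmod (zeta_reg s) \<le> (1 + K) * (1 + cmod s)^2" if s: "Re s \<ge> 1/4" for s
  proof -
    have bd: "cmod (zeta_rem 1 s n) \<le> (1 + cmod s)^2 * real (Suc n) powr (- (5/4))" for n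
    proof -
      have "cmod (zeta_rem 1 s n) \<le> cmod ((1 - s) * (- s)) * real (Suc n) powr (- Re s - 1)"
        using norm_zeta_rem[of 1 s n] s by (simp add: eval_nat_numeral)
      also have "cmod ((1 - s) * (- s)) \<le> (1 + cmod s) * (1 + cmod s)"
        unfolding norm_mult using norm_triangle_ineq4[of 1 s] by (intro mult_mono) auto
      also have "real (Suc n) powr (- Re s - 1) \<le> real (Suc n) powr (- (5/4))"
        using s by (intro powr_mono) auto
      finally show ?thesis by (simp add: power2_eq_square mult_left_mono)
    qed
    have "cmod (\<Sum>n. zeta_rem 1 s n) \<le> (\<Sum>n. (1 + cmod s)^2 * real (Suc n) powr (- (5/4)))"
      by (rule norm_suminf_le[OF bd]) (intro summable_mult sum)
    also have "\<dots> = (1 + cmod s)^2 * K" unfolding K_def by (rule suminf_mult[OF sum])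
    finally have "cmod (zeta_reg s) \<le> 1 + (1 + cmod s)^2 * K"
      unfolding zeta_reg_def using norm_triangle_ineq[of 1 "\<Sum>n. zeta_rem 1 s n"] by simp
    moreover have "1 \<le> (1 + cmod s)^2" by (simp add: one_le_power)
    ultimately have "cmod (zeta_reg s) \<le> (1 + cmod s)^2 + (1 + cmod s)^2 * K" by linarith
    thus ?thesis by (simp add: ring_distribs mult.commute)
  qed
  thus ?thesis using K by (intro exI[of _ "1 + K"]) auto
qed


section \<open>The Dirichlet series of the logarithm\<close>

text \<open>From the second term on, (n + 2)^(-a) \<le> 2^(2 - a) (n + 2)^(-2) with a = Re s. Used
  twice: to identify a constant as Re s tends to infinity, and to bound the logarithm on the line Re
  s = 2.\<close>

lemma norm_dirichlet_minus_first:
  assumes c: "\<And>n. \<bar>c n\<bar> \<le> 1" and s: "Re s \<ge> 2"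
  shows "cmod (dirichlet c s - of_real (c 0)) \<le> 2 powr (2 - Re s) * (\<Sum>n. real (Suc n) powr (-2))"
proof -
  have sm2: "summable (\<lambda>n. real (Suc n) powr (-2))" by (rule summable_Suc_powr) auto
  have "(\<lambda>n. of_real (c n) * of_nat (Suc n) powr (-s)) sums dirichlet c s"
    using s by (intro summable_dirichlet c) auto
  from sums_split_initial_segment[OF this, of 1]
  have sums: "(\<lambda>n. of_real (c (Suc n)) * of_nat (Suc (Suc n)) powr (-s)) sums (dirichlet c s - of_real (c 0))"
    by (simp del: of_nat_Suc) simp
  have bd: "cmod (of_real (c (Suc n)) * of_nat (Suc (Suc n)) powr (-s)) \<le> 2 powr (2 - Re s) * real (Suc n) powr (-2)" for n
  proof -
    have "cmod (of_real (c (Suc n)) * of_nat (Suc (Suc n)) powr (-s)) \<le> 1 * real (Suc (Suc n)) powr (- Re s)"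
      unfolding norm_dirichlet_term by (intro mult_right_mono c) auto
    also have "\<dots> = real (Suc (Suc n)) powr (2 - Re s) * real (Suc (Suc n)) powr (-2)"
      by (simp only: powr_add[symmetric]) simp
    also have "\<dots> \<le> 2 powr (2 - Re s) * real (Suc n) powr (-2)"
      using s by (intro mult_mono powr_mono2') auto
    finally show ?thesis .
  qed
  have "cmod (\<Sum>n. of_real (c (Suc n)) * of_nat (Suc (Suc n)) powr (-s)) \<le> (\<Sum>n. 2 powr (2 - Re s) * real (Suc n) powr (-2))"
    by (rule norm_suminf_le[OF bd]) (intro summable_mult sm2)
  thus ?thesis using sums_unique[OF sums] suminf_mult[OF sm2, of "2 powr (2 - Re s)"] by simp
qed

lemma dirichlet_tendsto_first:
  assumes c: "\<And>n. \<bar>c n\<bar> \<le> 1"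
  shows "(\<lambda>k. dirichlet c (of_nat k)) \<longlonglongrightarrow> of_real (c 0)"
proof (rule LIM_zero_cancel, rule Lim_null_comparison)
  show "\<forall>\<^sub>F k in sequentially. cmod (dirichlet c (of_nat k) - of_real (c 0)) \<le>
         2 powr (2 - real k) * (\<Sum>n. real (Suc n) powr (-2))"
    using eventually_ge_at_top[of "2::nat"]
    by eventually_elim (use norm_dirichlet_minus_first[OF c, of "of_nat _"] in auto)
  have "(\<lambda>k. 2 powr (2 - real k)) \<longlonglongrightarrow> 0" by real_asymp
  thus "(\<lambda>k. 2 powr (2 - real k) * (\<Sum>n. real (Suc n) powr (-2))) \<longlonglongrightarrow> 0"
    by (rule tendsto_mult_left_zero)
qed

text \<open>Indices are shifted by one: this is the coefficient of \<open>(n + 1)\<^bsup>-s\<^esup>\<close> in \<open>log \<zeta>(s)\<close>. At \<open>n = 0\<close> the quotient is \<open>0 / 0 = 0\<close>.\<close>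

definition log_coeff :: "nat \<Rightarrow> real" where
  "log_coeff n = mangoldt (Suc n) / ln (real (Suc n))"

lemma log_coeff_nonneg: "log_coeff n \<ge> 0"
  by (simp add: log_coeff_def mangoldt_nonneg del: of_nat_Suc)

lemma abs_log_coeff_le: "\<bar>log_coeff n\<bar> \<le> 1"
proof (cases "n = 0")
  case False
  hence "ln (real (Suc n)) > 0" by simp
  thus ?thesis using mangoldt_le[of "Suc n"] mangoldt_nonneg[of "Suc n"] by (simp add: log_coeff_def field_simps)
qed (simp add: log_coeff_def)

lemma log_coeff_mult_ln: "log_coeff n * ln (real (Suc n)) = mangoldt (Suc n)"
  by (cases "n = 0") (simp_all add: log_coeff_def)

lemma log_coeff_0 [simp]: "log_coeff 0 = 0"
  by (simp add: log_coeff_def)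

text \<open>The divisor-sum identity of \<open>mangoldt_sum\<close>, read as a product of Dirichlet
  series. Absolute convergence makes the double sum over (d, m) summable, and it is regrouped
  according to n = d m.\<close>

lemma dirichlet_mangoldt_product:
  assumes s: "Re s > 1"
    and L: "(\<lambda>n. mangoldt (Suc n) * of_nat (Suc n) powr (-s)) sums L"
    and M: "(\<lambda>n. of_real (ln (real (Suc n))) * of_nat (Suc n) powr (-s)) sums M"
    and sm: "summable (\<lambda>n. cmod (mangoldt (Suc n) * of_nat (Suc n) powr (-s)))"
  shows "M = L * zeta_series s"
proof -
  let ?A = "{0<..} :: nat set"
  define f :: "nat \<Rightarrow> complex" where "f = (\<lambda>n. mangoldt n * of_nat n powr (-s))"
  define g :: "nat \<Rightarrow> complex" where "g = (\<lambda>n. of_nat n powr (-s))"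
  have bij: "bij_betw Suc UNIV ?A"
    by (rule bij_betwI[of _ _ _ "\<lambda>n. n - 1"]) auto
  have f: "(f has_sum L) ?A"
    using norm_summable_imp_has_sum[OF sm L] unfolding f_def
    by (subst has_sum_reindex_bij_betw[OF bij, symmetric]) simp
  have g: "(g has_sum zeta_series s) ?A"
    using norm_summable_imp_has_sum[OF summable_dirichlet[of "\<lambda>_. 1" s]] s
    unfolding g_def zeta_series_eq_dirichlet
    by (subst has_sum_reindex_bij_betw[OF bij, symmetric]) simp
  have f': "(\<lambda>x. norm (f x)) summable_on ?A" and g': "(\<lambda>x. norm (g x)) summable_on ?A"
    using f g by (auto simp: summable_on_iff_abs_summable_on_complex[symmetric] summable_on_def)
  have "(\<lambda>x. norm (case x of (d, m) \<Rightarrow> f d * g m)) summable_on ?A \<times> ?A"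
    unfolding Infinite_Sum.abs_summable_on_Sigma_iff using f' g'
    by (auto simp: norm_mult infsum_cmult_right abs_mult intro!: summable_on_cmult_right summable_on_cmult_left)
  then obtain S where S: "((\<lambda>(d, m). f d * g m) has_sum S) (?A \<times> ?A)"
    using Infinite_Sum.abs_summable_summable by (force simp: summable_on_def)
  have "((\<lambda>d. f d * zeta_series s) has_sum S) ?A"
    by (rule has_sum_SigmaD[OF S]) (auto intro!: has_sum_cmult_right g)
  moreover have "((\<lambda>d. f d * zeta_series s) has_sum L * zeta_series s) ?A"
    by (intro has_sum_cmult_left f)
  ultimately have SL: "S = L * zeta_series s" by (rule has_sum_unique)
  let ?D = "SIGMA n:?A. {d. d dvd n}"
  have bij2: "bij_betw (\<lambda>(n, d). (d, n div d)) ?D (?A \<times> ?A)"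
    by (rule bij_betwI[of _ _ _ "\<lambda>(d, m). (d * m, d)"]) (auto elim!: dvdE intro: Nat.gr0I)
  have S2: "((\<lambda>(n, d). f d * g (n div d)) has_sum S) ?D"
    using has_sum_reindex_bij_betw[OF bij2, of "\<lambda>(d, m). f d * g m" S] S by (simp add: case_prod_unfold)
  have "((\<lambda>n. of_real (ln (real n)) * of_nat n powr (-s)) has_sum S) ?A"
  proof (rule has_sum_SigmaD[OF S2])
    fix n :: nat assume n: "n \<in> ?A"
    have "f d * g (n div d) = mangoldt d * of_nat n powr (-s)" if "d dvd n" for d
    proof -
      obtain m where m: "n = d * m" using \<open>d dvd n\<close> by auto
      have "complex_of_real (real d * real m) powr (-s) = of_real (real d) powr (-s) * of_real (real m) powr (-s)"
        using n m by (subst of_real_mult, subst powr_times_real) auto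
      thus ?thesis using m n by (simp add: f_def g_def)
    qed
    hence "(\<Sum>d | d dvd n. f d * g (n div d)) = (\<Sum>d | d dvd n. mangoldt d) * of_nat n powr (-s)"
      by (simp add: sum_distrib_right)
    also have "\<dots> = of_real (ln (real n)) * of_nat n powr (-s)"
      using n by (subst mangoldt_sum) auto
    finally show "((\<lambda>d. case (n, d) of (n, d) \<Rightarrow> f d * g (n div d)) has_sum of_real (ln (real n)) * of_nat n powr (-s)) {d. d dvd n}"
      using n by (auto intro!: has_sum_finiteI)
  qed
  hence "((\<lambda>n. of_real (ln (real (Suc n))) * of_nat (Suc n) powr (-s)) has_sum S) UNIV"
    by (subst (asm) has_sum_reindex_bij_betw[OF bij, symmetric])
  from has_sum_imp_sums[OF this] M have "M = S" by (rule sums_unique2[symmetric])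
  thus ?thesis using SL by simp
qed

text \<open>Writing D for the series of \<open>log_coeff\<close>, the previous lemma says \<zeta>' =
  D' \<zeta>, so \<zeta> exp(-D) is constant. Its limit along the integers is 1, since the first
  coefficient of D is 0.\<close>

lemma zeta_series_eq_exp:
  assumes s: "Re s > 1"
  shows "zeta_series s = exp (dirichlet log_coeff s)"
proof -
  let ?S = "{s. Re s > 1}"
  obtain Z where Z: "\<And>s. Re s > 1 \<Longrightarrow> (\<lambda>n. - of_real (1 * ln (real (Suc n))) * of_nat (Suc n) powr (-s)) sums Z s"
     "\<And>s. Re s > 1 \<Longrightarrow> (dirichlet (\<lambda>_. 1) has_field_derivative Z s) (at s)"
    using dirichlet_deriv[of "\<lambda>_. 1"] by auto
  obtain G where G: "\<And>s. Re s > 1 \<Longrightarrow> (\<lambda>n. - of_real (log_coeff n * ln (real (Suc n))) * of_nat (Suc n) powr (-s)) sums G s"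
     "\<And>s. Re s > 1 \<Longrightarrow> (dirichlet log_coeff has_field_derivative G s) (at s)"
    using dirichlet_deriv[of log_coeff, OF abs_log_coeff_le] by blast
  have eq: "Z s = G s * zeta_series s" if s: "Re s > 1" for s
  proof -
    have M: "(\<lambda>n. of_real (ln (real (Suc n))) * of_nat (Suc n) powr (-s)) sums (- Z s)"
      using sums_minus[OF Z(1)[OF s]] by (simp del: of_nat_Suc)
    have G': "(\<lambda>n. mangoldt (Suc n) * of_nat (Suc n) powr (-s)) sums (- G s)" if "Re s > 1" for s
      using sums_minus[OF G(1)[OF that]] by (simp only: log_coeff_mult_ln mult_minus_left minus_minus of_real_mangoldt)
    have "summable (\<lambda>n. cmod (mangoldt (Suc n) * of_nat (Suc n) powr (-s)))"
    proof -
      \<comment> \<open>The coefficients are nonnegative, so absolute convergence at s is just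
        convergence at the real point Re s.\<close>
      have "summable (\<lambda>n. mangoldt (Suc n) * of_nat (Suc n) powr (- of_real (Re s)) :: complex)"
        using G'[of "of_real (Re s)"] s by (auto simp: sums_iff)
      hence "summable (\<lambda>n. Re (mangoldt (Suc n) * of_nat (Suc n) powr (- of_real (Re s))))" by (rule summable_Re)
      moreover have "Re (mangoldt (Suc n) * of_nat (Suc n) powr (- of_real (Re s))) = cmod (mangoldt (Suc n) * of_nat (Suc n) powr (-s))" for n
      proof -
        have "of_nat (Suc n) powr (- of_real (Re s)) = complex_of_real (real (Suc n) powr (- Re s))"
          by (subst powr_of_real[symmetric]) auto
        thus ?thesis unfolding norm_mult norm_Suc_powr by (simp del: of_nat_Suc)
      qed
      ultimately show ?thesis by (simp only:)
    qed
    from dirichlet_mangoldt_product[OF s G'[OF s] M this] show ?thesis by simp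
  qed
  have hd: "((\<lambda>s. zeta_series s * exp (- dirichlet log_coeff s)) has_field_derivative 0) (at s)" if s: "Re s > 1" for s
    unfolding zeta_series_eq_dirichlet
    by (rule derivative_eq_intros Z(2)[OF s] G(2)[OF s] refl)+
       (simp add: eq[OF s] zeta_series_eq_dirichlet algebra_simps)
  have "\<exists>c. \<forall>s\<in>?S. zeta_series s * exp (- dirichlet log_coeff s) = c"
    by (rule DERIV_zero_connected_constant[where K="{}"])
       (auto intro!: convex_connected convex_halfspace_Re_gt hd DERIV_continuous_on[OF has_field_derivative_at_within[OF hd]]
         simp: open_halfspace_Re_gt)
  then obtain c where c: "\<And>s. Re s > 1 \<Longrightarrow> zeta_series s * exp (- dirichlet log_coeff s) = c" by auto
  have "(\<lambda>k. zeta_series (of_nat k) * exp (- dirichlet log_coeff (of_nat k))) \<longlonglongrightarrow> of_real 1 * exp (- of_real (log_coeff 0))"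
    unfolding zeta_series_eq_dirichlet
    by (intro tendsto_intros dirichlet_tendsto_first abs_log_coeff_le) auto
  moreover have "(\<lambda>k. zeta_series (of_nat k) * exp (- dirichlet log_coeff (of_nat k))) \<longlonglongrightarrow> c"
    by (rule tendsto_eventually) (use eventually_ge_at_top[of "2::nat"] in eventually_elim, auto intro!: c)
  ultimately have "c = 1" using LIMSEQ_unique by force
  with c[OF s] show ?thesis by (simp add: exp_minus field_simps)
qed

corollary zeta_eq_exp: "Re s > 1 \<Longrightarrow> zeta s = exp (dirichlet log_coeff s)"
  using zeta_spec(2) zeta_series_eq_exp by simp

section \<open>The line Re s = 1 and the pole at s = 1\<close>

lemma Re_dirichlet_term:
  "Re (of_real c * of_nat (Suc n) powr (- Complex a t)) = c * real (Suc n) powr (-a) * cos (t * ln (real (Suc n)))"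
proof -
  have Ln: "Ln (of_nat (Suc n)) = of_real (ln (real (Suc n)))" by (rule Ln_of_nat) simp
  have "of_nat (Suc n) powr (- Complex a t) = exp (Complex (- a * ln (real (Suc n))) (- t * ln (real (Suc n))))"
  proof -
    have "- Complex a t * of_real (ln (real (Suc n))) = Complex (- a * ln (real (Suc n))) (- t * ln (real (Suc n)))"
      by (simp add: complex_eq_iff)
    thus ?thesis unfolding powr_def Ln using of_nat_neq_0[of n, where ?'a=complex] by (simp only: if_False)
  qed
  thus ?thesis by (simp add: Re_exp powr_def del: of_nat_Suc)
qed

text \<open>Nonnegativity of \<open>log_coeff\<close> combined with 3 + 4 cos x + cos 2x = 2 (1 +
  cos x)^2.\<close>

lemma log_zeta_three_four_one:
  assumes "a > 1"
  shows "3 * Re (dirichlet log_coeff (of_real a)) + 4 * Re (dirichlet log_coeff (Complex a t)) +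
     Re (dirichlet log_coeff (Complex a (2 * t))) \<ge> 0"
proof -
  have *: "(\<lambda>n. log_coeff n * real (Suc n) powr (-a) * cos (t * ln (real (Suc n)))) sums Re (dirichlet log_coeff (Complex a t))" for t
    using sums_Re[OF summable_dirichlet(2)[OF abs_log_coeff_le, of "Complex a t"]] assms
    by (simp only: Re_dirichlet_term complex.sel)
  have nn: "3 + 4 * cos x + cos (2 * x) \<ge> 0" for x :: real
  proof -
    have "3 + 4 * cos x + cos (2 * x) = 2 * (1 + cos x)^2" unfolding cos_double_cos by (simp add: power2_eq_square algebra_simps)
    thus ?thesis by simp
  qed
  have "(\<lambda>n. 3 * (log_coeff n * real (Suc n) powr (-a) * cos (0 * ln (real (Suc n)))) +
      4 * (log_coeff n * real (Suc n) powr (-a) * cos (t * ln (real (Suc n)))) +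
      log_coeff n * real (Suc n) powr (-a) * cos ((2 * t) * ln (real (Suc n)))) sums
    (3 * Re (dirichlet log_coeff (Complex a 0)) + 4 * Re (dirichlet log_coeff (Complex a t)) +
     Re (dirichlet log_coeff (Complex a (2 * t))))"
    by (intro sums_add sums_mult *)
  moreover have "3 * (log_coeff n * real (Suc n) powr (-a) * cos (0 * ln (real (Suc n)))) +
      4 * (log_coeff n * real (Suc n) powr (-a) * cos (t * ln (real (Suc n)))) +
      log_coeff n * real (Suc n) powr (-a) * cos ((2 * t) * ln (real (Suc n))) \<ge> 0" for n
  proof -
    have "log_coeff n * real (Suc n) powr (-a) * (3 + 4 * cos (t * ln (real (Suc n))) + cos (2 * (t * ln (real (Suc n))))) \<ge> 0"
      by (intro mult_nonneg_nonneg nn log_coeff_nonneg) auto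
    thus ?thesis by (simp add: algebra_simps)
  qed
  ultimately have "0 \<le> 3 * Re (dirichlet log_coeff (Complex a 0)) + 4 * Re (dirichlet log_coeff (Complex a t)) +
     Re (dirichlet log_coeff (Complex a (2 * t)))"
    by (rule sums_le[rotated 2]) (rule sums_zero)
  thus ?thesis by (simp add: complex_of_real_def)
qed

lemma zeta_reg_tendsto_1: "((\<lambda>x. cmod (zeta_reg (of_real (1 + x)))) \<longlongrightarrow> 1) (at_right 0)"
proof -
  have "isCont zeta_reg 1"
    using holomorphic_on_imp_continuous_on[OF holomorphic_zeta_reg] 
    by (auto simp: continuous_on_eq_continuous_at open_halfspace_Re_gt)
  moreover have "isCont (\<lambda>x::real. complex_of_real (1 + x)) 0" by (intro continuous_intros)
  ultimately have "isCont (\<lambda>x. cmod (zeta_reg (of_real (1 + x)))) 0"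
    by (intro continuous_intros isCont_o2[where g=zeta_reg and f="\<lambda>x. complex_of_real (1 + x)"]) auto
  hence "(\<lambda>x. cmod (zeta_reg (of_real (1 + x)))) \<midarrow>0\<rightarrow> cmod (zeta_reg (of_real (1 + 0)))"
    by (simp only: isCont_def)
  thus ?thesis by (simp add: filterlim_at_split)
qed

text \<open>\<open>riemann_hypothesis\<close> speaks only of the open strip, so this line needs the
  classical argument: a zero at 1 + it, counted four times, would outweigh the pole at 1, counted
  three times.\<close>

lemma zeta_nonzero_line_1:
  assumes "t \<noteq> 0"
  shows "zeta (Complex 1 t) \<noteq> 0"
proof
  assume zero: "zeta (Complex 1 t) = 0"
  have diff: "zeta field_differentiable at (Complex 1 u)" if "u \<noteq> 0" for u
  proof -
    have "Complex 1 u \<in> - {1}" using that by (auto simp: complex_eq_iff)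
    thus ?thesis using zeta_spec(1) by (meson holomorphic_on_imp_differentiable_at open_Compl closed_singleton)
  qed
  obtain D where D: "(zeta has_field_derivative D) (at (Complex 1 t))"
    using diff[OF assms] by (auto simp: field_differentiable_def)
  have lim1: "((\<lambda>x::real. zeta (Complex 1 t + of_real x) / of_real x) \<longlongrightarrow> D) (at_right 0)"
  proof -
    have "filterlim complex_of_real (at 0) (at_right 0)"
      by (rule filterlim_atI) (auto intro!: tendsto_eq_intros simp: eventually_at_filter)
    from filterlim_compose[OF D[unfolded DERIV_def] this] show ?thesis using zero by simp
  qed
  have "isCont zeta (Complex 1 (2 * t))" using diff[of "2 * t"] assms by (auto intro: field_differentiable_imp_continuous_at)
  hence lim2: "((\<lambda>x::real. zeta (Complex 1 (2 * t) + of_real x)) \<longlongrightarrow> zeta (Complex 1 (2 * t))) (at_right 0)"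
    by (rule isCont_tendsto_compose) (auto intro!: tendsto_eq_intros)
  \<comment> \<open>The powers of x cancel: x^3 from the regularised factors, x^(-4) from the
    difference quotients, and the final x. For x > 0 the product is therefore the 3-4-1 product of
    values of |\<zeta>|, at least 1, whereas its limit is 0.\<close>
  have "((\<lambda>x::real. cmod (zeta_reg (of_real (1 + x))) ^ 3 * cmod (zeta (Complex 1 t + of_real x) / of_real x) ^ 4 *
      cmod (zeta (Complex 1 (2 * t) + of_real x)) * x) \<longlongrightarrow> 1 ^ 3 * cmod D ^ 4 * cmod (zeta (Complex 1 (2 * t))) * 0) (at_right 0)"
    by (intro tendsto_intros lim1 lim2 zeta_reg_tendsto_1)
  moreover have "\<forall>\<^sub>F x in at_right (0::real). 1 \<le> cmod (zeta_reg (of_real (1 + x))) ^ 3 * cmod (zeta (Complex 1 t + of_real x) / of_real x) ^ 4 *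
      cmod (zeta (Complex 1 (2 * t) + of_real x)) * x"
    using eventually_at_right_less[of 0]
  proof eventually_elim
    case (elim x)
    have c: "Complex 1 u + of_real x = Complex (1 + x) u" for u by (simp add: complex_eq_iff)
    let ?G = "dirichlet log_coeff"
    have reg: "zeta_reg (of_real (1 + x)) = of_real x * exp (?G (of_real (1 + x)))"
      using elim by (subst zeta_reg_eq) (auto simp: zeta_eq_exp[of "1 + of_real x"])
    have "cmod (zeta_reg (of_real (1 + x))) ^ 3 * cmod (zeta (Complex 1 t + of_real x) / of_real x) ^ 4 *
      cmod (zeta (Complex 1 (2 * t) + of_real x)) * x =
      exp (Re (?G (of_real (1 + x)))) ^ 3 * exp (Re (?G (Complex (1 + x) t))) ^ 4 * exp (Re (?G (Complex (1 + x) (2 * t))))"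
      unfolding reg c using elim by (simp add: zeta_eq_exp norm_mult norm_divide power_mult_distrib power_divide)
        (simp add: field_simps eval_nat_numeral)
    also have "\<dots> = exp (3 * Re (?G (of_real (1 + x))) + 4 * Re (?G (Complex (1 + x) t)) + Re (?G (Complex (1 + x) (2 * t))))"
      by (simp only: exp_add exp_of_nat_mult[symmetric] of_nat_numeral)
    also have "\<dots> \<ge> 1" using log_zeta_three_four_one[of "1 + x" t] elim by simp
    finally show ?case .
  qed
  ultimately have "1 \<le> 1 ^ 3 * cmod D ^ 4 * cmod (zeta (Complex 1 (2 * t))) * 0"
    by (intro tendsto_lowerbound[where F="at_right 0"]) auto
  thus False by simp
qed

text \<open>A consequence of the pole at 1 alone: log \<zeta>(1 + x) exceeds every bound as x
  \<rightarrow> 0+, and n^(-1-x) \<le> n^(-1/2). No estimate for the distribution of primes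
  enters.\<close>

lemma log_coeff_half_unbounded: "\<exists>M. (\<Sum>n<M. log_coeff n * real (Suc n) powr (-1/2)) > R"
proof -
  have "\<forall>\<^sub>F x in at_right (0::real). cmod (zeta_reg (of_real (1 + x))) > 1/2"
    by (rule order_tendstoD[OF zeta_reg_tendsto_1]) simp
  \<comment> \<open>For such x, the inequality x exp(Re log \<zeta>(1 + x)) > 1/2 forces Re log
    \<zeta>(1 + x) > R.\<close>
  moreover have "\<forall>\<^sub>F x in at_right (0::real). 0 < x \<and> x < exp (- R) / 2"
    by (auto simp: eventually_at_right_field intro!: exI[of _ "exp (- R) / 2"])
  ultimately have "\<forall>\<^sub>F x in at_right (0::real). Re (dirichlet log_coeff (of_real (1 + x))) > R \<and> 0 < x"
  proof eventually_elim
    case (elim x)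
    have "zeta_reg (of_real (1 + x)) = of_real x * exp (dirichlet log_coeff (of_real (1 + x)))"
      using elim by (subst zeta_reg_eq) (auto simp: zeta_eq_exp[of "1 + of_real x"])
    hence "1/2 < x * exp (Re (dirichlet log_coeff (of_real (1 + x))))" using elim by (simp add: norm_mult)
    also have "\<dots> \<le> (exp (- R) / 2) * exp (Re (dirichlet log_coeff (of_real (1 + x))))"
      using elim by (intro mult_right_mono) auto
    also have "\<dots> = exp (Re (dirichlet log_coeff (of_real (1 + x))) - R) / 2"
      by (simp add: exp_diff exp_minus field_simps)
    finally have "exp 0 < exp (Re (dirichlet log_coeff (of_real (1 + x))) - R)" by simp
    thus ?case using elim by (simp only: exp_less_cancel_iff) simp
  qed
  from eventually_happens[OF this] obtain x where x: "Re (dirichlet log_coeff (of_real (1 + x))) > R" "x > 0" by auto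
  have "(\<lambda>n. log_coeff n * real (Suc n) powr (-(1+x)) * cos (0 * ln (real (Suc n)))) sums Re (dirichlet log_coeff (Complex (1+x) 0))"
    using sums_Re[OF summable_dirichlet(2)[OF abs_log_coeff_le, of "Complex (1+x) 0"]] x
    by (simp only: Re_dirichlet_term complex.sel)
  hence "(\<lambda>N. \<Sum>n<N. log_coeff n * real (Suc n) powr (-(1+x))) \<longlonglongrightarrow> Re (dirichlet log_coeff (of_real (1+x)))"
    by (simp add: sums_def complex_of_real_def del: of_nat_Suc)
  from order_tendstoD(1)[OF this x(1)] obtain M where "(\<Sum>n<M. log_coeff n * real (Suc n) powr (-(1+x))) > R"
    by (auto simp: eventually_at_top_linorder)
  also have "(\<Sum>n<M. log_coeff n * real (Suc n) powr (-(1+x))) \<le> (\<Sum>n<M. log_coeff n * real (Suc n) powr (-1/2))"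
    using x by (intro sum_mono mult_left_mono powr_mono log_coeff_nonneg) auto
  finally show ?thesis by blast
qed


section \<open>The logarithm under the Riemann hypothesis\<close>

lemma zeta_reg_nonzero:
  assumes RH: "riemann_hypothesis" and s: "Re s > 1/2"
  shows "zeta_reg s \<noteq> 0"
proof (cases "s = 1")
  case False
  have "zeta s \<noteq> 0"
  proof -
    consider "Re s < 1" | "Re s = 1" | "Re s > 1" by linarith
    thus ?thesis
    proof cases
      case 1
      thus ?thesis using RH s unfolding riemann_hypothesis_def by force
    next
      case 2
      hence "s = Complex 1 (Im s)" "Im s \<noteq> 0" using False by (auto simp: complex_eq_iff)
      thus ?thesis using zeta_nonzero_line_1 by metis
    next
      case 3
      thus ?thesis by (simp add: zeta_eq_exp)
    qed
  qed
  thus ?thesis using zeta_reg_eq[of s] s False by auto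
qed auto

lemma norm_Ln_le_abs_ln_add_pi:
  assumes "z \<noteq> 0"
  shows "cmod (Ln z) \<le> \<bar>ln (cmod z)\<bar> + pi"
proof -
  have "\<bar>Im (Ln z)\<bar> \<le> pi" using mpi_less_Im_Ln[OF assms] Im_Ln_le_pi[OF assms] by linarith
  thus ?thesis using cmod_le[of "Ln z"] Re_Ln[OF assms] by simp
qed

text \<open>The map h / (2 M' - h) sends the half-plane Re h < M' into the unit disc, so Schwarz's
  lemma turns a one-sided bound for the real part into a bound for the modulus.\<close>

lemma Borel_Caratheodory:
  assumes hol: "f holomorphic_on ball z R" and Re_le: "\<And>w. w \<in> ball z R \<Longrightarrow> Re (f w) \<le> M"
    and K: "cmod (f z) \<le> K" and M: "M \<ge> 0" and r: "0 \<le> r" "r < R" and w: "dist z w \<le> r"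
  shows "cmod (f w) \<le> K + 2 * (M + K + 1) * r / (R - r)"
proof -
  have R: "R > 0" using r by linarith
  \<comment> \<open>Re (f - f(z)) is at most M + K; the extra 1 makes the inequality strict and M'
    positive.\<close>
  define M' where "M' = M + K + 1"
  have K0: "K \<ge> 0" using K norm_ge_zero order_trans by blast
  have M': "M' > 0" using M K0 by (simp add: M'_def)
  define h where "h = (\<lambda>x. f (z + of_real R * x) - f z)"
  have in_ball: "z + of_real R * x \<in> ball z R" if "cmod x < 1" for x
    using that R by (simp add: dist_norm norm_mult)
  have Re_h: "Re (h x) < M'" if "cmod x < 1" for x
    using Re_le[OF in_ball[OF that]] K abs_Re_le_cmod[of "f z"] by (simp add: h_def M'_def)
  have hol_h: "h holomorphic_on ball 0 1"
    unfolding h_def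
    by (intro holomorphic_intros holomorphic_on_compose_gen[OF _ hol, unfolded o_def])
       (auto intro!: holomorphic_intros in_ball)
  have nz: "2 * of_real M' - h x \<noteq> 0" if "cmod x < 1" for x
  proof
    assume "2 * of_real M' - h x = 0"
    hence "Re (h x) = 2 * M'" by (auto simp: complex_eq_iff)
    thus False using Re_h[OF that] M' by linarith
  qed
  have less: "cmod (h x) < cmod (2 * of_real M' - h x)" if "cmod x < 1" for x
  proof -
    have "(cmod (2 * of_real M' - h x))\<^sup>2 - (cmod (h x))\<^sup>2 = 4 * M' * (M' - Re (h x))"
      unfolding cmod_power2 by (simp add: power2_eq_square algebra_simps)
    moreover have "4 * M' * (M' - Re (h x)) > 0" using M' Re_h[OF that] by simp
    ultimately have "(cmod (h x))\<^sup>2 < (cmod (2 * of_real M' - h x))\<^sup>2" by linarith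
    thus ?thesis by (rule power_less_imp_less_base) simp
  qed
  define \<xi> where "\<xi> = (w - z) / of_real R"
  have \<xi>: "cmod \<xi> \<le> r / R" "r / R < 1" using w R r by (auto simp: \<xi>_def norm_divide dist_norm norm_minus_commute divide_right_mono)
  have "cmod (h \<xi> / (2 * of_real M' - h \<xi>)) \<le> cmod \<xi>"
  proof (rule Schwarz_Lemma(1)[where f="\<lambda>x. h x / (2 * of_real M' - h x)"])
    show "(\<lambda>x. h x / (2 * of_real M' - h x)) holomorphic_on ball 0 1"
      using nz by (intro holomorphic_intros hol_h) auto
    show "h 0 / (2 * of_real M' - h 0) = 0" by (simp add: h_def)
    show "cmod (h x / (2 * of_real M' - h x)) < 1" if "cmod x < 1" for x
      using less[OF that] nz[OF that] by (simp add: norm_divide)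
    show "cmod \<xi> < 1" using \<xi> by linarith
  qed
  hence "cmod (h \<xi>) \<le> cmod \<xi> * cmod (2 * of_real M' - h \<xi>)"
    using nz[of \<xi>] \<xi> by (simp add: norm_divide divide_le_eq)
  also have "\<dots> \<le> (r / R) * (2 * M' + cmod (h \<xi>))"
    using norm_triangle_ineq4[of "2 * of_real M'" "h \<xi>"] M' \<xi> r R by (intro mult_mono) (auto simp: norm_mult)
  finally have "cmod (h \<xi>) * R \<le> r * (2 * M' + cmod (h \<xi>))" using R by (simp add: field_simps)
  hence "cmod (h \<xi>) \<le> 2 * M' * r / (R - r)" using r by (simp add: field_simps)
  moreover have "h \<xi> = f w - f z" using R by (simp add: h_def \<xi>_def)
  ultimately show ?thesis using K norm_triangle_ineq2[of "f w" "f z"] by (simp add: M'_def)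
qed

lemma one_minus_2_div:
  assumes "Re s > -1"
  shows "1 - 2 / (s + 1) = (s - 1) / (s + 1)"
proof -
  have "s + 1 \<noteq> 0" using assms by (auto simp: complex_eq_iff)
  thus ?thesis by (simp add: field_simps)
qed

lemma one_minus_2_div_pos:
  assumes "Re s > 1"
  shows "Re (1 - 2 / (s + 1)) > 0"
proof -
  have "cmod (s + 1) \<ge> Re s + 1" using complex_Re_le_cmod[of "s + 1"] by simp
  hence "cmod (2 / (s + 1)) < 1" using assms by (auto simp: norm_divide divide_less_eq)
  thus ?thesis using complex_Re_le_cmod[of "2 / (s + 1)"] by simp
qed

text \<open>The pole rules out a holomorphic logarithm of \<zeta> on the whole half-plane, so one is
  taken of (s - 1) \<zeta>(s) / (s + 1). Dividing by s + 1 makes the correction factor equal to 1 -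
  2/(s + 1): for Re s > 1 it has positive real part, so the principal logarithm applies, and it is
  close to 1 at large height.\<close>

lemma RH_log_zeta:
  assumes RH: "riemann_hypothesis"
  obtains F where "F holomorphic_on {s. Re s > 1/2}"
    "\<And>s. Re s > 1/2 \<Longrightarrow> exp (F s) = zeta_reg s / (s + 1)"
    "\<And>s. Re s > 1 \<Longrightarrow> F s = dirichlet log_coeff s + Ln (1 - 2 / (s + 1))"
proof -
  let ?H = "{s. Re s > 1/2}"
  have s1: "s + 1 \<noteq> 0" if "Re s > 1/2" for s using that by (auto simp: complex_eq_iff)
  have hZ: "(\<lambda>s. zeta_reg s / (s + 1)) holomorphic_on ?H"
    using s1 by (intro holomorphic_intros holomorphic_on_subset[OF holomorphic_zeta_reg]) auto
  obtain g where g: "g holomorphic_on ?H" "\<And>s. s \<in> ?H \<Longrightarrow> exp (g s) = zeta_reg s / (s + 1)"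
    by (rule holomorphic_logarithm_exists[OF convex_halfspace_Re_gt open_halfspace_Re_gt hZ, of 1])
       (use zeta_reg_nonzero[OF RH] s1 in auto)
  define h where "h = (\<lambda>s. g s - (dirichlet log_coeff s + Ln (1 - 2 / (s + 1))))"
  have hol_h: "h holomorphic_on {s. Re s > 1}"
  proof -
    have "1 - 2 / (s + 1) \<notin> \<real>\<^sub>\<le>\<^sub>0" if "Re s > 1" for s
      using one_minus_2_div_pos[OF that] complex_nonpos_Reals_iff by auto
    moreover have "s + 1 \<noteq> 0" if "Re s > 1" for s using s1 that by simp
    ultimately show ?thesis unfolding h_def
      by (intro holomorphic_intros holomorphic_on_subset[OF g(1)] dirichlet_holomorphic abs_log_coeff_le) auto
  qed
  have exp_h: "exp (h s) = 1" if s: "Re s > 1" for s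
  proof -
    have ne: "s \<noteq> 1" "s + 1 \<noteq> 0" using s s1 by auto
    have ne': "1 - 2 / (s + 1) \<noteq> 0" using one_minus_2_div_pos[OF s] by auto
    have "exp (dirichlet log_coeff s + Ln (1 - 2 / (s + 1))) = zeta s * ((s - 1) / (s + 1))"
      using s ne' one_minus_2_div[of s] by (simp add: exp_add zeta_eq_exp)
    moreover have "exp (g s) = zeta s * ((s - 1) / (s + 1))"
      using g(2)[of s] zeta_reg_eq[of s] s ne by simp
    ultimately show ?thesis unfolding h_def exp_diff using exp_not_eq_zero by (metis divide_self)
  qed
  have dh: "(h has_field_derivative 0) (at s)" if s: "Re s > 1" for s
  proof -
    obtain D where D: "(h has_field_derivative D) (at s)"
      using hol_h s by (auto simp: holomorphic_on_open open_halfspace_Re_gt)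
    have "((\<lambda>s. exp (h s)) has_field_derivative exp (h s) * D) (at s)"
      by (rule DERIV_chain2[OF DERIV_exp D])
    moreover have "((\<lambda>s. exp (h s)) has_field_derivative 0) (at s)"
      by (rule DERIV_cong_ev[THEN iffD1, OF refl _ refl DERIV_const[of 1]])
         (use s exp_h in \<open>auto intro!: eventually_nhds_in_open[THEN eventually_mono, OF open_halfspace_Re_gt]\<close>)
    ultimately have "exp (h s) * D = 0" by (rule DERIV_unique)
    thus ?thesis using D by simp
  qed
  have "\<exists>c. \<forall>s\<in>{s. Re s > 1}. h s = c"
    by (rule DERIV_zero_connected_constant[where K="{}"])
       (auto intro!: convex_connected convex_halfspace_Re_gt dh holomorphic_on_imp_continuous_on[OF hol_h]
         simp: open_halfspace_Re_gt)
  then obtain c where c: "\<And>s. Re s > 1 \<Longrightarrow> h s = c" by auto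
  \<comment> \<open>The branch of the logarithm was arbitrary. It differs from the wanted one by c,
    a multiple of 2 pi i, which is subtracted.\<close>
  have "exp c = 1" using exp_h[of 2] c[of 2] by simp
  show ?thesis
  proof (rule that[of "\<lambda>s. g s - c"])
    show "(\<lambda>s. g s - c) holomorphic_on ?H" by (intro holomorphic_intros g)
    show "exp (g s - c) = zeta_reg s / (s + 1)" if "Re s > 1/2" for s
      using that g(2)[of s] \<open>exp c = 1\<close> by (simp add: exp_diff)
    show "g s - c = dirichlet log_coeff s + Ln (1 - 2 / (s + 1))" if "Re s > 1" for s
    proof -
      have "x - c = y" if "x - y = c" for x y :: complex using that by (simp add: algebra_simps)
      thus ?thesis using c[OF that] unfolding h_def .
    qed
  qed
qed

lemma zeta_reg_div_le:
  "\<exists>C\<ge>1. \<forall>s. Re s \<ge> 1/4 \<longrightarrow> cmod (zeta_reg s / (s + 1)) \<le> C * (1 + cmod s)^2"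
proof -
  obtain C where C: "C > 0" "\<And>s. Re s \<ge> 1/4 \<Longrightarrow> cmod (zeta_reg s) \<le> C * (1 + cmod s)^2"
    using norm_zeta_reg_le by blast
  have "cmod (zeta_reg s / (s + 1)) \<le> (C + 1) * (1 + cmod s)^2" if s: "Re s \<ge> 1/4" for s
  proof -
    have "cmod (s + 1) \<ge> 1" using complex_Re_le_cmod[of "s + 1"] s by simp
    hence "cmod (zeta_reg s / (s + 1)) \<le> cmod (zeta_reg s) / 1"
      unfolding norm_divide by (intro divide_left_mono) auto
    also have "\<dots> \<le> (C + 1) * (1 + cmod s)^2"
      using C(2)[OF s] by (simp add: ring_distribs add_increasing2)
    finally show ?thesis .
  qed
  thus ?thesis using C(1) by (intro exI[of _ "C + 1"]) auto
qed

text \<open>The size of \<zeta> bounds Re F only from above, and \<open>Borel_Caratheodory\<close>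
  supplies the modulus. The discs are centred at 2 + it, where the series bounds F, and have radius
  3/2, so they just reach the critical line. The constant depends on \<epsilon>, which is harmless:
  it only makes integrals converge.\<close>

lemma log_zeta_growth:
  assumes hol: "F holomorphic_on {s. Re s > 1/2}"
    and ex: "\<And>s. Re s > 1/2 \<Longrightarrow> exp (F s) = zeta_reg s / (s + 1)"
    and F1: "\<And>s. Re s > 1 \<Longrightarrow> F s = dirichlet log_coeff s + Ln (1 - 2 / (s + 1))"
    and \<epsilon>: "0 < \<epsilon>"
  shows "\<exists>C\<ge>0. \<forall>s. 1/2 + \<epsilon> \<le> Re s \<and> Re s \<le> 2 \<longrightarrow> cmod (F s) \<le> C * (1 + \<bar>Im s\<bar>)^2"
proof -
  obtain C where C: "C \<ge> 1" "\<And>s. Re s \<ge> 1/4 \<Longrightarrow> cmod (zeta_reg s / (s + 1)) \<le> C * (1 + cmod s)^2"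
    using zeta_reg_div_le by blast
  define K where "K = (\<Sum>n. real (Suc n) powr (-2)) + (2 + pi)"
  have K: "cmod (F (Complex 2 t)) \<le> K" for t
  proof -
    define z where "z = 1 - 2 / (Complex 2 t + 1)"
    have "cmod (Complex 2 t + 1) \<ge> 3" using complex_Re_le_cmod[of "Complex 2 t + 1"] by simp
    hence w: "cmod (2 / (Complex 2 t + 1)) \<le> 2/3" by (simp add: norm_divide divide_le_eq)
    have z: "cmod z \<ge> 1/3" "cmod z \<le> 5/3"
      using w norm_triangle_ineq2[of 1 "2 / (Complex 2 t + 1)"] norm_triangle_ineq4[of 1 "2 / (Complex 2 t + 1)"]
      by (auto simp: z_def)
    have "ln (cmod z) \<le> cmod z - 1" using z by (intro ln_le_minus_one) linarith
    moreover have "- ln (cmod z) \<le> 1 / cmod z - 1"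
    proof -
      have "z \<noteq> 0" using z by auto
      thus ?thesis using ln_le_minus_one[of "1 / cmod z"] by (simp add: ln_div)
    qed
    moreover have "1 / cmod z \<le> 3" using z by (simp add: divide_le_eq)
    ultimately have "\<bar>ln (cmod z)\<bar> \<le> 2" using z by linarith
    hence "cmod (Ln z) \<le> 2 + pi" using norm_Ln_le_abs_ln_add_pi[of z] z by fastforce
    moreover have "cmod (dirichlet log_coeff (Complex 2 t)) \<le> (\<Sum>n. real (Suc n) powr (-2))"
      using norm_dirichlet_minus_first[of log_coeff "Complex 2 t", OF abs_log_coeff_le] by (simp del: of_nat_Suc)
    ultimately show ?thesis using norm_triangle_ineq[of "dirichlet log_coeff (Complex 2 t)" "Ln z"]
      by (simp add: F1 K_def z_def)
  qed
  have K0: "K \<ge> 0" using K[of 0] norm_ge_zero order_trans by blast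
  \<comment> \<open>The distance from 2 + it to s is 2 - Re s \<le> 3/2 - \<epsilon>; the maximum
    with 0 covers \<epsilon> > 3/2.\<close>
  define r where "r = max 0 (3/2 - \<epsilon>)"
  have r: "0 \<le> r" "r < 3/2" using \<epsilon> by (auto simp: r_def max_def)
  define D where "D = K + 2 * (25 * C + K + 1) * r / (3/2 - r)"
  have "cmod (F s) \<le> D * (1 + \<bar>Im s\<bar>)^2" if s: "1/2 + \<epsilon> \<le> Re s" "Re s \<le> 2" for s
  proof -
    define z where "z = Complex 2 (Im s)"
    define M where "M = C * (5 + \<bar>Im s\<bar>)^2"
    have "cmod (F s) \<le> K + 2 * (M + K + 1) * r / (3/2 - r)"
    proof (rule Borel_Caratheodory[where f=F and z=z])
      have Re_gt: "Re w > 1/2" if "w \<in> ball z (3/2)" for w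
        using that abs_Re_le_cmod[of "z - w"] by (auto simp: dist_norm z_def)
      show "F holomorphic_on ball z (3/2)" by (rule holomorphic_on_subset[OF hol]) (use Re_gt in auto)
      show "Re (F w) \<le> M" if w: "w \<in> ball z (3/2)" for w
      proof -
        have "cmod w \<le> 4 + \<bar>Im s\<bar>"
          using w norm_triangle_ineq2[of w z] cmod_le[of z] by (simp add: dist_norm z_def norm_minus_commute)
        hence le: "(1 + cmod w)^2 \<le> (5 + \<bar>Im s\<bar>)^2" by (intro power_mono) auto
        \<comment> \<open>Polynomial growth suffices here, so the real part is bounded by its own
          exponential instead of by a logarithm.\<close>
        have "Re (F w) < exp (Re (F w))" by (rule exp_gt_self)
        also have "\<dots> = cmod (zeta_reg w / (w + 1))" using ex[OF Re_gt[OF w]] norm_exp_eq_Re by metis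
        also have "\<dots> \<le> C * (1 + cmod w)^2" using Re_gt[OF w] by (intro C) auto
        also have "\<dots> \<le> M" unfolding M_def using le C(1) by (intro mult_left_mono) auto
        finally show ?thesis by simp
      qed
      show "cmod (F z) \<le> K" unfolding z_def by (rule K)
      show "M \<ge> 0" using C(1) by (simp add: M_def)
      have "dist z s = \<bar>2 - Re s\<bar>" by (simp add: dist_norm z_def cmod_def)
      thus "dist z s \<le> r" using s by (simp add: r_def)
    qed (use r in auto)
    also have "\<dots> \<le> D * (1 + \<bar>Im s\<bar>)^2"
    proof -
      define q where "q = (1 + \<bar>Im s\<bar>)^2"
      have q: "q \<ge> 1" by (simp add: q_def one_le_power)
      have "(5 + \<bar>Im s\<bar>)^2 \<le> (5 * (1 + \<bar>Im s\<bar>))^2" by (intro power_mono) auto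
      hence a: "(5 + \<bar>Im s\<bar>)^2 \<le> 25 * q" unfolding q_def power_mult_distrib by simp
      have M25: "M \<le> 25 * C * q" unfolding M_def using mult_left_mono[OF a, of C] C(1) by (simp only: mult_ac)
      have "M + K + 1 \<le> (25 * C + K + 1) * q"
        using M25 q K0 mult_left_mono[of 1 q K] by (simp add: algebra_simps)
      hence "2 * (M + K + 1) * r / (3/2 - r) \<le> 2 * ((25 * C + K + 1) * q) * r / (3/2 - r)"
        using r by (intro divide_right_mono mult_right_mono) auto
      moreover have "K \<le> K * q" using q K0 mult_left_mono[of 1 q K] by simp
      ultimately have "K + 2 * (M + K + 1) * r / (3/2 - r) \<le> K * q + 2 * ((25 * C + K + 1) * q) * r / (3/2 - r)"
        by linarith
      also have "\<dots> = D * q" by (simp add: D_def algebra_simps add_divide_distrib)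
      finally show ?thesis by (simp add: q_def)
    qed
    finally show ?thesis .
  qed
  moreover have "D \<ge> 0" using K0 r C(1) unfolding D_def
    by (intro add_nonneg_nonneg divide_nonneg_nonneg mult_nonneg_nonneg) auto
  ultimately show ?thesis by blast
qed


section \<open>The kernel and its Fourier transform\<close>

lemma integrable_gaussian:
  assumes "c > 0"
  shows "integrable lborel (\<lambda>x::real. exp (- c * x^2))"
proof -
  define v where "v = sqrt (1 / (2 * c))"
  have v: "v > 0" "v^2 = 1 / (2 * c)" using assms by (auto simp: v_def)
  have "integrable lborel (\<lambda>x. sqrt (2 * pi * v^2) * normal_density 0 v x)"
    using integrable_normal_density[of v 0] v by auto
  moreover have "sqrt (2 * pi * v^2) * normal_density 0 v x = exp (- c * x^2)" for x
    using v assms unfolding normal_density_def by (simp add: field_simps)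
  ultimately show ?thesis by (simp only:)
qed

text \<open>Completing the square, (c |x| - a)^2 \<ge> 0: half of the Gaussian exponent pays for the
  exponential factor.\<close>

lemma gaussian_absorb:
  fixes a c x :: real
  assumes "c > 0"
  shows "exp (a * \<bar>x\<bar>) * exp (- c * x^2) \<le> exp (a^2 / (2 * c)) * exp (- (c / 2) * x^2)"
proof -
  have "0 \<le> (c * \<bar>x\<bar> - a)^2 / (2 * c)" using assms by simp
  also have "\<dots> = a^2 / (2 * c) - (c / 2) * x^2 - (a * \<bar>x\<bar> - c * x^2)"
    using assms by (simp add: power2_diff power_mult_distrib field_simps power2_eq_square)
  finally have "a * \<bar>x\<bar> + - c * x^2 \<le> a^2 / (2 * c) + - (c / 2) * x^2" by simp
  thus ?thesis unfolding exp_add[symmetric] by simp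
qed

lemma integral_whole_line_FTC:
  fixes f P :: "real \<Rightarrow> complex"
  assumes int: "integrable lborel f" and cont: "continuous_on UNIV f"
    and P: "\<And>x. (P has_vector_derivative f x) (at x)"
  shows "(\<lambda>n. P (real n) - P (- real n)) \<longlonglongrightarrow> (LINT x|lborel. f x)"
proof -
  have "(\<lambda>n. LINT x|lborel. indicator {- real n..real n} x *\<^sub>R f x) \<longlonglongrightarrow> (LINT x|lborel. f x)"
  proof (rule integral_dominated_convergence[where w="\<lambda>x. norm (f x)"])
    show "AE x in lborel. (\<lambda>n. indicator {- real n..real n} x *\<^sub>R f x) \<longlonglongrightarrow> f x"
    proof (rule AE_I2)
      fix x :: real
      obtain N :: nat where N: "\<bar>x\<bar> \<le> real N" using real_arch_simple by blast
      show "(\<lambda>n. indicator {- real n..real n} x *\<^sub>R f x) \<longlonglongrightarrow> f x"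
        by (rule tendsto_eventually, rule eventually_sequentiallyI[of N]) (use N in \<open>auto simp: indicator_def\<close>)
    qed
    show "AE x in lborel. norm (indicator {- real n..real n} x *\<^sub>R f x) \<le> norm (f x)" for n
      by (intro AE_I2) (auto simp: indicator_def)
    show "integrable lborel (\<lambda>x. norm (f x))" using int by simp
  qed (use int in \<open>auto intro!: borel_measurable_scaleR\<close>)
  moreover have "(LINT x|lborel. indicator {- real n..real n} x *\<^sub>R f x) = P (real n) - P (- real n)" for n
    by (intro integral_FTC_atLeastAtMost has_vector_derivative_at_within[OF P] continuous_on_subset[OF cont]) auto
  ultimately show ?thesis by simp
qed

lemma integrable_gaussian_bound:
  fixes f :: "real \<Rightarrow> 'a::{banach, second_countable_topology}"
  assumes "c > 0" "f \<in> borel_measurable lborel" "\<And>x. norm (f x) \<le> C * exp (- c * x^2)"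
  shows "integrable lborel f"
proof (rule Bochner_Integration.integrable_bound)
  show "integrable lborel (\<lambda>x. C * exp (- c * x^2))" using integrable_gaussian[OF assms(1)] by simp
  show "AE x in lborel. norm (f x) \<le> norm (C * exp (- c * x\<^sup>2))"
    using assms(3) by (intro AE_I2) (auto intro: order_trans[OF _ abs_ge_self])
qed fact

lemma gaussian_tendsto_0:
  assumes "c > 0" shows "(\<lambda>n. C * exp (- c * (real n)^2)) \<longlonglongrightarrow> 0"
  using assms by real_asymp

text \<open>With a primitive P on the convex domain, both line integrals are limits of differences
  of P. These differ by the increments of P along the two vertical ends, which the mean value
  inequality bounds by a Gaussian in n.\<close>

lemma contour_shift:
  fixes f :: "complex \<Rightarrow> complex"
  assumes S: "open S" "convex S" and hol: "f holomorphic_on S" and y: "y \<ge> 0" and c: "c > 0"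
    and strip: "\<And>u. - y \<le> Im u \<Longrightarrow> Im u \<le> 0 \<Longrightarrow> u \<in> S"
    and bd: "\<And>u. - y \<le> Im u \<Longrightarrow> Im u \<le> 0 \<Longrightarrow> cmod (f u) \<le> C * exp (- c * (Re u)^2)"
  shows "(LINT x|lborel. f (of_real x)) = (LINT x|lborel. f (of_real x - \<i> * of_real y))"
proof -
  obtain P where P: "\<And>u. u \<in> S \<Longrightarrow> (P has_field_derivative f u) (at u)"
    using holomorphic_convex_primitive'[OF S(2,1) hol] S(1) by (metis at_within_open)
  have lim: "(\<lambda>n. P (of_real (real n) - \<i> * of_real b) - P (of_real (- real n) - \<i> * of_real b)) \<longlonglongrightarrow> (LINT x|lborel. f (of_real x - \<i> * of_real b))"
    if b: "0 \<le> b" "b \<le> y" for b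
  proof (rule integral_whole_line_FTC)
    show cont: "continuous_on UNIV (\<lambda>x. f (of_real x - \<i> * of_real b))"
      by (rule continuous_on_compose2[OF holomorphic_on_imp_continuous_on[OF hol]])
         (use b in \<open>auto intro!: continuous_intros strip\<close>)
    show "integrable lborel (\<lambda>x. f (of_real x - \<i> * of_real b))"
      by (rule integrable_gaussian_bound[OF c, where C=C])
         (use bd[of "of_real _ - \<i> * of_real b"] b cont in \<open>auto intro: borel_measurable_continuous_onI\<close>)
    fix x :: real
    have "((\<lambda>x. P (of_real x - \<i> * of_real b)) has_vector_derivative (1 * f (of_real x - \<i> * of_real b))) (at x)"
    proof (rule field_vector_diff_chain_at[where f="\<lambda>x::real. complex_of_real x - \<i> * of_real b" and g=P, unfolded o_def])
      show "((\<lambda>x. complex_of_real x - \<i> * of_real b) has_vector_derivative 1) (at x)"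
        by (auto intro!: derivative_eq_intros)
      show "(P has_field_derivative f (of_real x - \<i> * of_real b)) (at (of_real x - \<i> * of_real b))"
        using b by (intro P strip) auto
    qed
    thus "((\<lambda>x. P (of_real x - \<i> * of_real b)) has_vector_derivative f (of_real x - \<i> * of_real b)) (at x)" by simp
  qed
  have vert: "cmod (P (of_real x) - P (of_real x - \<i> * of_real y)) \<le> C * exp (- c * x^2) * y" for x :: real
  proof -
    have seg: "Re u = x \<and> - y \<le> Im u \<and> Im u \<le> 0" if "u \<in> closed_segment (of_real x - \<i> * of_real y) (of_real x)" for u
      using that y by (subst (asm) closed_segment_same_Re) (auto simp: closed_segment_eq_real_ivl)
    have "cmod (P (of_real x) - P (of_real x - \<i> * of_real y)) \<le> C * exp (- c * x^2) * cmod (of_real x - (of_real x - \<i> * of_real y))"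
    proof (rule field_differentiable_bound[where S="closed_segment (of_real x - \<i> * of_real y) (of_real x)" and f'=f])
      show "(P has_field_derivative f u) (at u within closed_segment (of_real x - \<i> * of_real y) (of_real x))"
        if "u \<in> closed_segment (of_real x - \<i> * of_real y) (of_real x)" for u
        using seg[OF that] by (intro has_field_derivative_at_within[OF P[OF strip]]) auto
      show "cmod (f u) \<le> C * exp (- c * x^2)" if "u \<in> closed_segment (of_real x - \<i> * of_real y) (of_real x)" for u
        using seg[OF that] bd[of u] by auto
    qed auto
    thus ?thesis using y by (simp add: norm_mult)
  qed
  have z: "(\<lambda>n. C * exp (- c * (real n)^2) * y) \<longlonglongrightarrow> 0"
    using tendsto_mult_left_zero[OF gaussian_tendsto_0[OF c, of C], of y] .
  have 1: "(\<lambda>n. P (of_real (real n)) - P (of_real (real n) - \<i> * of_real y)) \<longlonglongrightarrow> 0"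
    by (rule Lim_null_comparison[OF _ z]) (intro always_eventually allI vert)
  have 2: "(\<lambda>n. P (of_real (- real n)) - P (of_real (- real n) - \<i> * of_real y)) \<longlonglongrightarrow> 0"
    by (rule Lim_null_comparison[OF _ z]) (use vert[of "- real _"] in auto)
  have "(\<lambda>n. (P (of_real (real n)) - P (of_real (- real n))) - (P (of_real (real n) - \<i> * of_real y) - P (of_real (- real n) - \<i> * of_real y)))
      \<longlonglongrightarrow> (LINT x|lborel. f (of_real x)) - (LINT x|lborel. f (of_real x - \<i> * of_real y))"
    using lim[of 0] lim[of y] y by (intro tendsto_diff) auto
  moreover have "(\<lambda>n. (P (of_real (real n)) - P (of_real (- real n))) - (P (of_real (real n) - \<i> * of_real y) - P (of_real (- real n) - \<i> * of_real y))) \<longlonglongrightarrow> 0"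
    using tendsto_diff[OF 1 2] by (simp add: algebra_simps)
  ultimately show ?thesis using LIMSEQ_unique by fastforce
qed

section \<open>The kernel on the strip\<close>

definition dexp_kernel :: "real \<Rightarrow> real \<Rightarrow> complex \<Rightarrow> complex" where
  "dexp_kernel B \<eta> u = exp (- (of_real \<eta> * cosh (of_real pi * u)) - of_real B * u^2)"

lemma Re_cosh: "Re (cosh z) = cosh (Re z) * cos (Im z)"
  by (simp add: cosh_def Re_exp field_simps)

lemma holomorphic_kernel: "dexp_kernel B \<eta> holomorphic_on A"
proof -
  have "dexp_kernel B \<eta> = (\<lambda>u. exp (- (of_real \<eta> * ((exp (of_real pi * u) + exp (- (of_real pi * u))) / 2)) - of_real B * u^2))"
    by (simp add: dexp_kernel_def cosh_def scaleR_conv_of_real fun_eq_iff)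
  thus ?thesis by (simp only:) (intro holomorphic_intros; simp)
qed

lemma norm_kernel:
  "cmod (dexp_kernel B \<eta> u) = exp (- \<eta> * cosh (pi * Re u) * cos (pi * Im u) - B * ((Re u)^2 - (Im u)^2))"
proof -
  have "Re (u^2) = (Re u)^2 - (Im u)^2" by (simp add: power2_eq_square)
  thus ?thesis by (simp add: dexp_kernel_def Re_cosh)
qed

text \<open>In this strip the cosine of pi Im u is nonnegative, so the double exponential has
  modulus at most 1 and may be discarded. At |Im u| = 1/2 the cosine is 0 and the Gaussian is all
  that remains.\<close>

lemma norm_kernel_le:
  assumes "\<bar>Im u\<bar> \<le> 1/2" "\<eta> \<ge> 0" "B \<ge> 0"
  shows "cmod (dexp_kernel B \<eta> u) \<le> exp (B / 4) * exp (- B * (Re u)^2)"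
proof -
  have "cos (pi * Im u) \<ge> 0"
  proof (rule cos_ge_zero)
    have "Im u \<le> 1/2" "- (1/2) \<le> Im u" using assms by auto
    hence "pi * Im u \<le> pi * (1/2)" "pi * (- (1/2)) \<le> pi * Im u" by (intro mult_left_mono; simp)+
    thus "- (pi / 2) \<le> pi * Im u" "pi * Im u \<le> pi / 2" by auto
  qed
  hence "\<eta> * cosh (pi * Re u) * cos (pi * Im u) \<ge> 0" using assms by simp
  moreover have "B * (Im u)^2 \<le> B * (1/2)^2"
    using assms power_mono[OF assms(1), of 2] by (intro mult_left_mono) auto
  ultimately have "- \<eta> * cosh (pi * Re u) * cos (pi * Im u) - B * ((Re u)^2 - (Im u)^2) \<le> B / 4 + - B * (Re u)^2"
    by (simp add: algebra_simps power2_eq_square)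
  thus ?thesis unfolding norm_kernel exp_add[symmetric] by simp
qed

lemma kernel_of_real:
  "dexp_kernel B \<eta> (of_real x) = of_real (exp (- \<eta> * cosh (pi * x)) * exp (- B * x^2))"
proof -
  have "cosh (complex_of_real (pi * x)) = of_real (cosh (pi * x))"
    unfolding cosh_def by (simp add: scaleR_conv_of_real exp_of_real flip: of_real_minus of_real_mult)
  hence "- (of_real \<eta> * cosh (of_real pi * of_real x)) - of_real B * (of_real x)^2 = complex_of_real (- \<eta> * cosh (pi * x) + - B * x^2)"
    by simp
  thus ?thesis unfolding dexp_kernel_def exp_add[symmetric] by (simp only: exp_of_real)
qed

definition kernel_ft :: "real \<Rightarrow> real \<Rightarrow> real \<Rightarrow> complex" where
  "kernel_ft B \<eta> \<xi> = (LINT x|lborel. dexp_kernel B \<eta> (of_real x) * exp (- \<i> * of_real (x * \<xi>)))"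

text \<open>On the line Im u = -y the oscillating factor has modulus exp(-y \<xi>). For \<xi> = ln n
  this is n^(-y), the effect of moving a Dirichlet series by y.\<close>

lemma kernel_ft_shift:
  assumes "0 \<le> y" "y \<le> 1/2" "\<eta> \<ge> 0" "B > 0"
  shows "kernel_ft B \<eta> \<xi> = exp (- of_real (y * \<xi>)) *
    (LINT x|lborel. dexp_kernel B \<eta> (of_real x - \<i> * of_real y) * exp (- \<i> * of_real (x * \<xi>)))"
proof -
  have "kernel_ft B \<eta> \<xi> = (LINT x|lborel. dexp_kernel B \<eta> (of_real x) * exp (- \<i> * of_real x * of_real \<xi>))"
    by (simp add: kernel_ft_def mult.assoc)
  also have "\<dots> = (LINT x|lborel. dexp_kernel B \<eta> (of_real x - \<i> * of_real y) * exp (- \<i> * (of_real x - \<i> * of_real y) * of_real \<xi>))"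
  proof (rule contour_shift[where S=UNIV and c=B and f="\<lambda>u. dexp_kernel B \<eta> u * exp (- \<i> * u * of_real \<xi>)"
        and C="exp (B / 4) * exp \<bar>\<xi>\<bar>"])
    show "(\<lambda>u. dexp_kernel B \<eta> u * exp (- \<i> * u * of_real \<xi>)) holomorphic_on UNIV"
      by (intro holomorphic_intros holomorphic_kernel)
    fix u assume u: "- y \<le> Im u" "Im u \<le> 0"
    have "\<bar>Im u * \<xi>\<bar> \<le> 1 * \<bar>\<xi>\<bar>" unfolding abs_mult using u assms by (intro mult_right_mono) auto
    hence "cmod (exp (- \<i> * u * of_real \<xi>)) \<le> exp \<bar>\<xi>\<bar>" by (simp add: norm_exp_eq_Re)
    moreover have "cmod (dexp_kernel B \<eta> u) \<le> exp (B / 4) * exp (- B * (Re u)^2)"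
      using u assms by (intro norm_kernel_le) auto
    ultimately have "cmod (dexp_kernel B \<eta> u) * cmod (exp (- \<i> * u * of_real \<xi>)) \<le> exp (B / 4) * exp (- B * (Re u)^2) * exp \<bar>\<xi>\<bar>"
      by (intro mult_mono) auto
    thus "cmod (dexp_kernel B \<eta> u * exp (- \<i> * u * of_real \<xi>)) \<le> exp (B / 4) * exp \<bar>\<xi>\<bar> * exp (- B * (Re u)^2)"
      by (simp only: norm_mult mult_ac)
  qed (use assms in auto)
  also have "\<dots> = (LINT x|lborel. exp (- of_real (y * \<xi>)) * (dexp_kernel B \<eta> (of_real x - \<i> * of_real y) * exp (- \<i> * of_real (x * \<xi>))))"
  proof -
    have "exp (- \<i> * (of_real x - \<i> * of_real y) * of_real \<xi>) = exp (- of_real (y * \<xi>)) * exp (- \<i> * of_real (x * \<xi>))" for x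
    proof -
      have "- \<i> * (of_real x - \<i> * of_real y) * of_real \<xi> = - of_real (y * \<xi>) + - \<i> * of_real (x * \<xi>)"
        by (simp add: complex_eq_iff)
      thus ?thesis by (simp only: exp_add)
    qed
    thus ?thesis by (simp only: mult_ac)
  qed
  also have "\<dots> = exp (- of_real (y * \<xi>)) * (LINT x|lborel. dexp_kernel B \<eta> (of_real x - \<i> * of_real y) * exp (- \<i> * of_real (x * \<xi>)))"
    by (rule integral_mult_right_zero)
  finally show ?thesis .
qed

text \<open>The known value is sqrt(pi / B); the integral is kept as it stands because it serves as
  the positive unit in which the final inequalities are measured.\<close>

definition gauss_mass :: "real \<Rightarrow> real" where
  "gauss_mass B = (LINT x|lborel. exp (- B * x^2))"

lemma gauss_mass_pos:
  assumes "B > 0"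
  shows "gauss_mass B > 0"
proof -
  have "gauss_mass B \<noteq> 0"
  proof
    assume "gauss_mass B = 0"
    hence "AE x in lborel. exp (- B * x^2) = (0::real)"
      unfolding gauss_mass_def using integral_nonneg_eq_0_iff_AE[OF integrable_gaussian[OF assms]] by simp
    hence "AE x in (lborel :: real measure). False" by simp
    thus False by (simp add: ae_filter_eq_bot_iff eventually_False)
  qed
  moreover have "gauss_mass B \<ge> 0" unfolding gauss_mass_def by (rule Bochner_Integration.integral_nonneg) simp
  ultimately show ?thesis by simp
qed

lemma gaussian_ft:
  assumes "B > 0" "\<xi> \<ge> 0"
  shows "(LINT x|lborel. of_real (exp (- B * x^2)) * exp (- \<i> * of_real (x * \<xi>))) =
           complex_of_real (exp (- (\<xi>^2) / (4 * B)) * gauss_mass B)"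
proof -
  \<comment> \<open>The horizontal line through the saddle point of the exponent, on which the
    exponent is real.\<close>
  define y where "y = \<xi> / (2 * B)"
  have y: "y \<ge> 0" using assms by (simp add: y_def)
  define f where "f = (\<lambda>u::complex. exp (- of_real B * u^2 - \<i> * u * of_real \<xi>))"
  have "(LINT x|lborel. of_real (exp (- B * x^2)) * exp (- \<i> * of_real (x * \<xi>))) = (LINT x|lborel. f (of_real x))"
  proof (intro Bochner_Integration.integral_cong refl)
    fix x :: real
    have "complex_of_real (exp (- B * x^2)) = exp (- of_real B * of_real x ^ 2)" by (simp add: exp_of_real[symmetric])
    thus "of_real (exp (- B * x^2)) * exp (- \<i> * of_real (x * \<xi>)) = f (of_real x)"
      unfolding f_def by (simp add: exp_add[symmetric] mult.assoc)
  qed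
  also have "\<dots> = (LINT x|lborel. f (of_real x - \<i> * of_real y))"
  proof (rule contour_shift[where S=UNIV and c=B and C="exp (B * y^2)"])
    show "f holomorphic_on UNIV" unfolding f_def by (intro holomorphic_intros)
    fix u assume u: "- y \<le> Im u" "Im u \<le> 0"
    have "(Im u)^2 \<le> y^2" using u by (simp add: abs_le_square_iff[symmetric])
    hence "B * (Im u)^2 \<le> B * y^2" using assms by simp
    moreover have "Im u * \<xi> \<le> 0" using u assms by (simp add: mult_nonpos_nonneg)
    moreover have "Re (- of_real B * u^2 - \<i> * u * of_real \<xi>) = - B * (Re u)^2 + B * (Im u)^2 + Im u * \<xi>"
      by (simp add: power2_eq_square algebra_simps)
    ultimately have "Re (- of_real B * u^2 - \<i> * u * of_real \<xi>) \<le> B * y^2 + - B * (Re u)^2" by linarith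
    thus "cmod (f u) \<le> exp (B * y^2) * exp (- B * (Re u)^2)"
      unfolding f_def norm_exp_eq_Re exp_add[symmetric] by simp
  qed (use assms y in auto)
  also have "\<dots> = (LINT x|lborel. complex_of_real (exp (- (\<xi>^2) / (4 * B)) * exp (- B * x^2)))"
  proof (intro Bochner_Integration.integral_cong refl)
    fix x :: real
    have "- of_real B * (of_real x - \<i> * of_real y)^2 - \<i> * (of_real x - \<i> * of_real y) * of_real \<xi> =
        complex_of_real (- (\<xi>^2) / (4 * B) + - B * x^2)"
      using assms by (simp add: complex_eq_iff y_def power2_eq_square field_simps)
    thus "f (of_real x - \<i> * of_real y) = complex_of_real (exp (- (\<xi>^2) / (4 * B)) * exp (- B * x^2))"
      unfolding f_def exp_add[symmetric] by (simp only: exp_of_real)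
  qed
  also have "\<dots> = complex_of_real (exp (- (\<xi>^2) / (4 * B)) * gauss_mass B)"
    unfolding integral_complex_of_real gauss_mass_def by simp
  finally show ?thesis .
qed

lemma borel_measurable_kernel [measurable]:
  "(\<lambda>x. dexp_kernel B \<eta> (of_real x - \<i> * of_real y)) \<in> borel_measurable borel"
  by (intro borel_measurable_continuous_onI
        continuous_on_compose2[OF holomorphic_on_imp_continuous_on[OF holomorphic_kernel[where A=UNIV]]])
     (auto intro!: continuous_intros)

lemma borel_measurable_kernel_real [measurable]:
  "(\<lambda>x. dexp_kernel B \<eta> (of_real x)) \<in> borel_measurable borel"
  using borel_measurable_kernel[of B \<eta> 0] by simp

text \<open>From |exp(-\<eta> cosh) - 1| \<le> \<eta> cosh, the cosh being absorbed by the Gaussian.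
  Linearity in \<eta> with a constant independent of \<xi> is what permits treating the first
  \<open>M\<close> coefficients at once.\<close>

lemma kernel_ft_approx:
  assumes B: "B > 0"
  shows "\<exists>C\<ge>0. \<forall>\<eta>\<ge>0. \<forall>\<xi>\<ge>0. cmod (kernel_ft B \<eta> \<xi> - of_real (exp (- (\<xi>^2) / (4 * B)) * gauss_mass B)) \<le> C * \<eta>"
proof -
  define C where "C = (LINT x|lborel. cosh (pi * x) * exp (- B * x^2))"
  have cosh_le: "cosh (pi * x) \<le> exp (pi * \<bar>x\<bar>)" for x :: real
  proof -
    have "exp (pi * x) \<le> exp (pi * \<bar>x\<bar>)" "exp (- (pi * x)) \<le> exp (pi * \<bar>x\<bar>)"
      using mult_left_mono[of x "\<bar>x\<bar>" pi] mult_left_mono[of "-x" "\<bar>x\<bar>" pi] by auto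
    thus ?thesis by (simp add: cosh_def del: exp_le_cancel_iff)
  qed
  have int: "integrable lborel (\<lambda>x. cosh (pi * x) * exp (- B * x^2))"
  proof (rule integrable_gaussian_bound[where c="B/2" and C="exp (pi^2 / (2 * B))"])
    show "(\<lambda>x. cosh (pi * x) * exp (- B * x^2)) \<in> borel_measurable lborel"
      by (auto intro!: borel_measurable_continuous_onI continuous_intros)
    fix x :: real
    have "norm (cosh (pi * x) * exp (- B * x^2)) \<le> exp (pi * \<bar>x\<bar>) * exp (- B * x^2)"
      using cosh_le[of x] cosh_real_nonneg[of "pi * x"] by (simp add: abs_mult)
    also have "\<dots> \<le> exp (pi^2 / (2 * B)) * exp (- (B / 2) * x^2)" by (rule gaussian_absorb[OF B])
    finally show "norm (cosh (pi * x) * exp (- B * x^2)) \<le> exp (pi^2 / (2 * B)) * exp (- (B / 2) * x^2)" .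
  qed (use B in auto)
  have "cmod (kernel_ft B \<eta> \<xi> - of_real (exp (- (\<xi>^2) / (4 * B)) * gauss_mass B)) \<le> C * \<eta>" if \<eta>: "\<eta> \<ge> 0" and \<xi>: "\<xi> \<ge> 0" for \<eta> \<xi>
  proof -
    let ?e = "\<lambda>x. exp (- \<i> * of_real (x * \<xi>))"
    have ne: "cmod (?e x) = 1" for x by (simp add: norm_exp_eq_Re)
    have i1: "integrable lborel (\<lambda>x. dexp_kernel B \<eta> (of_real x) * ?e x)"
    proof (rule integrable_gaussian_bound[OF B, where C="exp (B/4)"])
      show "cmod (dexp_kernel B \<eta> (of_real x) * ?e x) \<le> exp (B / 4) * exp (- B * x\<^sup>2)" for x
        using norm_kernel_le[of "of_real x" \<eta> B] \<eta> B by (simp only: norm_mult ne) simp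
    qed measurable
    have i2: "integrable lborel (\<lambda>x. of_real (exp (- B * x^2)) * ?e x)"
    proof (rule integrable_gaussian_bound[OF B, where C=1])
      show "cmod (of_real (exp (- B * x^2)) * ?e x) \<le> 1 * exp (- B * x\<^sup>2)" for x
        by (simp only: norm_mult ne) simp
    qed measurable
    have "kernel_ft B \<eta> \<xi> - of_real (exp (- (\<xi>^2) / (4 * B)) * gauss_mass B) =
       (LINT x|lborel. dexp_kernel B \<eta> (of_real x) * ?e x - of_real (exp (- B * x^2)) * ?e x)"
      unfolding kernel_ft_def gaussian_ft[OF B \<xi>, symmetric] using i1 i2 by simp
    also have "cmod \<dots> \<le> (LINT x|lborel. \<eta> * (cosh (pi * x) * exp (- B * x^2)))"
    proof (rule Bochner_Integration.integral_norm_bound_integral)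
      show "integrable lborel (\<lambda>x. dexp_kernel B \<eta> (of_real x) * ?e x - of_real (exp (- B * x^2)) * ?e x)"
        using i1 i2 by simp
      show "integrable lborel (\<lambda>x. \<eta> * (cosh (pi * x) * exp (- B * x^2)))" using int by simp
      fix x :: real
      have "dexp_kernel B \<eta> (of_real x) * ?e x - of_real (exp (- B * x^2)) * ?e x =
         of_real ((exp (- \<eta> * cosh (pi * x)) - 1) * exp (- B * x^2)) * ?e x"
        by (simp add: kernel_of_real algebra_simps)
      hence "cmod (dexp_kernel B \<eta> (of_real x) * ?e x - of_real (exp (- B * x^2)) * ?e x) = \<bar>exp (- \<eta> * cosh (pi * x)) - 1\<bar> * exp (- B * x^2)"
        by (simp only: norm_mult ne norm_of_real abs_mult abs_exp_cancel mult_1_right)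
      also have "\<bar>exp (- \<eta> * cosh (pi * x)) - 1\<bar> \<le> \<eta> * cosh (pi * x)"
        using exp_ge_add_one_self[of "- \<eta> * cosh (pi * x)"] \<eta> by simp
      finally show "cmod (dexp_kernel B \<eta> (of_real x) * ?e x - of_real (exp (- B * x^2)) * ?e x) \<le> \<eta> * (cosh (pi * x) * exp (- B * x^2))"
        by (simp add: mult_right_mono mult.assoc)
    qed
    also have "\<dots> = C * \<eta>" by (simp add: C_def)
    finally show ?thesis .
  qed
  moreover have "C \<ge> 0" unfolding C_def by (intro Bochner_Integration.integral_nonneg) auto
  ultimately show ?thesis by blast
qed

text \<open>First and second derivative of the exponent of the kernel.\<close>

definition kernel_log' :: "real \<Rightarrow> real \<Rightarrow> complex \<Rightarrow> complex" where
  "kernel_log' B \<eta> u = - (of_real (\<eta> * pi) * sinh (of_real pi * u)) - 2 * of_real B * u"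

definition kernel_log'' :: "real \<Rightarrow> real \<Rightarrow> complex \<Rightarrow> complex" where
  "kernel_log'' B \<eta> u = - (of_real (\<eta> * pi^2) * cosh (of_real pi * u)) - 2 * of_real B"

lemma kernel_deriv:
  "(dexp_kernel B \<eta> has_field_derivative kernel_log' B \<eta> u * dexp_kernel B \<eta> u) (at u)"
proof -
  have "((\<lambda>u. exp (- (of_real \<eta> * cosh (of_real pi * u)) - of_real B * u^2)) has_field_derivative 
     kernel_log' B \<eta> u * exp (- (of_real \<eta> * cosh (of_real pi * u)) - of_real B * u^2)) (at u)"
    by (rule derivative_eq_intros refl)+ (simp add: kernel_log'_def algebra_simps)
  thus ?thesis by (simp add: dexp_kernel_def[abs_def])
qed

lemma kernel_log'_deriv:
  "(kernel_log' B \<eta> has_field_derivative kernel_log'' B \<eta> u) (at u)"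
  unfolding kernel_log'_def[abs_def]
  by (rule derivative_eq_intros refl)+ (simp add: kernel_log''_def algebra_simps power2_eq_square)

lemma norm_cosh_sinh_le:
  "cmod (cosh z) \<le> exp \<bar>Re z\<bar>" "cmod (sinh z) \<le> exp \<bar>Re z\<bar>"
proof -
  have e: "cmod (exp z) \<le> exp \<bar>Re z\<bar>" "cmod (exp (- z)) \<le> exp \<bar>Re z\<bar>" by (auto simp: norm_exp_eq_Re)
  show "cmod (cosh z) \<le> exp \<bar>Re z\<bar>"
    using norm_triangle_ineq[of "exp z" "exp (- z)"] e by (simp add: cosh_def del: norm_exp_eq_Re)
  show "cmod (sinh z) \<le> exp \<bar>Re z\<bar>"
    using norm_triangle_ineq4[of "exp z" "exp (- z)"] e by (simp add: sinh_def del: norm_exp_eq_Re)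
qed

text \<open>exp(-\<xi>/2) together with the weight n^(-1/2) gives only 1/n at \<xi> = ln n, which is
  not summable; the extra 1/\<xi>^2 yields the convergent 1/(n ln^2 n). Uniformity in \<eta> holds
  because derivatives of the exponent on Im u = -1/2 grow only exponentially, with coefficients
  bounded for \<eta> \<le> 1, and the Gaussian absorbs them.\<close>

lemma kernel_ft_bound:
  assumes B: "B > 0"
  shows "\<exists>C\<ge>0. \<forall>\<eta>. 0 \<le> \<eta> \<and> \<eta> \<le> 1 \<longrightarrow> (\<forall>\<xi>>0. cmod (kernel_ft B \<eta> \<xi>) \<le> C * exp (- \<xi> / 2) / \<xi>^2)"
proof -
  \<comment> \<open>\<open>Q\<close> collects the coefficients in the bound for l2 + l1^2, where l1
    and l2 are the derivatives of the exponent; \<open>R\<close> below is the price of absorbing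
    exp(2 pi |x|).\<close>
  define Q where "Q = (pi^2 + 2 * B) + (pi + 2 * B)^2"
  define R where "R = exp (B / 4) * exp ((2 * pi)^2 / (2 * B))"
  have Q: "Q \<ge> 0" using B by (simp add: Q_def)
  have abs_kernel: "exp (2 * pi * \<bar>x\<bar>) * cmod (dexp_kernel B \<eta> (of_real x - \<i> * of_real (1/2))) \<le> R * exp (- (B/2) * x^2)"
    if "\<eta> \<ge> 0" for x \<eta> :: real
  proof -
    have "exp (2 * pi * \<bar>x\<bar>) * cmod (dexp_kernel B \<eta> (of_real x - \<i> * of_real (1/2))) \<le> exp (2 * pi * \<bar>x\<bar>) * (exp (B/4) * exp (- B * x^2))"
      using norm_kernel_le[of "of_real x - \<i> * of_real (1/2)" \<eta> B] that B by (intro mult_left_mono) auto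
    also have "\<dots> = exp (B/4) * (exp (2 * pi * \<bar>x\<bar>) * exp (- B * x^2))" by (simp only: mult_ac)
    also have "\<dots> \<le> exp (B/4) * (exp ((2 * pi)^2 / (2 * B)) * exp (- (B/2) * x^2))"
      by (intro mult_left_mono gaussian_absorb B) auto
    finally show ?thesis by (simp only: R_def mult_ac)
  qed
  have "cmod (kernel_ft B \<eta> \<xi>) \<le> (Q * R * gauss_mass (B/2)) * exp (- \<xi> / 2) / \<xi>^2"
    if \<eta>: "0 \<le> \<eta>" "\<eta> \<le> 1" and \<xi>: "\<xi> > 0" for \<eta> \<xi>
  proof -
    define u where "u = (\<lambda>x::real. of_real x - \<i> * of_real (1/2) :: complex)"
    define k where "k = (\<lambda>x. dexp_kernel B \<eta> (u x))"
    define e where "e = (\<lambda>x::real. exp (- \<i> * of_real (x * \<xi>)))"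
    define l1 where "l1 = (\<lambda>x. kernel_log' B \<eta> (u x))"
    define l2 where "l2 = (\<lambda>x. kernel_log'' B \<eta> (u x))"
    have ne: "cmod (e x) = 1" for x by (simp add: e_def norm_exp_eq_Re)
    have e1: "exp (pi * \<bar>x\<bar>) \<le> exp (2 * pi * \<bar>x\<bar>)" "1 \<le> exp (2 * pi * \<bar>x\<bar>)" for x :: real by auto
    have e2: "exp (pi * \<bar>x\<bar>) ^ 2 = exp (2 * pi * \<bar>x\<bar>)" for x :: real
      by (simp add: exp_double mult.assoc)
    have pe: "cmod (of_real (\<eta> * pi)) \<le> 1 * pi" "cmod (of_real (\<eta> * pi^2)) \<le> 1 * pi^2"
      using \<eta> mult_right_mono[of \<eta> 1 pi] mult_right_mono[of \<eta> 1 "pi^2"] unfolding norm_of_real by (auto simp: abs_mult)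
    have nl1: "cmod (l1 x) \<le> (pi + 2 * B) * exp (pi * \<bar>x\<bar>)" for x
    proof -
      have "cmod (sinh (of_real pi * u x)) \<le> exp (pi * \<bar>x\<bar>)"
        using norm_cosh_sinh_le(2)[of "of_real pi * u x"] by (simp add: u_def abs_mult)
      hence "cmod (of_real (\<eta> * pi) * sinh (of_real pi * u x)) \<le> (1 * pi) * exp (pi * \<bar>x\<bar>)"
        unfolding norm_mult[of "of_real _" "sinh _"] by (intro mult_mono pe) auto
      moreover have "cmod (u x) \<le> exp (pi * \<bar>x\<bar>)"
      proof -
        have "cmod (u x) \<le> \<bar>x\<bar> + 1/2" using cmod_le[of "u x"] by (simp add: u_def)
        also have "\<dots> \<le> 1 + pi * \<bar>x\<bar>" using pi_gt3 mult_right_mono[of 1 pi "\<bar>x\<bar>"] by simp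
        also have "\<dots> \<le> exp (pi * \<bar>x\<bar>)" by (rule exp_ge_add_one_self)
        finally show ?thesis .
      qed
      hence "cmod (2 * of_real B * u x) \<le> (2 * B) * exp (pi * \<bar>x\<bar>)"
        unfolding norm_mult using B by (intro mult_mono) auto
      ultimately show ?thesis unfolding l1_def kernel_log'_def
        using norm_triangle_ineq4[of "- (of_real (\<eta> * pi) * sinh (of_real pi * u x))" "2 * of_real B * u x"]
        by (simp only: norm_minus_cancel ring_distribs; linarith)
    qed
    have nl2: "cmod (l2 x) \<le> (pi^2 + 2 * B) * exp (2 * pi * \<bar>x\<bar>)" for x
    proof -
      have "cmod (cosh (of_real pi * u x)) \<le> exp (2 * pi * \<bar>x\<bar>)"
        by (rule order_trans[OF norm_cosh_sinh_le(1) order_trans[OF _ e1(1)]]) (simp add: u_def abs_mult)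
      hence "cmod (of_real (\<eta> * pi^2) * cosh (of_real pi * u x)) \<le> (1 * pi^2) * exp (2 * pi * \<bar>x\<bar>)"
        unfolding norm_mult[of "of_real _" "cosh _"] by (intro mult_mono pe) auto
      moreover have "cmod (2 * of_real B) \<le> (2 * B) * exp (2 * pi * \<bar>x\<bar>)"
        using B e1(2)[of x] mult_left_mono[of 1 "exp (2 * pi * \<bar>x\<bar>)" "2 * B"] by (simp add: norm_mult)
      ultimately show ?thesis unfolding l2_def kernel_log''_def
        using norm_triangle_ineq4[of "- (of_real (\<eta> * pi^2) * cosh (of_real pi * u x))" "2 * of_real B"]
        by (simp only: norm_minus_cancel ring_distribs; linarith)
    qed
    have nq: "cmod ((l2 x + l1 x ^ 2) * k x * e x) \<le> Q * R * exp (- (B/2) * x^2)" for x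
    proof -
      have "cmod (l1 x ^ 2) \<le> (pi + 2 * B)^2 * exp (2 * pi * \<bar>x\<bar>)"
        unfolding norm_power e2[symmetric] power_mult_distrib[symmetric] by (intro power_mono nl1) auto
      hence "cmod (l2 x + l1 x ^ 2) \<le> Q * exp (2 * pi * \<bar>x\<bar>)"
        using nl2[of x] norm_triangle_ineq[of "l2 x" "l1 x ^ 2"] by (simp only: Q_def ring_distribs; linarith)
      hence "cmod ((l2 x + l1 x ^ 2) * k x * e x) \<le> Q * exp (2 * pi * \<bar>x\<bar>) * cmod (k x)"
        unfolding norm_mult ne mult_1_right by (intro mult_right_mono) auto
      also have "\<dots> \<le> Q * (R * exp (- (B/2) * x^2))"
        unfolding mult.assoc[of Q] k_def u_def using \<eta> Q by (intro mult_left_mono abs_kernel) auto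
      finally show ?thesis by (simp only: mult.assoc)
    qed
    have nk: "cmod (k x) \<le> R * exp (- (B/2) * x^2)" for x
      using abs_kernel[OF \<eta>(1), of x] mult_right_mono[OF e1(2)[of x] norm_ge_zero[of "k x"]] unfolding k_def u_def by linarith
    have hol: "(\<lambda>z. (kernel_log'' B \<eta> z + kernel_log' B \<eta> z ^ 2) * dexp_kernel B \<eta> z) holomorphic_on UNIV"
      unfolding kernel_log'_def[abs_def] kernel_log''_def[abs_def] sinh_def cosh_def scaleR_conv_of_real
      by (intro holomorphic_intros holomorphic_kernel)
    have cont_q: "continuous_on UNIV (\<lambda>x. (l2 x + l1 x ^ 2) * k x * e x)"
    proof -
      have "continuous_on UNIV (\<lambda>x. (l2 x + l1 x ^ 2) * k x)"
        unfolding l2_def l1_def k_def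
        by (rule continuous_on_compose2[OF holomorphic_on_imp_continuous_on[OF hol], where f=u])
           (auto simp: u_def intro!: continuous_intros)
      moreover have "continuous_on UNIV e" unfolding e_def by (intro continuous_intros)
      ultimately show ?thesis by (rule continuous_on_mult)
    qed
    have cont_k: "continuous_on UNIV (\<lambda>x. k x * e x)"
    proof -
      have "continuous_on UNIV k" unfolding k_def
        by (rule continuous_on_compose2[OF holomorphic_on_imp_continuous_on[OF holomorphic_kernel[where A=UNIV]], where f=u])
           (auto simp: u_def intro!: continuous_intros)
      moreover have "continuous_on UNIV e" unfolding e_def by (intro continuous_intros)
      ultimately show ?thesis by (rule continuous_on_mult)
    qed
    have int_q: "integrable lborel (\<lambda>x. (l2 x + l1 x ^ 2) * k x * e x)"
      by (rule integrable_gaussian_bound[where c="B/2" and C="Q * R"])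
         (use B nq cont_q in \<open>auto intro: borel_measurable_continuous_onI\<close>)
    have int_k: "integrable lborel (\<lambda>x. k x * e x)"
      by (rule integrable_gaussian_bound[where c="B/2" and C="R"])
         (use B nk cont_k in \<open>auto simp: norm_mult ne intro: borel_measurable_continuous_onI\<close>)
    \<comment> \<open>Both integrations by parts at once: W = (k' + i \<xi> k) e with e' = -i \<xi>
      e, hence W' = (k'' + \<xi>^2 k) e, and k'' = (l2 + l1^2) k. Since W vanishes at both ends, the
      integral of W' is 0.\<close>
    define W where "W = (\<lambda>x. (l1 x + \<i> * of_real \<xi>) * k x * e x)"
    have der: "(W has_vector_derivative ((l2 x + l1 x ^ 2) * k x * e x + of_real (\<xi>^2) * (k x * e x))) (at x)" for x
    proof -
      have du: "(u has_vector_derivative 1) (at x)" unfolding u_def by (auto intro!: derivative_eq_intros)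
      have d1: "(l1 has_vector_derivative 1 * l2 x) (at x)"
        unfolding l1_def l2_def by (rule field_vector_diff_chain_at[OF du kernel_log'_deriv, unfolded o_def])
      have d2: "(k has_vector_derivative 1 * (l1 x * k x)) (at x)"
        unfolding l1_def k_def by (rule field_vector_diff_chain_at[OF du kernel_deriv, unfolded o_def])
      have d3: "(e has_vector_derivative (- \<i> * of_real \<xi>) * e x) (at x)"
        unfolding e_def
        by (rule derivative_eq_intros has_vector_derivative_real_field refl | simp)+
      have "(W has_vector_derivative (((l1 x + \<i> * of_real \<xi>) * k x) * ((- \<i> * of_real \<xi>) * e x) +
          ((l1 x + \<i> * of_real \<xi>) * (1 * (l1 x * k x)) + (1 * l2 x + 0) * k x) * e x)) (at x)"
        unfolding W_def
        by (intro has_vector_derivative_mult has_vector_derivative_add has_vector_derivative_const d1 d2 d3)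
      moreover have "(((l1 x + \<i> * of_real \<xi>) * k x) * ((- \<i> * of_real \<xi>) * e x) +
          ((l1 x + \<i> * of_real \<xi>) * (1 * (l1 x * k x)) + (1 * l2 x + 0) * k x) * e x) =
         (l2 x + l1 x ^ 2) * k x * e x + of_real (\<xi>^2) * (k x * e x)"
        by (simp add: power2_eq_square algebra_simps)
      ultimately show ?thesis by (simp only:)
    qed
    have nW: "cmod (W x) \<le> (pi + 2 * B + \<xi>) * R * exp (- (B/2) * x^2)" for x
    proof -
      have "cmod (l1 x + \<i> * of_real \<xi>) \<le> (pi + 2 * B) * exp (pi * \<bar>x\<bar>) + \<xi>"
        using nl1[of x] norm_triangle_ineq[of "l1 x" "\<i> * of_real \<xi>"] \<xi> by (simp add: norm_mult)
      also have "\<dots> \<le> (pi + 2 * B) * exp (2 * pi * \<bar>x\<bar>) + \<xi> * exp (2 * pi * \<bar>x\<bar>)"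
        using e1[of x] \<xi> B mult_left_mono[OF e1(2)[of x], of \<xi>] by (intro add_mono mult_left_mono) auto
      finally have "cmod (l1 x + \<i> * of_real \<xi>) \<le> (pi + 2 * B + \<xi>) * exp (2 * pi * \<bar>x\<bar>)" by (simp only: ring_distribs)
      hence "cmod (W x) \<le> (pi + 2 * B + \<xi>) * exp (2 * pi * \<bar>x\<bar>) * cmod (k x)"
        unfolding W_def norm_mult ne mult_1_right by (intro mult_right_mono) auto
      also have "\<dots> \<le> (pi + 2 * B + \<xi>) * (R * exp (- (B/2) * x^2))"
        unfolding mult.assoc[of "pi + 2 * B + \<xi>"] k_def u_def using \<eta> \<xi> B by (intro mult_left_mono abs_kernel) auto
      finally show ?thesis by (simp only: mult.assoc)
    qed
    have z: "(\<lambda>n. (pi + 2 * B + \<xi>) * R * exp (- (B/2) * (real n)^2)) \<longlonglongrightarrow> 0"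
      using B by (intro gaussian_tendsto_0) auto
    have W1: "(\<lambda>n. W (real n)) \<longlonglongrightarrow> 0"
      by (rule Lim_null_comparison[OF _ z]) (intro always_eventually allI nW)
    have W2: "(\<lambda>n. W (- real n)) \<longlonglongrightarrow> 0"
      by (rule Lim_null_comparison[OF _ z]) (use nW[of "- real _"] in auto)
    have "(\<lambda>n. W (real n) - W (- real n)) \<longlonglongrightarrow> (LINT x|lborel. (l2 x + l1 x ^ 2) * k x * e x + of_real (\<xi>^2) * (k x * e x))"
      by (rule integral_whole_line_FTC[OF Bochner_Integration.integrable_add[OF int_q integrable_mult_right[OF int_k]]
              continuous_on_add[OF cont_q continuous_on_mult[OF continuous_on_const cont_k]] der])
    moreover have "(\<lambda>n. W (real n) - W (- real n)) \<longlonglongrightarrow> 0" using tendsto_diff[OF W1 W2] by simp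
    ultimately have "(LINT x|lborel. (l2 x + l1 x ^ 2) * k x * e x + of_real (\<xi>^2) * (k x * e x)) = 0"
      using LIMSEQ_unique by blast
    hence "of_real (\<xi>^2) * (LINT x|lborel. k x * e x) = - (LINT x|lborel. (l2 x + l1 x ^ 2) * k x * e x)"
      using int_q int_k by (simp add: eq_neg_iff_add_eq_0 add.commute)
    hence "cmod (of_real (\<xi>^2) * (LINT x|lborel. k x * e x)) = cmod (LINT x|lborel. (l2 x + l1 x ^ 2) * k x * e x)" by simp
    also have "\<dots> \<le> (LINT x|lborel. Q * R * exp (- (B/2) * x^2))"
      using B nq integrable_gaussian[of "B/2"]
      by (intro Bochner_Integration.integral_norm_bound_integral int_q) auto
    also have "\<dots> = Q * R * gauss_mass (B/2)" by (simp add: gauss_mass_def)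
    finally have "\<xi>^2 * cmod (LINT x|lborel. k x * e x) \<le> Q * R * gauss_mass (B/2)"
      by (simp add: norm_mult norm_power)
    hence I: "cmod (LINT x|lborel. k x * e x) \<le> Q * R * gauss_mass (B/2) / \<xi>^2"
      using \<xi> by (simp add: field_simps)
    have "kernel_ft B \<eta> \<xi> = exp (- of_real ((1/2) * \<xi>)) * (LINT x|lborel. k x * e x)"
      unfolding k_def u_def e_def using \<eta> B by (intro kernel_ft_shift) auto
    hence "cmod (kernel_ft B \<eta> \<xi>) = exp (- \<xi> / 2) * cmod (LINT x|lborel. k x * e x)"
      by (simp add: norm_mult norm_exp_eq_Re)
    also have "\<dots> \<le> exp (- \<xi> / 2) * (Q * R * gauss_mass (B/2) / \<xi>^2)"
      by (intro mult_left_mono I) auto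
    finally show ?thesis by (simp add: mult_ac)
  qed
  moreover have "Q * R * gauss_mass (B/2) \<ge> 0"
    using Q gauss_mass_pos[of "B/2"] B by (simp add: R_def)
  ultimately show ?thesis by blast
qed


section \<open>Averages of the logarithm\<close>

lemma one_plus_power_le_exp: "(1 + \<bar>x\<bar>) ^ k \<le> exp (real k * \<bar>x\<bar>)" for x :: real
proof -
  have "(1 + \<bar>x\<bar>) ^ k \<le> exp \<bar>x\<bar> ^ k" by (intro power_mono exp_ge_add_one_self) auto
  thus ?thesis by (simp add: exp_of_nat_mult)
qed

lemma Suc_powr_Complex:
  "of_nat (Suc n) powr (- Complex a b) = of_real (real (Suc n) powr (- a)) * exp (- \<i> * of_real (b * ln (real (Suc n))))"
proof -
  have Ln: "Ln (of_nat (Suc n)) = of_real (ln (real (Suc n)))" by (rule Ln_of_nat) simp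
  have "- Complex a b * of_real (ln (real (Suc n))) = of_real (- a * ln (real (Suc n))) + - \<i> * of_real (b * ln (real (Suc n)))"
    by (simp add: complex_eq_iff)
  hence "of_nat (Suc n) powr (- Complex a b) = exp (of_real (- a * ln (real (Suc n))) + - \<i> * of_real (b * ln (real (Suc n))))"
    unfolding powr_def Ln using of_nat_neq_0[of n, where ?'a=complex] by (simp only: if_False)
  also have "\<dots> = of_real (exp (- a * ln (real (Suc n)))) * exp (- \<i> * of_real (b * ln (real (Suc n))))"
    by (simp only: exp_add exp_of_real)
  finally show ?thesis by (simp add: powr_def del: of_nat_Suc)
qed

lemma norm_exp_i [simp]: "cmod (exp (- \<i> * of_real x)) = 1"
  by (simp add: norm_exp_eq_Re)

text \<open>The shift by 1/2 - \<epsilon>/2 lands on Re s = 1 + \<epsilon>/2, still inside absolute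
  convergence, while the kernel argument stays within its strip.\<close>

lemma holomorphic_times_kernel_shift:
  assumes hol: "F holomorphic_on {s. Re s > 1/2}"
    and growth: "\<And>s. 1/2 + \<epsilon> \<le> Re s \<Longrightarrow> Re s \<le> 2 \<Longrightarrow> cmod (F s) \<le> C * (1 + \<bar>Im s\<bar>)^2"
    and C: "C \<ge> 0" and \<epsilon>: "0 < \<epsilon>" "\<epsilon> \<le> 1/2" and B: "B > 0" and \<eta>: "\<eta> \<ge> 0" and y: "y = 1/2 - \<epsilon>/2"
  shows "(LINT x|lborel. F (Complex (1/2 + \<epsilon>) (\<tau> + x)) * dexp_kernel B \<eta> (of_real x)) =
         (LINT x|lborel. F (Complex (1 + \<epsilon>/2) (\<tau> + x)) * dexp_kernel B \<eta> (of_real x - \<i> * of_real y))" (is ?eq)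
    and "integrable lborel (\<lambda>x. F (Complex (1/2 + \<epsilon>) (\<tau> + x)) * dexp_kernel B \<eta> (of_real x))" (is ?int1)
    and "integrable lborel (\<lambda>x. F (Complex (1 + \<epsilon>/2) (\<tau> + x)) * dexp_kernel B \<eta> (of_real x - \<i> * of_real y))" (is ?int2)
proof -
  define f where "f = (\<lambda>u. F (Complex (1/2 + \<epsilon>) \<tau> + \<i> * u) * dexp_kernel B \<eta> u)"
  \<comment> \<open>In the variable u, the half-plane Re s > 1/2 becomes Im u < \<epsilon>.\<close>
  define S where "S = {u. Im u < \<epsilon>}"
  define D where "D = C * (1 + \<bar>\<tau>\<bar>)^2 * exp (B/4) * exp (2^2 / (2 * B))"
  have S: "open S" "convex S" unfolding S_def by (auto simp: open_halfspace_Im_lt convex_halfspace_Im_lt)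
  have hol_f: "f holomorphic_on S" unfolding f_def
    by (intro holomorphic_intros holomorphic_kernel holomorphic_on_compose_gen[OF _ hol, unfolded o_def])
       (auto intro!: holomorphic_intros simp: S_def)
  have bd: "cmod (f u) \<le> D * exp (- (B/2) * (Re u)^2)" if u: "- y \<le> Im u" "Im u \<le> 0" for u
  proof -
    have "cmod (F (Complex (1/2 + \<epsilon>) \<tau> + \<i> * u)) \<le> C * (1 + \<bar>\<tau> + Re u\<bar>)^2"
      using growth[of "Complex (1/2 + \<epsilon>) \<tau> + \<i> * u"] u \<epsilon> y by simp
    also have "1 + \<bar>\<tau> + Re u\<bar> \<le> (1 + \<bar>\<tau>\<bar>) * (1 + \<bar>Re u\<bar>)"
      using abs_triangle_ineq[of \<tau> "Re u"] mult_nonneg_nonneg[OF abs_ge_zero abs_ge_zero, of \<tau> "Re u"] by (simp only: ring_distribs mult_1 mult_1_right; linarith)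
    hence "C * (1 + \<bar>\<tau> + Re u\<bar>)^2 \<le> C * ((1 + \<bar>\<tau>\<bar>) * (1 + \<bar>Re u\<bar>))^2"
      using C by (intro mult_left_mono power_mono) auto
    also have "\<dots> \<le> C * ((1 + \<bar>\<tau>\<bar>)^2 * exp (2 * \<bar>Re u\<bar>))"
      unfolding power_mult_distrib using one_plus_power_le_exp[of "Re u" 2] C by (intro mult_left_mono) auto
    finally have 1: "cmod (F (Complex (1/2 + \<epsilon>) \<tau> + \<i> * u)) \<le> C * ((1 + \<bar>\<tau>\<bar>)^2 * exp (2 * \<bar>Re u\<bar>))" .
    have 2: "cmod (dexp_kernel B \<eta> u) \<le> exp (B / 4) * exp (- B * (Re u)^2)"
      using u y \<epsilon> \<eta> B by (intro norm_kernel_le) auto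
    have "cmod (f u) \<le> (C * ((1 + \<bar>\<tau>\<bar>)^2 * exp (2 * \<bar>Re u\<bar>))) * (exp (B / 4) * exp (- B * (Re u)^2))"
      unfolding f_def norm_mult using C by (intro mult_mono 1 2) auto
    also have "\<dots> = C * (1 + \<bar>\<tau>\<bar>)^2 * exp (B/4) * (exp (2 * \<bar>Re u\<bar>) * exp (- B * (Re u)^2))" by (simp only: mult_ac)
    also have "\<dots> \<le> C * (1 + \<bar>\<tau>\<bar>)^2 * exp (B/4) * (exp (2^2 / (2 * B)) * exp (- (B/2) * (Re u)^2))"
      using C by (intro mult_left_mono gaussian_absorb B) auto
    finally show ?thesis by (simp only: D_def mult_ac)
  qed
  have f0: "f (of_real x) = F (Complex (1/2 + \<epsilon>) (\<tau> + x)) * dexp_kernel B \<eta> (of_real x)" for x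
  proof -
    have "Complex (1/2 + \<epsilon>) \<tau> + \<i> * of_real x = Complex (1/2 + \<epsilon>) (\<tau> + x)" by (simp add: complex_eq_iff)
    thus ?thesis unfolding f_def by (simp only:)
  qed
  have fy: "f (of_real x - \<i> * of_real y) = F (Complex (1 + \<epsilon>/2) (\<tau> + x)) * dexp_kernel B \<eta> (of_real x - \<i> * of_real y)" for x
  proof -
    have "Complex (1/2 + \<epsilon>) \<tau> + \<i> * (of_real x - \<i> * of_real y) = Complex (1 + \<epsilon>/2) (\<tau> + x)"
      by (simp add: complex_eq_iff y)
    thus ?thesis unfolding f_def by (simp only:)
  qed
  have int: "integrable lborel (\<lambda>x. f (of_real x - \<i> * of_real b))" if b: "0 \<le> b" "b \<le> y" for b
  proof (rule integrable_gaussian_bound[where c="B/2" and C=D])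
    have "continuous_on UNIV (\<lambda>x. f (of_real x - \<i> * of_real b))"
      by (rule continuous_on_compose2[OF holomorphic_on_imp_continuous_on[OF hol_f]])
         (use b \<epsilon> in \<open>auto intro!: continuous_intros simp: S_def\<close>)
    thus "(\<lambda>x. f (of_real x - \<i> * of_real b)) \<in> borel_measurable lborel" by (auto intro: borel_measurable_continuous_onI)
    show "cmod (f (of_real x - \<i> * of_real b)) \<le> D * exp (- (B/2) * x^2)" for x
      using bd[of "of_real x - \<i> * of_real b"] b by simp
  qed (use B in auto)
  have "(LINT x|lborel. f (of_real x)) = (LINT x|lborel. f (of_real x - \<i> * of_real y))"
    by (rule contour_shift[OF S hol_f, where c="B/2" and C=D]) (use bd B y \<epsilon> in \<open>auto simp: S_def\<close>)
  thus ?eq by (simp only: f0 fy)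
  show ?int1 using int[of 0] y \<epsilon> by (simp add: f0)
  have "0 \<le> y" using y \<epsilon> by simp
  from int[OF this order_refl] show ?int2 by (simp only: fy)
qed

text \<open>Integrate termwise on the line of absolute convergence and then move each term back
  separately, which is possible because every n^(-s) is entire: n^(-1-\<epsilon>/2) n^y =
  n^(-1/2-\<epsilon>).\<close>

lemma kernel_series:
  assumes c: "\<And>n. \<bar>c n\<bar> \<le> 1" and \<epsilon>: "0 < \<epsilon>" "\<epsilon> \<le> 1/2" and B: "B > 0" and \<eta>: "\<eta> \<ge> 0" and y: "y = 1/2 - \<epsilon>/2"
  shows "(\<lambda>n. of_real (c n) * of_nat (Suc n) powr (- Complex (1/2 + \<epsilon>) \<tau>) * kernel_ft B \<eta> (ln (real (Suc n)))) sums
    (LINT x|lborel. dirichlet c (Complex (1 + \<epsilon>/2) (\<tau> + x)) * dexp_kernel B \<eta> (of_real x - \<i> * of_real y))"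
    and "integrable lborel (\<lambda>x. dirichlet c (Complex (1 + \<epsilon>/2) (\<tau> + x)) * dexp_kernel B \<eta> (of_real x - \<i> * of_real y))"
proof -
  define k where "k = (\<lambda>x. dexp_kernel B \<eta> (of_real x - \<i> * of_real y))"
  define f where "f = (\<lambda>n x. of_real (c n) * of_nat (Suc n) powr (- Complex (1 + \<epsilon>/2) (\<tau> + x)) * k x)"
  have nk: "cmod (k x) \<le> exp (B/4) * exp (- B * x^2)" for x
    unfolding k_def using norm_kernel_le[of "of_real x - \<i> * of_real y" \<eta> B] y \<epsilon> \<eta> B by simp
  have mk [measurable]: "k \<in> borel_measurable borel" unfolding k_def by measurable
  have ik: "integrable lborel k" by (rule integrable_gaussian_bound[OF B, of k "exp (B/4)"]) (use nk in auto)
  have f_eq: "f n x = of_real (c n) * of_nat (Suc n) powr (- Complex (1 + \<epsilon>/2) \<tau>) * (k x * exp (- \<i> * of_real (x * ln (real (Suc n)))))" for n x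
  proof -
    have "exp (- \<i> * of_real ((\<tau> + x) * ln (real (Suc n)))) = exp (- \<i> * of_real (\<tau> * ln (real (Suc n)))) * exp (- \<i> * of_real (x * ln (real (Suc n))))"
      unfolding exp_add[symmetric] by (simp add: ring_distribs del: of_nat_Suc)
    thus ?thesis unfolding f_def Suc_powr_Complex by (simp only: mult_ac)
  qed
  have nf: "cmod (f n x) = \<bar>c n\<bar> * real (Suc n) powr (- (1 + \<epsilon>/2)) * cmod (k x)" for n x
    unfolding f_def norm_mult[of _ "k x"] norm_dirichlet_term by (simp del: of_nat_Suc)
  have ike: "integrable lborel (\<lambda>x. k x * exp (- \<i> * of_real (x * ln (real (Suc n)))))" for n
    by (rule Bochner_Integration.integrable_bound[OF ik]) (auto simp: norm_mult simp del: of_nat_Suc)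
  have int_f: "integrable lborel (f n)" for n
    unfolding f_eq by (intro integrable_mult_right ike)
  have sums: "(\<lambda>n. f n x) sums (dirichlet c (Complex (1 + \<epsilon>/2) (\<tau> + x)) * k x)" for x
    unfolding f_def using \<epsilon> by (intro sums_mult2 summable_dirichlet c) auto
  have sm: "summable (\<lambda>n. \<bar>c n\<bar> * real (Suc n) powr (- (1 + \<epsilon>/2)))"
    using summable_dirichlet(1)[of c "Complex (1 + \<epsilon>/2) 0", OF c] \<epsilon> unfolding norm_dirichlet_term by simp
  have sn: "AE x in lborel. summable (\<lambda>n. norm (f n x))"
    unfolding nf by (intro AE_I2 summable_mult2 sm)
  have si: "summable (\<lambda>n. LINT x|lborel. norm (f n x))"
    unfolding nf using sm by (simp del: of_nat_Suc add: summable_mult2)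
  have suminf: "(\<Sum>n. f n x) = dirichlet c (Complex (1 + \<epsilon>/2) (\<tau> + x)) * k x" for x
    using sums[of x] by (simp add: sums_iff)
  have int_n: "(LINT x|lborel. f n x) = of_real (c n) * of_nat (Suc n) powr (- Complex (1/2 + \<epsilon>) \<tau>) * kernel_ft B \<eta> (ln (real (Suc n)))" for n
  proof -
    define \<xi> where "\<xi> = ln (real (Suc n))"
    have "kernel_ft B \<eta> \<xi> = exp (- of_real (y * \<xi>)) * (LINT x|lborel. k x * exp (- \<i> * of_real (x * \<xi>)))"
      unfolding k_def using y \<epsilon> \<eta> B by (intro kernel_ft_shift) auto
    hence "(LINT x|lborel. k x * exp (- \<i> * of_real (x * \<xi>))) = exp (of_real (y * \<xi>)) * kernel_ft B \<eta> \<xi>"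
      by (simp add: exp_minus field_simps)
    also have "exp (of_real (y * \<xi>)) = complex_of_real (real (Suc n) powr y)"
      unfolding exp_of_real by (simp add: powr_def \<xi>_def del: of_nat_Suc)
    finally have "(LINT x|lborel. f n x) = of_real (c n) * of_nat (Suc n) powr (- Complex (1 + \<epsilon>/2) \<tau>) * (of_real (real (Suc n) powr y) * kernel_ft B \<eta> \<xi>)"
      unfolding f_eq \<xi>_def by (simp del: of_nat_Suc)
    also have "\<dots> = of_real (c n) * (of_nat (Suc n) powr (- Complex (1 + \<epsilon>/2) \<tau>) * of_real (real (Suc n) powr y)) * kernel_ft B \<eta> \<xi>"
      by (simp only: mult.assoc)
    also have "of_nat (Suc n) powr (- Complex (1 + \<epsilon>/2) \<tau>) * of_real (real (Suc n) powr y) = of_nat (Suc n) powr (- Complex (1/2 + \<epsilon>) \<tau>)"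
    proof -
      have "- (1/2 + \<epsilon>) = - (1 + \<epsilon>/2) + y" by (simp add: y field_simps)
      hence "real (Suc n) powr (- (1/2 + \<epsilon>)) = real (Suc n) powr (- (1 + \<epsilon>/2)) * real (Suc n) powr y"
        by (simp only: powr_add)
      thus ?thesis unfolding Suc_powr_Complex by (simp only: of_real_mult mult_ac)
    qed
    finally show ?thesis by (simp only: \<xi>_def)
  qed
  show "(\<lambda>n. of_real (c n) * of_nat (Suc n) powr (- Complex (1/2 + \<epsilon>) \<tau>) * kernel_ft B \<eta> (ln (real (Suc n)))) sums
    (LINT x|lborel. dirichlet c (Complex (1 + \<epsilon>/2) (\<tau> + x)) * dexp_kernel B \<eta> (of_real x - \<i> * of_real y))"
    using sums_integral[OF int_f sn si] unfolding suminf int_n by (simp only: k_def)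
  show "integrable lborel (\<lambda>x. dirichlet c (Complex (1 + \<epsilon>/2) (\<tau> + x)) * dexp_kernel B \<eta> (of_real x - \<i> * of_real y))"
    using integrable_suminf[OF int_f sn si] unfolding suminf by (simp only: k_def)
qed

text \<open>For |x| \<le> \<tau>/2 the point is far from the pole and the logarithm is O(1/\<tau>).
  Otherwise it may come within \<epsilon>/2 of the pole, but then |x| is large, and powers of 1 +
  |x| pay both for 1/\<epsilon> = \<tau>^3 and for the gain 1/\<tau>.\<close>

lemma pole_factor_bound:
  assumes \<tau>: "\<tau> \<ge> 8" and \<epsilon>: "\<epsilon> = 1 / \<tau>^3"
  shows "cmod (Ln (1 - 2 / (Complex (1 + \<epsilon>/2) (\<tau> + x) + 1))) \<le> 160 / \<tau> * exp (5 * \<bar>x\<bar>)"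
proof -
  define s where "s = Complex (1 + \<epsilon>/2) (\<tau> + x)"
  have t3: "\<tau>^3 \<ge> 1" using \<tau> by (intro one_le_power) auto
  have e: "0 < \<epsilon>" "\<epsilon> \<le> 1" using \<tau> t3 by (auto simp: \<epsilon> divide_le_eq)
  have e1: "exp (5 * \<bar>x\<bar>) \<ge> 1" by simp
  show ?thesis
  proof (cases "\<bar>x\<bar> \<le> \<tau> / 2")
    case True
    define w where "w = - (2 / (s + 1))"
    have "Im (s + 1) = \<tau> + x" by (simp add: s_def)
    hence "\<tau> / 2 \<le> \<bar>Im (s + 1)\<bar>" using True \<tau> by linarith
    also have "\<dots> \<le> cmod (s + 1)" by (rule abs_Im_le_cmod)
    finally have "cmod (s + 1) \<ge> \<tau> / 2" .
    hence w: "cmod w \<le> 4 / \<tau>" using \<tau> frac_le[of 2 2 "\<tau>/2" "cmod (s+1)"] by (simp add: w_def norm_divide)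
    have "4 / \<tau> \<le> 1/2" using \<tau> by (simp add: field_simps)
    with w have w2: "cmod w \<le> 1/2" by linarith
    have "cmod (Ln (1 + w) - w) \<le> cmod w ^ 2 / (1 - cmod w)" using w2 by (intro Ln_approx_linear) auto
    also have "\<dots> \<le> cmod w ^ 2 / (1/2)" using w2 by (intro divide_left_mono) auto
    also have "\<dots> \<le> cmod w" using w2 mult_left_mono[of "cmod w" "1/2" "cmod w"] by (simp add: power2_eq_square)
    finally have "cmod (Ln (1 + w)) \<le> 2 * cmod w" using norm_triangle_ineq2[of "Ln (1 + w)" w] by linarith
    also have "\<dots> \<le> 160 / \<tau> * 1" using w \<tau> by (simp add: field_simps)
    also have "\<dots> \<le> 160 / \<tau> * exp (5 * \<bar>x\<bar>)" using \<tau> e1 by (intro mult_left_mono) auto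
    finally show ?thesis by (simp add: w_def s_def)
  next
    case False
    define z where "z = 1 - 2 / (s + 1)"
    have Re_s: "Re s > 1" using e by (simp add: s_def)
    have ne: "z \<noteq> 0" using one_minus_2_div_pos[OF Re_s] by (auto simp: z_def)
    have z: "z = (s - 1) / (s + 1)" unfolding z_def using Re_s by (intro one_minus_2_div) auto
    have s1: "cmod (s + 1) \<ge> 2" using complex_Re_le_cmod[of "s + 1"] Re_s by simp
    have "cmod (s - 1) \<le> cmod (s + 1)"
      unfolding cmod_def using Re_s by (auto intro!: real_sqrt_le_mono power_mono)
    hence le1: "cmod z \<le> 1" using s1 unfolding z norm_divide by (subst divide_le_eq_1_pos) linarith+
    have "cmod (s - 1) \<ge> \<epsilon> / 2" using complex_Re_le_cmod[of "s - 1"] by (simp add: s_def)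
    hence ge: "1 / cmod z \<le> cmod (s + 1) / (\<epsilon> / 2)"
      using e frac_le[of "cmod (s+1)" "cmod (s+1)" "\<epsilon>/2" "cmod (s-1)"] by (simp add: z norm_divide)
    have s3: "cmod (s + 1) \<le> 3 * (1 + \<bar>x\<bar>)"
    proof -
      have "Re (s + 1) = 2 + \<epsilon>/2" "Im (s + 1) = \<tau> + x" by (simp_all add: s_def)
      moreover have "\<bar>\<tau> + x\<bar> \<le> 3 * \<bar>x\<bar>" using False \<tau> by linarith
      ultimately show ?thesis using cmod_le[of "s + 1"] e by simp
    qed
    have "\<bar>ln (cmod z)\<bar> = - ln (cmod z)" using le1 ne by simp
    also have "\<dots> = ln (1 / cmod z)" using ne by (simp add: ln_div)
    also have "\<dots> \<le> 1 / cmod z" using ne by (intro less_imp_le[OF ln_less_self]) auto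
    also have "\<dots> \<le> cmod (s + 1) / (\<epsilon> / 2)" by (rule ge)
    also have "\<dots> \<le> (3 * (1 + \<bar>x\<bar>)) / (\<epsilon> / 2)" using e s3 by (intro divide_right_mono) auto
    also have "\<dots> = 6 * (1 + \<bar>x\<bar>) * \<tau>^3" by (simp add: \<epsilon>)
    finally have "cmod (Ln z) \<le> 6 * (1 + \<bar>x\<bar>) * \<tau>^3 + 4" using norm_Ln_le_abs_ln_add_pi[OF ne] pi_less_4 by linarith
    moreover have "4 \<le> 4 * (1 + \<bar>x\<bar>) * \<tau>^3"
    proof -
      have "1 * 1 \<le> (1 + \<bar>x\<bar>) * \<tau>^3" using t3 by (intro mult_mono) auto
      thus ?thesis unfolding mult.assoc by linarith
    qed
    ultimately have "cmod (Ln z) \<le> 10 * (1 + \<bar>x\<bar>) * \<tau>^3" unfolding mult.assoc by linarith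
    \<comment> \<open>Here \<tau> < 2 |x|, so \<tau>^4 \<le> 16 (1 + |x|)^4; with the factor 1 + |x|
      already present this accounts for the exponent 5.\<close>
    also have "\<tau>^3 \<le> 16 * (1 + \<bar>x\<bar>)^4 / \<tau>"
    proof -
      have "\<tau>^4 \<le> (2 * (1 + \<bar>x\<bar>))^4" using False \<tau> by (intro power_mono) auto
      moreover have "\<tau>^4 = \<tau>^3 * \<tau>" by (simp add: eval_nat_numeral)
      ultimately show ?thesis using \<tau> unfolding power_mult_distrib by (simp add: pos_le_divide_eq)
    qed
    hence "10 * (1 + \<bar>x\<bar>) * \<tau>^3 \<le> 10 * (1 + \<bar>x\<bar>) * (16 * (1 + \<bar>x\<bar>)^4 / \<tau>)" by (intro mult_left_mono) auto
    also have "\<dots> = 160 / \<tau> * (1 + \<bar>x\<bar>)^5"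
    proof -
      have "10 * q * (16 * q^4 / \<tau>) = 160 / \<tau> * q^5" for q by (simp add: eval_nat_numeral)
      thus ?thesis .
    qed
    also have "\<dots> \<le> 160 / \<tau> * exp (5 * \<bar>x\<bar>)"
      using one_plus_power_le_exp[of x 5] \<tau> by (intro mult_left_mono) auto
    finally show ?thesis by (simp add: z_def s_def)
  qed
qed


lemma pole_integral_bound:
  assumes B: "B > 0"
  shows "\<exists>C\<ge>0. \<forall>\<eta>\<ge>0. \<forall>\<tau>\<ge>8. \<forall>\<epsilon> y. \<epsilon> = 1 / \<tau>^3 \<longrightarrow> y = 1/2 - \<epsilon>/2 \<longrightarrow>
    cmod (LINT x|lborel. Ln (1 - 2 / (Complex (1 + \<epsilon>/2) (\<tau> + x) + 1)) * dexp_kernel B \<eta> (of_real x - \<i> * of_real y)) \<le> C / \<tau>"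
proof -
  define D where "D = 160 * exp (B/4) * exp (5^2 / (2 * B))"
  have "cmod (LINT x|lborel. Ln (1 - 2 / (Complex (1 + \<epsilon>/2) (\<tau> + x) + 1)) * dexp_kernel B \<eta> (of_real x - \<i> * of_real y))
      \<le> (D * gauss_mass (B/2)) / \<tau>"
    if \<eta>: "\<eta> \<ge> 0" and \<tau>: "\<tau> \<ge> 8" and \<epsilon>: "\<epsilon> = 1 / \<tau>^3" and y: "y = 1/2 - \<epsilon>/2" for \<eta> \<tau> \<epsilon> y
  proof -
    have "\<tau>^3 \<ge> 1" using \<tau> by (intro one_le_power) auto
    hence e: "0 < \<epsilon>" "\<epsilon> \<le> 1" using \<tau> by (auto simp: \<epsilon> divide_le_eq)
    define f where "f = (\<lambda>x. Ln (1 - 2 / (Complex (1 + \<epsilon>/2) (\<tau> + x) + 1)) * dexp_kernel B \<eta> (of_real x - \<i> * of_real y))"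
    have bd: "cmod (f x) \<le> D / \<tau> * exp (- (B/2) * x^2)" for x
    proof -
      have "cmod (f x) \<le> (160 / \<tau> * exp (5 * \<bar>x\<bar>)) * (exp (B/4) * exp (- B * x^2))"
        unfolding f_def norm_mult
        using pole_factor_bound[OF \<tau> \<epsilon>, of x] norm_kernel_le[of "of_real x - \<i> * of_real y" \<eta> B] \<eta> B y e \<tau>
        by (intro mult_mono) auto
      also have "\<dots> = 160 / \<tau> * exp (B/4) * (exp (5 * \<bar>x\<bar>) * exp (- B * x^2))" by (simp only: mult_ac)
      also have "\<dots> \<le> 160 / \<tau> * exp (B/4) * (exp (5^2 / (2 * B)) * exp (- (B/2) * x^2))"
        using \<tau> by (intro mult_left_mono gaussian_absorb B) auto
      finally show ?thesis by (simp add: D_def mult_ac)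
    qed
    have cont: "continuous_on UNIV (\<lambda>x. Ln (1 - 2 / (Complex (1 + \<epsilon>/2) (\<tau> + x) + 1)))"
    proof -
      have c: "Complex a b = of_real a + \<i> * of_real b" for a b by (simp add: complex_eq_iff)
      have "1 - 2 / (Complex (1 + \<epsilon>/2) (\<tau> + x) + 1) \<notin> \<real>\<^sub>\<le>\<^sub>0" for x
        using one_minus_2_div_pos[of "Complex (1 + \<epsilon>/2) (\<tau> + x)"] e complex_nonpos_Reals_iff
        by (metis add_increasing2 complex.sel(1) divide_pos_pos less_add_same_cancel1 not_le zero_less_numeral)
      moreover have "Complex (1 + \<epsilon>/2) (\<tau> + x) + 1 \<noteq> 0" for x using e by (auto simp: complex_eq_iff)
      moreover have "continuous_on UNIV (\<lambda>x. Complex (1 + \<epsilon>/2) (\<tau> + x))" unfolding c by (intro continuous_intros)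
      ultimately show ?thesis by (intro continuous_intros) auto
    qed
    have mf: "f \<in> borel_measurable lborel"
      unfolding f_def using borel_measurable_continuous_onI[OF cont] by measurable
    have int: "integrable lborel f"
      by (rule integrable_gaussian_bound[where c="B/2", OF _ mf bd]) (use B in auto)
    have "cmod (LINT x|lborel. f x) \<le> (LINT x|lborel. D / \<tau> * exp (- (B/2) * x^2))"
      using bd integrable_gaussian[of "B/2"] B by (intro Bochner_Integration.integral_norm_bound_integral int) auto
    also have "\<dots> = (D * gauss_mass (B/2)) / \<tau>" by (simp add: gauss_mass_def)
    finally show ?thesis by (simp add: f_def)
  qed
  moreover have "D * gauss_mass (B/2) \<ge> 0" using gauss_mass_pos[of "B/2"] B by (simp add: D_def)
  ultimately show ?thesis by blast
qed

text \<open>Near the centre the assumed bound \<open>a\<close> is used; beyond \<open>h\<close> the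
  trivial logarithmic bound is multiplied by the value of the double exponential at
  \<open>h\<close>. The constant depends on \<open>B\<close> alone, so \<eta>, h and \<epsilon> may
  be fixed afterwards. No lower bound for the real part of F is needed because the kernel is
  positive.\<close>

lemma log_zeta_integral_upper:
  assumes B: "B > 0"
  shows "\<exists>C\<ge>0. \<forall>F \<tau> \<epsilon> \<eta> h a. (\<forall>s. Re s > 1/2 \<longrightarrow> exp (F s) = zeta_reg s / (s + 1)) \<longrightarrow>
     \<tau> \<ge> 1 \<longrightarrow> 0 < \<epsilon> \<longrightarrow> \<epsilon> \<le> 1/2 \<longrightarrow> \<eta> \<ge> 0 \<longrightarrow> h \<ge> 0 \<longrightarrow> a \<ge> 1 \<longrightarrow>
     (\<forall>x. \<bar>x\<bar> \<le> h \<longrightarrow> cmod (zeta_reg (Complex (1/2 + \<epsilon>) (\<tau> + x)) / (Complex (1/2 + \<epsilon>) (\<tau> + x) + 1)) \<le> a) \<longrightarrow>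
     integrable lborel (\<lambda>x. F (Complex (1/2 + \<epsilon>) (\<tau> + x)) * dexp_kernel B \<eta> (of_real x)) \<longrightarrow>
     Re (LINT x|lborel. F (Complex (1/2 + \<epsilon>) (\<tau> + x)) * dexp_kernel B \<eta> (of_real x))
       \<le> ln a * gauss_mass B + C * (1 + ln \<tau>) * exp (- \<eta> * cosh (pi * h))"
proof -
  obtain C where C: "C \<ge> 1" "\<And>s. Re s \<ge> 1/4 \<Longrightarrow> cmod (zeta_reg s / (s + 1)) \<le> C * (1 + cmod s)^2"
    using zeta_reg_div_le by blast
  define L where "L = ln C + 2 * ln 3 + 2"
  have LL: "L = ln C + 2 * ln 3 + 2" by (simp add: L_def)
  have L: "L \<ge> 2" using C by (simp add: L_def)
  define D where "D = L * exp (2^2 / (2 * B)) * gauss_mass (B/2)"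
  have D0: "D \<ge> 0" using L gauss_mass_pos[of "B/2"] B by (simp add: D_def)
  have "Re (LINT x|lborel. F (Complex (1/2 + \<epsilon>) (\<tau> + x)) * dexp_kernel B \<eta> (of_real x))
       \<le> ln a * gauss_mass B + D * (1 + ln \<tau>) * exp (- \<eta> * cosh (pi * h))"
    if ex: "\<And>s. Re s > 1/2 \<Longrightarrow> exp (F s) = zeta_reg s / (s + 1)"
      and \<tau>: "\<tau> \<ge> 1" and \<epsilon>: "0 < \<epsilon>" "\<epsilon> \<le> 1/2" and \<eta>: "\<eta> \<ge> 0" and h: "h \<ge> 0" and a: "a \<ge> 1"
      and near: "\<And>x. \<bar>x\<bar> \<le> h \<Longrightarrow> cmod (zeta_reg (Complex (1/2 + \<epsilon>) (\<tau> + x)) / (Complex (1/2 + \<epsilon>) (\<tau> + x) + 1)) \<le> a"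
      and int: "integrable lborel (\<lambda>x. F (Complex (1/2 + \<epsilon>) (\<tau> + x)) * dexp_kernel B \<eta> (of_real x))"
    for F \<tau> \<epsilon> \<eta> h a
  proof -
    define Z where "Z = (\<lambda>x. cmod (zeta_reg (Complex (1/2 + \<epsilon>) (\<tau> + x)) / (Complex (1/2 + \<epsilon>) (\<tau> + x) + 1)))"
    define p where "p = (\<lambda>x. Re (F (Complex (1/2 + \<epsilon>) (\<tau> + x))))"
    define E where "E = exp (- \<eta> * cosh (pi * h))"
    have l\<tau>: "ln \<tau> \<ge> 0" using \<tau> by simp
    have expp: "exp (p x) = Z x" for x
    proof -
      have "exp (F (Complex (1/2 + \<epsilon>) (\<tau> + x))) = zeta_reg (Complex (1/2 + \<epsilon>) (\<tau> + x)) / (Complex (1/2 + \<epsilon>) (\<tau> + x) + 1)"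
        using ex \<epsilon> by auto
      thus ?thesis unfolding Z_def p_def norm_exp_eq_Re[symmetric] by (simp only:)
    qed
    have p_near: "p x \<le> ln a" if "\<bar>x\<bar> \<le> h" for x
    proof -
      have "exp (p x) \<le> a" unfolding expp Z_def by (rule near[OF that])
      thus ?thesis using ln_mono[of "exp (p x)" a] by simp
    qed
    have p_far: "p x \<le> L * (1 + ln \<tau>) * exp (2 * \<bar>x\<bar>)" for x
    proof -
      define s where "s = Complex (1/2 + \<epsilon>) (\<tau> + x)"
      have sl: "1 + cmod s \<le> 3 * \<tau> * (1 + \<bar>x\<bar>)"
      proof -
        have "cmod s \<le> \<bar>Re s\<bar> + \<bar>Im s\<bar>" by (rule cmod_le)
        hence "1 + cmod s \<le> 2 + \<tau> + \<bar>x\<bar>" using \<epsilon> \<tau> by (simp add: s_def)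
        also have "\<dots> \<le> 3 * \<tau> + 3 * (\<tau> * \<bar>x\<bar>)" using \<tau> mult_right_mono[of 1 \<tau> "\<bar>x\<bar>"] by simp
        finally show ?thesis by (simp add: algebra_simps)
      qed
      have "exp (p x) \<le> C * (1 + cmod s)^2" unfolding expp Z_def s_def using \<epsilon> by (intro C) auto
      also have "\<dots> \<le> C * (3 * \<tau> * (1 + \<bar>x\<bar>))^2" using C(1) sl by (intro mult_left_mono power_mono) auto
      finally have "exp (p x) \<le> C * (3 * \<tau> * (1 + \<bar>x\<bar>))^2" .
      hence "ln (exp (p x)) \<le> ln (C * (3 * \<tau> * (1 + \<bar>x\<bar>))^2)" by (intro ln_mono) auto
      also have "\<dots> = ln C + 2 * (ln 3 + ln \<tau> + ln (1 + \<bar>x\<bar>))"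
        using C(1) \<tau> by (simp add: ln_mult ln_realpow)
      also have "ln (1 + \<bar>x\<bar>) \<le> \<bar>x\<bar>" by (rule ln_add_one_self_le_self) simp
      finally have "p x \<le> ln C + 2 * (ln 3 + ln \<tau> + \<bar>x\<bar>)" by simp
      also have "\<dots> \<le> (L * (1 + ln \<tau>)) * (1 + 2 * \<bar>x\<bar>)"
      proof -
        have "ln C \<ge> 0" "ln (3::real) \<ge> 0" using C by auto
        moreover have "L * ln \<tau> \<ge> 2 * ln \<tau>" using L l\<tau> by (intro mult_right_mono) auto
        moreover have "(L * (1 + ln \<tau>)) * (2 * \<bar>x\<bar>) \<ge> 1 * (2 * \<bar>x\<bar>)"
        proof (rule mult_right_mono)
          have "1 * 1 \<le> L * (1 + ln \<tau>)" using L l\<tau> by (intro mult_mono) auto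
          thus "1 \<le> L * (1 + ln \<tau>)" by simp
        qed simp
        moreover have "r + 2 * (u + v + w) \<le> (l + e) + q" if "l = r + 2 * u + 2" "2 * v \<le> e" "1 * (2 * w) \<le> q"
          for r u v w l e q :: real using that by (simp add: ring_distribs)
        ultimately have "ln C + 2 * (ln 3 + ln \<tau> + \<bar>x\<bar>) \<le> (L + L * ln \<tau>) + (L * (1 + ln \<tau>)) * (2 * \<bar>x\<bar>)"
          using LL by blast
        thus ?thesis by (simp add: algebra_simps)
      qed
      also have "\<dots> \<le> (L * (1 + ln \<tau>)) * exp (2 * \<bar>x\<bar>)"
        using L l\<tau> by (intro mult_left_mono exp_ge_add_one_self) auto
      finally show ?thesis by simp
    qed
    have pt: "Re (F (Complex (1/2 + \<epsilon>) (\<tau> + x)) * dexp_kernel B \<eta> (of_real x)) \<le>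
        ln a * exp (- B * x^2) + (L * (1 + ln \<tau>) * E * exp (2^2 / (2 * B))) * exp (- (B/2) * x^2)" for x
    proof -
      define k where "k = exp (- \<eta> * cosh (pi * x))"
      have k: "0 < k" "k \<le> 1" using \<eta> by (auto simp: k_def)
      have eq: "Re (F (Complex (1/2 + \<epsilon>) (\<tau> + x)) * dexp_kernel B \<eta> (of_real x)) = p x * k * exp (- B * x^2)"
        unfolding kernel_of_real p_def k_def by (simp only: Re_complex_of_real times_complex.simps Im_complex_of_real)
      have lna: "ln a \<ge> 0" using a by simp
      have second: "(L * (1 + ln \<tau>) * E * exp (2^2 / (2 * B))) * exp (- (B/2) * x^2) \<ge> 0"
        using L l\<tau> by (simp add: E_def)
      show ?thesis
      proof (cases "\<bar>x\<bar> \<le> h")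
        case True
        \<comment> \<open>Since p x may be negative, the factor k \<le> 1 is removed only after
          passing to ln a, which is nonnegative because a \<ge> 1.\<close>
        have "p x * k \<le> ln a * 1" using p_near[OF True] lna k
          by (intro order_trans[OF mult_right_mono mult_left_mono]) auto
        hence "p x * k * exp (- B * x^2) \<le> ln a * exp (- B * x^2)" by (intro mult_right_mono) auto
        thus ?thesis using second eq by linarith
      next
        case False
        have "cosh (pi * h) \<le> cosh (pi * \<bar>x\<bar>)"
          using False h by (subst cosh_real_nonneg_le_iff) auto
        also have "cosh (pi * \<bar>x\<bar>) = cosh (pi * x)" by (cases "x \<ge> 0") auto
        finally have "k \<le> E" unfolding k_def E_def using \<eta> by (simp add: mult_left_mono)
        have "p x * k \<le> (L * (1 + ln \<tau>) * exp (2 * \<bar>x\<bar>)) * E"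
          using p_far[of x] k \<open>k \<le> E\<close> L l\<tau>
          by (intro order_trans[OF mult_right_mono mult_left_mono]) auto
        hence "p x * k * exp (- B * x^2) \<le> (L * (1 + ln \<tau>) * exp (2 * \<bar>x\<bar>)) * E * exp (- B * x^2)" by (intro mult_right_mono) auto
        also have "\<dots> = L * (1 + ln \<tau>) * E * (exp (2 * \<bar>x\<bar>) * exp (- B * x^2))" by (simp only: mult_ac)
        also have "\<dots> \<le> L * (1 + ln \<tau>) * E * (exp (2^2 / (2 * B)) * exp (- (B/2) * x^2))"
          using L l\<tau> by (intro mult_left_mono gaussian_absorb B) (auto simp: E_def)
        finally have "p x * k * exp (- B * x^2) \<le> (L * (1 + ln \<tau>) * E * exp (2^2 / (2 * B))) * exp (- (B/2) * x^2)"
          by (simp only: mult_ac)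
        moreover have "ln a * exp (- B * x^2) \<ge> 0" using lna by simp
        ultimately show ?thesis using eq by linarith
      qed
    qed
    have "Re (LINT x|lborel. F (Complex (1/2 + \<epsilon>) (\<tau> + x)) * dexp_kernel B \<eta> (of_real x)) =
       (LINT x|lborel. Re (F (Complex (1/2 + \<epsilon>) (\<tau> + x)) * dexp_kernel B \<eta> (of_real x)))"
      using int by (rule integral_Re[symmetric])
    also have "\<dots> \<le> (LINT x|lborel. ln a * exp (- B * x^2) + (L * (1 + ln \<tau>) * E * exp (2^2 / (2 * B))) * exp (- (B/2) * x^2))"
      using integrable_gaussian[of B] integrable_gaussian[of "B/2"] B
      by (intro integral_mono pt integrable_Re int Bochner_Integration.integrable_add integrable_mult_right) auto
    also have "\<dots> = ln a * gauss_mass B + (L * (1 + ln \<tau>) * E * exp (2^2 / (2 * B))) * gauss_mass (B/2)"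
      unfolding gauss_mass_def using integrable_gaussian[of B] integrable_gaussian[of "B/2"] B
      by (subst Bochner_Integration.integral_add) auto
    also have "(L * (1 + ln \<tau>) * E * exp (2^2 / (2 * B))) * gauss_mass (B/2) = D * (1 + ln \<tau>) * E" by (simp only: D_def mult_ac)
    finally show ?thesis by (simp only: E_def)
  qed
  thus ?thesis using D0 by (intro exI[of _ D]) blast
qed

text \<open>Carries the smallness assumed on the critical line over to Re s = 1/2 + \<epsilon>,
  where the logarithm lives: Cauchy's inequality on circles of radius 1/4 bounds the derivative by
  O(t^2).\<close>

lemma zeta_near_half_line:
  "\<exists>C\<ge>0. \<forall>t \<epsilon>. t \<ge> 2 \<longrightarrow> 0 \<le> \<epsilon> \<longrightarrow> \<epsilon> \<le> 1 \<longrightarrow> cmod (zeta (Complex (1/2 + \<epsilon>) t) - zeta (Complex (1/2) t)) \<le> C * t^2 * \<epsilon>"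
proof -
  obtain C where C: "C > 0" "\<And>s. Re s \<ge> 1/4 \<Longrightarrow> cmod (zeta_reg s) \<le> C * (1 + cmod s)^2"
    using norm_zeta_reg_le by blast
  have zb: "cmod (zeta w) \<le> C * (1 + cmod w)^2" if w: "Re w \<ge> 1/4" "Im w \<ge> 1" for w
  proof -
    have ne: "w \<noteq> 1" using w by auto
    have "1 \<le> cmod (w - 1)" using abs_Im_le_cmod[of "w - 1"] w by simp
    hence "cmod (zeta w) * 1 \<le> cmod (zeta w) * cmod (w - 1)" by (intro mult_left_mono) auto
    also have "\<dots> = cmod (zeta_reg w)" using zeta_reg_eq[of w] w ne by (simp add: norm_mult)
    also have "\<dots> \<le> C * (1 + cmod w)^2" using w by (intro C) auto
    finally show ?thesis by simp
  qed
  have "cmod (zeta (Complex (1/2 + \<epsilon>) t) - zeta (Complex (1/2) t)) \<le> (64 * C) * t^2 * \<epsilon>"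
    if t: "t \<ge> 2" and \<epsilon>: "0 \<le> \<epsilon>" "\<epsilon> \<le> 1" for t \<epsilon>
  proof -
    let ?S = "closed_segment (Complex (1/2) t) (Complex (1/2 + \<epsilon>) t)"
    have seg: "Im u = t \<and> 1/2 \<le> Re u \<and> Re u \<le> 3/2" if "u \<in> ?S" for u
      using that \<epsilon> by (subst (asm) closed_segment_same_Im) (auto simp: closed_segment_eq_real_ivl)
    have hol: "zeta holomorphic_on cball u (1/4)" if "u \<in> ?S" for u
    proof (rule holomorphic_on_subset[OF zeta_spec(1)], safe)
      assume "1 \<in> cball u (1/4)"
      thus False using seg[OF that] t abs_Im_le_cmod[of "u - 1"] by (auto simp: dist_norm)
    qed
    have der: "cmod (deriv zeta u) \<le> 64 * C * t^2" if u: "u \<in> ?S" for u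
    proof -
      have "cmod ((deriv ^^ 1) zeta u) \<le> fact 1 * (C * (4 * t)^2) / (1/4)^1"
      proof (rule Cauchy_inequality)
        show "zeta holomorphic_on ball u (1/4)" by (rule holomorphic_on_subset[OF hol[OF u]]) auto
        show "continuous_on (cball u (1/4)) zeta" by (rule holomorphic_on_imp_continuous_on[OF hol[OF u]])
        fix w assume w: "cmod (u - w) = 1/4"
        have "\<bar>Re u - Re w\<bar> \<le> 1/4" "\<bar>Im u - Im w\<bar> \<le> 1/4"
          using abs_Re_le_cmod[of "u - w"] abs_Im_le_cmod[of "u - w"] w by auto
        hence w': "Re w \<ge> 1/4" "Re w \<le> 7/4" "Im w \<ge> 1" "Im w \<le> t + 1/4" using seg[OF u] t by linarith+
        have "1 + cmod w \<le> 4 * t" using cmod_le[of w] w' t by simp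
        hence "(1 + cmod w)^2 \<le> (4 * t)^2" by (intro power_mono) auto
        thus "cmod (zeta w) \<le> C * (4 * t)^2" using zb[of w] w' C(1) by (meson mult_left_mono less_imp_le order_trans)
      qed auto
      thus ?thesis by (simp add: power_mult_distrib)
    qed
    have "cmod (zeta (Complex (1/2 + \<epsilon>) t) - zeta (Complex (1/2) t)) \<le> 64 * C * t^2 * cmod (Complex (1/2 + \<epsilon>) t - Complex (1/2) t)"
    proof (rule field_differentiable_bound[where S="?S" and f'="deriv zeta"])
      fix u assume u: "u \<in> ?S"
      have "u \<noteq> 1" using seg[OF u] t by auto
      hence "(zeta has_field_derivative deriv zeta u) (at u)"
        using holomorphic_derivI[OF zeta_spec(1), of u] by auto
      thus "(zeta has_field_derivative deriv zeta u) (at u within ?S)" by (rule has_field_derivative_at_within)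
    qed (use der in auto)
    also have "Complex (1/2 + \<epsilon>) t - Complex (1/2) t = of_real \<epsilon>" by (simp add: complex_eq_iff)
    finally show ?thesis using \<epsilon> by simp
  qed
  thus ?thesis using C(1) by (intro exI[of _ "64 * C"]) auto
qed

text \<open>Sort the real numbers by the boxes containing their fractional parts and keep one
  representative t for each of the finitely many occupied boxes. Then \<tau> = T - t works for T in
  the box of t, and R is the largest |t|. The target phases are all 0, so linear independence of
  logarithms is not involved.\<close>

lemma simultaneous_approximation:
  "\<exists>R\<ge>0. \<forall>T. \<exists>\<tau>. \<bar>\<tau> - T\<bar> \<le> R \<and> (\<forall>n<M. cmod (exp (- \<i> * of_real (\<tau> * ln (real (Suc n)))) - 1) \<le> 1/2)"
proof -
  define \<xi> where "\<xi> = (\<lambda>n. ln (real (Suc n)))"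
  \<comment> \<open>Boxes of side 1/16 keep each angle within 2 pi / 16 < 1/2 of a multiple of 2
    pi.\<close>
  define c where "c = (\<lambda>T::real. restrict (\<lambda>n. \<lfloor>16 * frac (T * \<xi> n / (2 * pi))\<rfloor>) {..<M})"
  have "c T \<in> {..<M} \<rightarrow>\<^sub>E {0..16}" for T
  proof -
    have "0 \<le> \<lfloor>16 * frac x\<rfloor>" "\<lfloor>16 * frac x\<rfloor> \<le> 16" for x :: real
      using frac_ge_0[of x] frac_lt_1[of x] by (auto simp: floor_le_iff)
    thus ?thesis by (auto simp: c_def)
  qed
  hence "range c \<subseteq> {..<M} \<rightarrow>\<^sub>E {0..16}" by auto
  hence fin: "finite (range c)" by (rule finite_subset) (auto intro!: finite_PiE)
  define F where "F = inv_into UNIV c ` range c"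
  have finF: "finite F" unfolding F_def using fin by simp
  define R where "R = Max (insert 0 (abs ` F))"
  have R: "R \<ge> 0" "\<And>x. x \<in> F \<Longrightarrow> \<bar>x\<bar> \<le> R" unfolding R_def using finF by auto
  have "\<exists>\<tau>. \<bar>\<tau> - T\<bar> \<le> R \<and> (\<forall>n<M. cmod (exp (- \<i> * of_real (\<tau> * \<xi> n)) - 1) \<le> 1/2)" for T
  proof -
    define t where "t = inv_into UNIV c (c T)"
    have tF: "t \<in> F" by (simp add: F_def t_def)
    have ct: "c t = c T" unfolding t_def by (rule f_inv_into_f) simp
    have "cmod (exp (- \<i> * of_real ((T - t) * \<xi> n)) - 1) \<le> 1/2" if n: "n < M" for n
    proof -
      define x where "x = T * \<xi> n / (2 * pi)"
      define z where "z = t * \<xi> n / (2 * pi)"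
      have fl: "\<lfloor>16 * frac x\<rfloor> = \<lfloor>16 * frac z\<rfloor>" using fun_cong[OF ct, of n] n by (simp add: c_def x_def z_def)
      have d: "\<bar>frac x - frac z\<bar> \<le> 1/16" using fl by linarith
      define \<theta> where "\<theta> = 2 * pi * (frac x - frac z)"
      have "\<bar>\<theta>\<bar> = 2 * pi * \<bar>frac x - frac z\<bar>" by (simp add: \<theta>_def abs_mult)
      also have "\<dots> \<le> 2 * pi * (1/16)" using d by (intro mult_left_mono) auto
      also have "\<dots> \<le> 1/2" using pi_less_4 by simp
      finally have \<theta>: "\<bar>\<theta>\<bar> \<le> 1/2" .
      have "(T - t) * \<xi> n = 2 * pi * (x - z)" by (simp add: x_def z_def field_simps)
      also have "\<dots> = \<theta> + 2 * pi * of_int (\<lfloor>x\<rfloor> - \<lfloor>z\<rfloor>)" by (simp add: \<theta>_def frac_def algebra_simps)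
      finally have eq: "(T - t) * \<xi> n = \<theta> + 2 * pi * of_int (\<lfloor>x\<rfloor> - \<lfloor>z\<rfloor>)" .
      have "exp (- \<i> * of_real ((T - t) * \<xi> n)) = cis (- ((T - t) * \<xi> n))" by (simp add: cis_conv_exp)
      also have "\<dots> = cis (- \<theta> + 2 * pi * of_int (\<lfloor>z\<rfloor> - \<lfloor>x\<rfloor>))" unfolding eq by (simp add: algebra_simps)
      also have "\<dots> = cis (- \<theta>)" unfolding cis_mult[symmetric] by (simp add: cis_multiple_2pi)
      finally have "cmod (exp (- \<i> * of_real ((T - t) * \<xi> n)) - 1) = cmod (cis (- \<theta>) - cis 0)" by simp
      also have "\<dots> \<le> \<bar>- \<theta> - 0\<bar>"
      proof -
        have "cmod (exp (\<i> * of_real (- \<theta>)) - 1) = 2 * \<bar>sin (- \<theta> / 2)\<bar>" by (rule dist_exp_i_1)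
        also have "\<dots> \<le> 2 * \<bar>- \<theta> / 2\<bar>" using abs_sin_x_le_abs_x[of "- \<theta> / 2"] by simp
        finally show ?thesis by (simp add: cis_conv_exp)
      qed
      finally show ?thesis using \<theta> by simp
    qed
    moreover have "\<bar>(T - t) - T\<bar> \<le> R" using R(2)[OF tF] by simp
    ultimately show ?thesis by blast
  qed
  thus ?thesis unfolding \<xi>_def using R(1) by blast
qed

text \<open>Comparison with the telescoping series of 1/ln a - 1/ln(a + 1). The term n = 0 reads 1/0
  = 0, and the comparison starts beyond it.\<close>

lemma summable_inverse_mult_ln_squared: "summable (\<lambda>n. 1 / (real (Suc n) * ln (real (Suc n)) ^ 2))"
proof -
  have lim: "(\<lambda>n. 1 / ln (real (n + 2))) \<longlonglongrightarrow> 0" by real_asymp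
  have "summable (\<lambda>n. 1 / ln (real (n + 2)) - 1 / ln (real (Suc n + 2)))"
    using telescope_summable'[OF lim] by simp
  hence "summable (\<lambda>n. 1 / (real (Suc (n + 2)) * ln (real (Suc (n + 2))) ^ 2))"
  proof (rule summable_comparison_test'[where N=0])
    fix n :: nat
    define a where "a = real (n + 2)"
    have a: "a \<ge> 2" by (simp add: a_def)
    have l: "ln a > 0" "ln (a + 1) \<ge> ln a" using a by auto
    have "ln (a / (a + 1)) \<le> a / (a + 1) - 1" using a by (intro ln_le_minus_one) auto
    hence "1 / (a + 1) \<le> ln (a + 1) - ln a" using a by (simp add: ln_div field_simps)
    hence "1 / (a + 1) / (ln (a + 1) * ln (a + 1)) \<le> (ln (a + 1) - ln a) / (ln a * ln (a + 1))"
      using l a by (intro frac_le mult_right_mono) auto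
    also have "\<dots> = 1 / ln a - 1 / ln (a + 1)" using l by (simp add: field_simps)
    finally show "norm (1 / (real (Suc (n + 2)) * ln (real (Suc (n + 2))) ^ 2)) \<le> 1 / ln (real (n + 2)) - 1 / ln (real (Suc n + 2))"
      by (simp add: a_def power2_eq_square add.commute add.left_commute)
  qed
  thus ?thesis by (subst (asm) summable_iff_shift[where f="\<lambda>n. 1 / (real (Suc n) * ln (real (Suc n)) ^ 2)"])
qed


section \<open>Large values\<close>

text \<open>The losses from n^(-\<epsilon>), from the phases and from G n \<ge> g/2 are a factor 2
  each, which turns 8 K into K. Replacing k by G below \<open>M\<close> costs at most g and the tail
  another g, whence K - 2. Between \<open>M0\<close> and \<open>M\<close> the main terms are
  nonnegative and are discarded.\<close>

lemma log_series_lower_bound: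
  fixes k :: "nat \<Rightarrow> complex" and G Q :: "nat \<Rightarrow> real"
  assumes sums: "(\<lambda>n. of_real (log_coeff n) * of_nat (Suc n) powr (- Complex (1/2 + \<epsilon>) \<tau>) * k n) sums S"
    and near1: "\<And>n. n < M \<Longrightarrow> cmod (exp (- \<i> * of_real (\<tau> * ln (real (Suc n)))) - 1) \<le> 1/2"
    and kG: "\<And>n. n < M \<Longrightarrow> cmod (k n - of_real (G n)) \<le> \<delta>" and G0: "\<And>n. G n \<ge> 0"
    and tail: "\<And>n. n \<ge> M \<Longrightarrow> real (Suc n) powr (-1/2) * cmod (k n) \<le> Q n" and Q: "summable Q"
    and \<epsilon>: "\<epsilon> \<ge> 0" and M0: "M0 \<le> M" and G: "\<And>n. n < M0 \<Longrightarrow> G n \<ge> g / 2"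
    and p: "\<And>n. n < M0 \<Longrightarrow> real (Suc n) powr (- \<epsilon>) \<ge> 1/2"
    and K: "(\<Sum>n<M0. log_coeff n * real (Suc n) powr (-1/2)) \<ge> 8 * K"
    and \<delta>: "0 \<le> \<delta>" "real M * \<delta> \<le> g" and Qg: "(\<Sum>n. Q (n + M)) \<le> g" and g: "g > 0"
  shows "Re S \<ge> (K - 2) * g"
proof -
  define t where "t = (\<lambda>n. of_real (log_coeff n) * of_nat (Suc n) powr (- Complex (1/2 + \<epsilon>) \<tau>) * k n)"
  define q where "q = (\<lambda>n. log_coeff n * real (Suc n) powr (- (1/2 + \<epsilon>)))"
  have q: "0 \<le> q n" "q n \<le> real (Suc n) powr (-1/2)" "q n \<le> 1" for n
  proof -
    show "0 \<le> q n" unfolding q_def by (intro mult_nonneg_nonneg log_coeff_nonneg) auto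
    have "q n \<le> 1 * real (Suc n) powr (-1/2)" unfolding q_def
      using abs_log_coeff_le[of n] \<epsilon> by (intro mult_mono powr_mono) auto
    thus "q n \<le> real (Suc n) powr (-1/2)" by simp
    also have "\<dots> \<le> real (Suc n) powr 0" by (intro powr_mono) auto
    finally show "q n \<le> 1" by simp
  qed
  have t_eq: "t n = of_real (q n) * (exp (- \<i> * of_real (\<tau> * ln (real (Suc n)))) * k n)" for n
    unfolding t_def q_def Suc_powr_Complex by (simp only: of_real_mult mult_ac)
  have S: "S = (\<Sum>n<M. t n) + (\<Sum>n. t (n + M))"
    using suminf_split_initial_segment[of t M] sums_summable[OF sums] sums_unique[OF sums]
    unfolding t_def by simp
  have nt: "cmod (t (n + M)) \<le> Q (n + M)" for n
  proof -
    have "cmod (t (n + M)) = q (n + M) * cmod (k (n + M))"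
      unfolding t_eq norm_mult norm_exp_i using q(1)[of "n + M"] by simp
    also have "\<dots> \<le> real (Suc (n + M)) powr (-1/2) * cmod (k (n + M))" by (intro mult_right_mono q) auto
    also have "\<dots> \<le> Q (n + M)" by (intro tail) auto
    finally show ?thesis .
  qed
  have "cmod (\<Sum>n. t (n + M)) \<le> (\<Sum>n. Q (n + M))"
    using Q by (intro norm_suminf_le nt) (simp add: summable_iff_shift)
  hence tail_le: "Re (\<Sum>n. t (n + M)) \<ge> - g" using Qg abs_Re_le_cmod[of "\<Sum>n. t (n + M)"] by linarith
  have Re_t: "Re (t n) \<ge> q n * G n / 2 - \<delta>" if n: "n < M" for n
  proof -
    define e where "e = exp (- \<i> * of_real (\<tau> * ln (real (Suc n))))"
    have e: "cmod e = 1" unfolding e_def by (rule norm_exp_i)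
    have "e * k n = of_real (G n) + ((e - 1) * of_real (G n) + e * (k n - of_real (G n)))" by (simp add: algebra_simps)
    moreover have "\<bar>Re ((e - 1) * of_real (G n))\<bar> \<le> 1/2 * G n"
    proof -
      have "\<bar>Re ((e - 1) * of_real (G n))\<bar> \<le> cmod (e - 1) * G n"
        using abs_Re_le_cmod[of "(e - 1) * of_real (G n)"] G0[of n] by (simp add: norm_mult)
      also have "\<dots> \<le> 1/2 * G n" using near1[OF n] G0[of n] unfolding e_def by (intro mult_right_mono) auto
      finally show ?thesis .
    qed
    moreover have "\<bar>Re (e * (k n - of_real (G n)))\<bar> \<le> \<delta>"
      using abs_Re_le_cmod[of "e * (k n - of_real (G n))"] kG[OF n] by (simp add: norm_mult e)
    ultimately have "Re (e * k n) \<ge> G n / 2 - \<delta>" by simp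
    hence "q n * Re (e * k n) \<ge> q n * (G n / 2 - \<delta>)" by (intro mult_left_mono q)
    moreover have "q n * \<delta> \<le> 1 * \<delta>" by (intro mult_right_mono q \<delta>)
    moreover have "Re (t n) = q n * Re (e * k n)" unfolding t_eq e_def[symmetric] by simp
    ultimately show ?thesis by (simp add: right_diff_distrib)
  qed
  have "K * g = (8 * K) * (g / 8)" by simp
  also have "\<dots> \<le> (\<Sum>n<M0. log_coeff n * real (Suc n) powr (-1/2)) * (g / 8)"
    using K g by (intro mult_right_mono) auto
  also have "\<dots> = (\<Sum>n<M0. log_coeff n * real (Suc n) powr (-1/2) * (g / 8))" by (rule sum_distrib_right)
  also have "\<dots> \<le> (\<Sum>n<M0. q n * G n / 2)"
  proof (rule sum_mono)
    fix n assume "n \<in> {..<M0}"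
    hence n: "n < M0" by simp
    have "real (Suc n) powr (- (1/2 + \<epsilon>)) = real (Suc n) powr (-1/2) * real (Suc n) powr (- \<epsilon>)"
      unfolding powr_add[symmetric] by simp
    hence q_eq: "q n = log_coeff n * real (Suc n) powr (-1/2) * real (Suc n) powr (- \<epsilon>)"
      unfolding q_def by (simp only: mult.assoc)
    have "log_coeff n * real (Suc n) powr (-1/2) * (1/2) \<le> q n"
      unfolding q_eq using p[OF n] by (intro mult_left_mono mult_nonneg_nonneg log_coeff_nonneg) auto
    hence "log_coeff n * real (Suc n) powr (-1/2) * (1/2) * (g / 2) \<le> q n * G n"
      using G[OF n] g q(1)[of n] by (intro mult_mono) auto
    thus "log_coeff n * real (Suc n) powr (-1/2) * (g / 8) \<le> q n * G n / 2" by (simp add: mult_ac)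
  qed
  also have "\<dots> \<le> (\<Sum>n<M. q n * G n / 2)"
    using M0 q(1) G0 by (intro sum_mono2) auto
  also have "\<dots> \<le> (\<Sum>n<M. Re (t n) + \<delta>)" using Re_t by (intro sum_mono) (simp add: diff_le_eq)
  also have "\<dots> = Re (\<Sum>n<M. t n) + real M * \<delta>" by (simp add: sum.distrib)
  finally have "K * g \<le> Re (\<Sum>n<M. t n) + g" using \<delta> by linarith
  hence "K * g - 2 * g \<le> Re S" unfolding S using tail_le by simp
  thus ?thesis by (simp add: left_diff_distrib)
qed

text \<open>On the shifted line F is the Dirichlet series plus the logarithm of the pole factor. The
  growth constant, which depends on \<epsilon>, is consumed inside this proof and the result is an
  exact identity.\<close>

lemma integral_identity:
  assumes hol: "F holomorphic_on {s. Re s > 1/2}"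
    and ex: "\<And>s. Re s > 1/2 \<Longrightarrow> exp (F s) = zeta_reg s / (s + 1)"
    and F1: "\<And>s. Re s > 1 \<Longrightarrow> F s = dirichlet log_coeff s + Ln (1 - 2 / (s + 1))"
    and \<epsilon>: "0 < \<epsilon>" "\<epsilon> \<le> 1/2" and B: "B > 0" and \<eta>: "\<eta> \<ge> 0" and y: "y = 1/2 - \<epsilon>/2"
  shows "integrable lborel (\<lambda>x. F (Complex (1/2 + \<epsilon>) (\<tau> + x)) * dexp_kernel B \<eta> (of_real x))"
    and "(\<lambda>n. of_real (log_coeff n) * of_nat (Suc n) powr (- Complex (1/2 + \<epsilon>) \<tau>) * kernel_ft B \<eta> (ln (real (Suc n)))) sums
      ((LINT x|lborel. F (Complex (1/2 + \<epsilon>) (\<tau> + x)) * dexp_kernel B \<eta> (of_real x)) -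
       (LINT x|lborel. Ln (1 - 2 / (Complex (1 + \<epsilon>/2) (\<tau> + x) + 1)) * dexp_kernel B \<eta> (of_real x - \<i> * of_real y)))"
proof -
  obtain C where C: "C \<ge> 0" "\<And>s. 1/2 + \<epsilon> \<le> Re s \<Longrightarrow> Re s \<le> 2 \<Longrightarrow> cmod (F s) \<le> C * (1 + \<bar>Im s\<bar>)^2"
    using log_zeta_growth[OF hol ex F1 \<epsilon>(1)] by blast
  note H = holomorphic_times_kernel_shift[OF hol C(2) C(1) \<epsilon> B \<eta> y, of \<tau>]
  note D = kernel_series[where c=log_coeff and \<tau>=\<tau>, OF abs_log_coeff_le \<epsilon> B \<eta> y]
  show "integrable lborel (\<lambda>x. F (Complex (1/2 + \<epsilon>) (\<tau> + x)) * dexp_kernel B \<eta> (of_real x))" by (rule H(2))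
  have eq: "dirichlet log_coeff (Complex (1 + \<epsilon>/2) (\<tau> + x)) * dexp_kernel B \<eta> (of_real x - \<i> * of_real y) =
     F (Complex (1 + \<epsilon>/2) (\<tau> + x)) * dexp_kernel B \<eta> (of_real x - \<i> * of_real y) -
     Ln (1 - 2 / (Complex (1 + \<epsilon>/2) (\<tau> + x) + 1)) * dexp_kernel B \<eta> (of_real x - \<i> * of_real y)" for x
    using \<epsilon> by (subst F1) (auto simp: algebra_simps)
  have eq': "Ln (1 - 2 / (Complex (1 + \<epsilon>/2) (\<tau> + x) + 1)) * dexp_kernel B \<eta> (of_real x - \<i> * of_real y) =
     F (Complex (1 + \<epsilon>/2) (\<tau> + x)) * dexp_kernel B \<eta> (of_real x - \<i> * of_real y) -
     dirichlet log_coeff (Complex (1 + \<epsilon>/2) (\<tau> + x)) * dexp_kernel B \<eta> (of_real x - \<i> * of_real y)" for x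
    unfolding eq by simp
  have "(LINT x|lborel. Ln (1 - 2 / (Complex (1 + \<epsilon>/2) (\<tau> + x) + 1)) * dexp_kernel B \<eta> (of_real x - \<i> * of_real y)) =
    (LINT x|lborel. F (Complex (1 + \<epsilon>/2) (\<tau> + x)) * dexp_kernel B \<eta> (of_real x - \<i> * of_real y)) -
    (LINT x|lborel. dirichlet log_coeff (Complex (1 + \<epsilon>/2) (\<tau> + x)) * dexp_kernel B \<eta> (of_real x - \<i> * of_real y))"
    unfolding eq' by (rule Bochner_Integration.integral_diff[OF H(3) D(2)])
  thus "(\<lambda>n. of_real (log_coeff n) * of_nat (Suc n) powr (- Complex (1/2 + \<epsilon>) \<tau>) * kernel_ft B \<eta> (ln (real (Suc n)))) sums
      ((LINT x|lborel. F (Complex (1/2 + \<epsilon>) (\<tau> + x)) * dexp_kernel B \<eta> (of_real x)) -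
       (LINT x|lborel. Ln (1 - 2 / (Complex (1 + \<epsilon>/2) (\<tau> + x) + 1)) * dexp_kernel B \<eta> (of_real x - \<i> * of_real y)))"
    using D(1) H(1) by simp
qed

theorem theorem1:
  fixes A :: real
  assumes RH: "riemann_hypothesis"
    and "A \<ge> 1"
  shows "\<exists>c\<^sub>0::real. c\<^sub>0 > 0 \<and> (\<exists>T\<^sub>0::real. \<forall>T>T\<^sub>0.
           let H = 1 / pi * ln (ln (ln T)) + c\<^sub>0
           in \<exists>t::real. t \<in> {T - H<..<T + H} \<and>
                cmod (zeta (1 / 2 + \<i> * complex_of_real t)) > A)"
proof -
  obtain F where F: "F holomorphic_on {s. Re s > 1/2}"
    "\<And>s. Re s > 1/2 \<Longrightarrow> exp (F s) = zeta_reg s / (s + 1)"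
    "\<And>s. Re s > 1 \<Longrightarrow> F s = dirichlet log_coeff s + Ln (1 - 2 / (s + 1))"
    using RH_log_zeta[OF RH] by blast
  \<comment> \<open>The final balance in units of g: at least K - 2 from below, against ln(A + 1) +
    1 for the average and 1 for the pole. With this K it reads ln(A + 1) + 3 \<le> ln(A + 1) +
    2.\<close>
  define K where "K = ln (A + 1) + 5"
  obtain M0 where M0: "(\<Sum>n<M0. log_coeff n * real (Suc n) powr (-1/2)) > 8 * K"
    using log_coeff_half_unbounded by blast
  define l where "l = ln (real M0 + 1)"
  have l: "l \<ge> 0" by (simp add: l_def)
  have ln_le: "0 \<le> ln (real (Suc n))" "ln (real (Suc n)) \<le> l" if "n < M0" for n
    using that by (auto simp: l_def)
  \<comment> \<open>With \<xi> \<le> l this makes \<xi>^2 / (4 B) \<le> 1/4, so the Gaussian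
    transform keeps more than half its mass at each of the first \<open>M0\<close>
    logarithms.\<close>
  define B where "B = l^2 + 1"
  have B: "B > 0" by (simp add: B_def add_nonneg_pos)
  define g where "g = gauss_mass B"
  have g: "g > 0" unfolding g_def by (rule gauss_mass_pos[OF B])
  define G where "G = (\<lambda>n. exp (- (ln (real (Suc n))^2) / (4 * B)) * g)"
  have G0: "G n \<ge> 0" for n using g by (simp add: G_def)
  have G: "G n \<ge> g / 2" if n: "n < M0" for n
  proof -
    have "ln (real (Suc n))^2 \<le> l^2" by (intro power_mono ln_le n)
    hence "ln (real (Suc n))^2 / (4 * B) \<le> 1/4" using B by (simp add: B_def divide_le_eq)
    moreover have "1 + - (ln (real (Suc n))^2) / (4 * B) \<le> exp (- (ln (real (Suc n))^2) / (4 * B))" by (rule exp_ge_add_one_self)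
    ultimately have "1/2 \<le> exp (- (ln (real (Suc n))^2) / (4 * B))" by simp
    hence "1/2 * g \<le> G n" unfolding G_def using g by (intro mult_right_mono) auto
    thus ?thesis by simp
  qed
  obtain C1 where C1: "C1 \<ge> 0" "\<And>\<eta> \<xi>. 0 \<le> \<eta> \<Longrightarrow> \<eta> \<le> 1 \<Longrightarrow> \<xi> > 0 \<Longrightarrow> cmod (kernel_ft B \<eta> \<xi>) \<le> C1 * exp (- \<xi> / 2) / \<xi>^2"
    using kernel_ft_bound[OF B] by blast
  obtain C2 where C2: "C2 \<ge> 0" "\<And>\<eta> \<xi>. \<eta> \<ge> 0 \<Longrightarrow> \<xi> \<ge> 0 \<Longrightarrow> cmod (kernel_ft B \<eta> \<xi> - of_real (exp (- (\<xi>^2) / (4 * B)) * gauss_mass B)) \<le> C2 * \<eta>"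
    using kernel_ft_approx[OF B] by blast
  obtain C3 where C3: "C3 \<ge> 0" "\<And>\<eta> \<tau> \<epsilon> y. \<eta> \<ge> 0 \<Longrightarrow> \<tau> \<ge> 8 \<Longrightarrow> \<epsilon> = 1 / \<tau>^3 \<Longrightarrow> y = 1/2 - \<epsilon>/2 \<Longrightarrow>
    cmod (LINT x|lborel. Ln (1 - 2 / (Complex (1 + \<epsilon>/2) (\<tau> + x) + 1)) * dexp_kernel B \<eta> (of_real x - \<i> * of_real y)) \<le> C3 / \<tau>"
    using pole_integral_bound[OF B] by blast
  obtain C4 where C4: "C4 \<ge> 0"
    and C4': "\<forall>F \<tau> \<epsilon> \<eta> h a. (\<forall>s. Re s > 1/2 \<longrightarrow> exp (F s) = zeta_reg s / (s + 1)) \<longrightarrow>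
     \<tau> \<ge> 1 \<longrightarrow> 0 < \<epsilon> \<longrightarrow> \<epsilon> \<le> 1/2 \<longrightarrow> \<eta> \<ge> 0 \<longrightarrow> h \<ge> 0 \<longrightarrow> a \<ge> 1 \<longrightarrow>
     (\<forall>x. \<bar>x\<bar> \<le> h \<longrightarrow> cmod (zeta_reg (Complex (1/2 + \<epsilon>) (\<tau> + x)) / (Complex (1/2 + \<epsilon>) (\<tau> + x) + 1)) \<le> a) \<longrightarrow>
     integrable lborel (\<lambda>x. F (Complex (1/2 + \<epsilon>) (\<tau> + x)) * dexp_kernel B \<eta> (of_real x)) \<longrightarrow>
     Re (LINT x|lborel. F (Complex (1/2 + \<epsilon>) (\<tau> + x)) * dexp_kernel B \<eta> (of_real x))
       \<le> ln a * gauss_mass B + C4 * (1 + ln \<tau>) * exp (- \<eta> * cosh (pi * h))"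
    using log_zeta_integral_upper[OF B] by (elim exE conjE) (rule that)
  obtain C5 where C5: "C5 \<ge> 0" "\<And>t \<epsilon>. t \<ge> 2 \<Longrightarrow> 0 \<le> \<epsilon> \<Longrightarrow> \<epsilon> \<le> 1 \<Longrightarrow> cmod (zeta (Complex (1/2 + \<epsilon>) t) - zeta (Complex (1/2) t)) \<le> C5 * t^2 * \<epsilon>"
    using zeta_near_half_line by blast
  define Q where "Q = (\<lambda>n. C1 * (1 / (real (Suc n) * ln (real (Suc n)) ^ 2)))"
  have Q: "summable Q" unfolding Q_def by (intro summable_mult summable_inverse_mult_ln_squared)
  from suminf_exist_split[OF g Q] obtain N where N: "\<And>n. n \<ge> N \<Longrightarrow> norm (\<Sum>i. Q (i + n)) < g" by blast
  \<comment> \<open>\<open>M\<close> can be fixed before \<eta> because \<open>C1\<close> is uniform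
    for \<eta> \<le> 1. The bound M \<ge> 1 keeps ln (Suc n) positive throughout the tail.\<close>
  define M where "M = max N (max M0 1)"
  have M: "M0 \<le> M" "1 \<le> M" "N \<le> M" by (auto simp: M_def)
  have QM: "(\<Sum>n. Q (n + M)) \<le> g" using N[OF M(3)] by auto
  \<comment> \<open>Small enough that replacing \<open>M\<close> transforms by Gaussian ones costs
    at most g in total.\<close>
  define \<eta> where "\<eta> = min 1 (g / (real M * C2 + 1))"
  have MC: "real M * C2 + 1 > 0" using C2(1) by (simp add: add_nonneg_pos)
  have \<eta>: "0 < \<eta>" "\<eta> \<le> 1" using g MC by (auto simp: \<eta>_def)
  have \<eta>M: "real M * (C2 * \<eta>) \<le> g"
  proof -
    have "real M * (C2 * \<eta>) \<le> (real M * C2 + 1) * \<eta>" using \<eta> by (simp add: algebra_simps)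
    also have "\<dots> \<le> (real M * C2 + 1) * (g / (real M * C2 + 1))" using MC by (intro mult_left_mono) (auto simp: \<eta>_def)
    also have "\<dots> = g" using MC by simp
    finally show ?thesis .
  qed
  obtain R where R: "R \<ge> 0" "\<And>T. \<exists>\<tau>. \<bar>\<tau> - T\<bar> \<le> R \<and> (\<forall>n<M. cmod (exp (- \<i> * of_real (\<tau> * ln (real (Suc n)))) - 1) \<le> 1/2)"
    using simultaneous_approximation by blast
  \<comment> \<open>Chosen so that \<eta> cosh(pi h) \<ge> 2 ln ln T: the kernel beyond h is then at
    most (ln T)^(-2), which beats the factor 1 + ln \<tau>.\<close>
  define c1 where "c1 = ln (4 / \<eta>) / pi"
  have c1: "c1 \<ge> 0" using \<eta> by (simp add: c1_def)
  \<comment> \<open>\<open>R\<close> accounts for replacing T by \<tau>, \<open>c1\<close> belongs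
    to the radius h, and 1 makes the inclusion in the open interval strict.\<close>
  define c0 where "c0 = R + 1 + c1"
  have c0: "c0 > 0" using R(1) c1 by (simp add: c0_def)
  define h where "h = (\<lambda>T. 1 / pi * ln (ln (ln T)) + c1)"
  have exp_cosh: "exp (- \<eta> * cosh (pi * h T)) \<le> 1 / ln T ^ 2" if T: "ln (ln T) > 0" "ln T > 0" for T
  proof -
    have "pi * h T = ln (ln (ln T)) + ln (4 / \<eta>)" by (simp add: h_def c1_def field_simps)
    hence "exp (pi * h T) = ln (ln T) * (4 / \<eta>)" using T \<eta> by (simp add: exp_add)
    moreover have "cosh (pi * h T) \<ge> exp (pi * h T) / 2" by (simp add: cosh_def)
    ultimately have "\<eta> * cosh (pi * h T) \<ge> \<eta> * (ln (ln T) * (4 / \<eta>) / 2)" using \<eta> by (intro mult_left_mono) auto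
    also have "\<eta> * (ln (ln T) * (4 / \<eta>) / 2) = 2 * ln (ln T)" using \<eta> by simp
    finally have "exp (- \<eta> * cosh (pi * h T)) \<le> exp (- (2 * ln (ln T)))" by simp
    also have "exp (- (2 * ln (ln T))) = inverse (exp (ln (ln T)) ^ 2)" by (simp add: exp_minus exp_double)
    also have "\<dots> = 1 / ln T ^ 2" using T by (simp add: inverse_eq_divide)
    finally show ?thesis .
  qed
  have key: "\<exists>t. t \<in> {T - (1 / pi * ln (ln (ln T)) + c0)<..<T + (1 / pi * ln (ln (ln T)) + c0)} \<and>
      cmod (zeta (1 / 2 + \<i> * complex_of_real t)) > A"
    if T1: "T \<ge> 2 * R + 16" and T2: "ln (ln (ln T)) \<ge> 0" "ln (ln T) > 0" "ln T > 0" and T3: "h T + 2 \<le> T / 2"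
      and T4: "T \<ge> 8 * C5" and T5: "T \<ge> 2 * C3 / g" and T6: "C4 * (1 + ln (2 * T)) / ln T ^ 2 \<le> g" and T7: "T \<ge> 4 * l" for T
  proof (rule ccontr)
    define H where "H = 1 / pi * ln (ln (ln T)) + c0"
    assume "\<not> ?thesis"
    hence small: "cmod (zeta (1 / 2 + \<i> * complex_of_real t)) \<le> A" if "T - H < t" "t < T + H" for t
      using that unfolding H_def by (metis greaterThanLessThan_iff not_less)
    obtain \<tau> where \<tau>: "\<bar>\<tau> - T\<bar> \<le> R" "\<And>n. n < M \<Longrightarrow> cmod (exp (- \<i> * of_real (\<tau> * ln (real (Suc n)))) - 1) \<le> 1/2"
      using R(2) by blast
    have \<tau>T: "T / 2 \<le> \<tau>" "\<tau> \<le> 2 * T" "8 \<le> \<tau>" using \<tau>(1) T1 R(1) by linarith+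
    \<comment> \<open>The cube beats the t^2 of \<open>zeta_near_half_line\<close>: moving off the
      critical line changes \<zeta> by O(1/\<tau>), here at most 1, hence the bound A + 1
      below.\<close>
    define \<epsilon> where "\<epsilon> = 1 / \<tau>^3"
    define y where "y = 1/2 - \<epsilon>/2"
    have "\<tau>^3 \<ge> \<tau>^1" using \<tau>T by (intro power_increasing) auto
    hence \<epsilon>: "0 < \<epsilon>" "\<epsilon> \<le> 1 / \<tau>" using \<tau>T by (auto simp: \<epsilon>_def intro!: divide_left_mono)
    have "1 / \<tau> \<le> 1/8" using \<tau>T by (simp add: divide_le_eq)
    with \<epsilon> have \<epsilon>2: "\<epsilon> \<le> 1/2" by linarith
    have h0: "h T \<ge> 0" using T2 c1 by (simp add: h_def)
    have HR: "H = h T + R + 1" by (simp add: H_def h_def c0_def)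
    have near: "cmod (zeta_reg (Complex (1/2 + \<epsilon>) (\<tau> + x)) / (Complex (1/2 + \<epsilon>) (\<tau> + x) + 1)) \<le> A + 1" if x: "\<bar>x\<bar> \<le> h T" for x
    proof -
      define t where "t = \<tau> + x"
      have "T - H < t" "t < T + H" unfolding HR t_def using x \<tau>(1) by linarith+
      hence "cmod (zeta (1 / 2 + \<i> * complex_of_real t)) \<le> A" by (rule small)
      moreover have "1 / 2 + \<i> * complex_of_real t = Complex (1/2) t" by (simp add: complex_eq_iff)
      ultimately have zA: "cmod (zeta (Complex (1/2) t)) \<le> A" by simp
      have t: "2 \<le> t" "t \<le> 2 * \<tau>" unfolding t_def using x T3 \<tau>T by linarith+
      have "C5 * t^2 * \<epsilon> \<le> C5 * (2 * \<tau>)^2 * \<epsilon>"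
        using t C5(1) \<epsilon> by (intro mult_right_mono mult_left_mono power_mono) auto
      also have "\<dots> = 4 * C5 / \<tau>" using \<tau>T by (simp add: \<epsilon>_def power_mult_distrib eval_nat_numeral)
      also have "\<dots> \<le> 1" using \<tau>T T4 by (simp add: divide_le_eq)
      finally have "C5 * t^2 * \<epsilon> \<le> 1" .
      moreover have "cmod (zeta (Complex (1/2 + \<epsilon>) t) - zeta (Complex (1/2) t)) \<le> C5 * t^2 * \<epsilon>"
        using t \<epsilon> \<epsilon>2 by (intro C5) auto
      ultimately have z: "cmod (zeta (Complex (1/2 + \<epsilon>) t)) \<le> A + 1"
        using zA norm_triangle_ineq2[of "zeta (Complex (1/2 + \<epsilon>) t)" "zeta (Complex (1/2) t)"] by linarith
      define s where "s = Complex (1/2 + \<epsilon>) t"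
      have s: "Re s > 0" "s \<noteq> 1" using \<epsilon> t by (auto simp: s_def complex_eq_iff)
      have "Re (s + 1) > 0" using s by simp
      hence s1: "cmod (s + 1) > 0" using complex_Re_le_cmod[of "s + 1"] by linarith
      \<comment> \<open>Passing from \<zeta> to the quotient that F is a logarithm of does not
        increase the modulus.\<close>
      have "cmod (s - 1) \<le> cmod (s + 1)"
        unfolding cmod_def using s by (auto intro!: real_sqrt_le_mono simp: power2_eq_square algebra_simps)
      hence "cmod (s - 1) / cmod (s + 1) \<le> 1" by (subst divide_le_eq_1_pos[OF s1])
      hence "cmod (s - 1) / cmod (s + 1) * cmod (zeta s) \<le> 1 * (A + 1)"
        using z assms(2) unfolding s_def by (intro mult_mono) auto
      thus ?thesis unfolding t_def[symmetric] s_def[symmetric] zeta_reg_eq[OF s] by (simp add: norm_mult norm_divide)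
    qed
    note I = integral_identity[OF F \<epsilon>(1) \<epsilon>2 B less_imp_le[OF \<eta>(1)] y_def, of \<tau>]
    define J where "J = (LINT x|lborel. F (Complex (1/2 + \<epsilon>) (\<tau> + x)) * dexp_kernel B \<eta> (of_real x))"
    define D where "D = (LINT x|lborel. Ln (1 - 2 / (Complex (1 + \<epsilon>/2) (\<tau> + x) + 1)) * dexp_kernel B \<eta> (of_real x - \<i> * of_real y))"
    have "(K - 2) * g \<le> Re (J - D)"
    proof (rule log_series_lower_bound[where M=M and M0=M0 and \<tau>=\<tau> and \<epsilon>=\<epsilon> and Q=Q and G=G and \<delta>="C2 * \<eta>"])
      show "(\<lambda>n. of_real (log_coeff n) * of_nat (Suc n) powr (- Complex (1/2 + \<epsilon>) \<tau>) * kernel_ft B \<eta> (ln (real (Suc n)))) sums (J - D)"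
        unfolding J_def D_def by (rule I(2))
      show "cmod (kernel_ft B \<eta> (ln (real (Suc n))) - of_real (G n)) \<le> C2 * \<eta>" for n
        unfolding G_def g_def using \<eta> by (intro C2) auto
      show "real (Suc n) powr (-1/2) * cmod (kernel_ft B \<eta> (ln (real (Suc n)))) \<le> Q n" if "n \<ge> M" for n
      proof -
        define \<xi> where "\<xi> = ln (real (Suc n))"
        have \<xi>: "\<xi> > 0" using that M by (simp add: \<xi>_def)
        have e: "real (Suc n) powr (-1/2) = exp (- \<xi> / 2)" by (simp add: powr_def \<xi>_def)
        have "exp (- \<xi> / 2) * exp (- \<xi> / 2) = exp (- \<xi>)" by (simp flip: exp_add)
        also have "\<dots> = 1 / real (Suc n)" by (simp add: \<xi>_def exp_minus inverse_eq_divide)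
        finally have ee: "exp (- \<xi> / 2) * exp (- \<xi> / 2) = 1 / real (Suc n)" .
        have "real (Suc n) powr (-1/2) * cmod (kernel_ft B \<eta> \<xi>) \<le> exp (- \<xi> / 2) * (C1 * exp (- \<xi> / 2) / \<xi>^2)"
          unfolding e using \<eta> \<xi> by (intro mult_left_mono C1) auto
        also have "\<dots> = C1 * (exp (- \<xi> / 2) * exp (- \<xi> / 2)) / \<xi>^2" by (simp only: mult_ac times_divide_eq_right)
        also have "\<dots> = Q n" unfolding ee Q_def \<xi>_def[symmetric] by simp
        finally show ?thesis by (simp only: \<xi>_def)
      qed
      show "real (Suc n) powr (- \<epsilon>) \<ge> 1/2" if n: "n < M0" for n
      proof -
        have "\<epsilon> * ln (real (Suc n)) \<le> (1 / \<tau>) * l" using \<epsilon> \<tau>T ln_le[OF n] by (intro mult_mono) auto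
        also have "\<dots> \<le> 1/2" using \<tau>T T7 by (simp add: divide_le_eq)
        finally have "1/2 \<le> 1 + - \<epsilon> * ln (real (Suc n))" by simp
        also have "\<dots> \<le> exp (- \<epsilon> * ln (real (Suc n)))" by (rule exp_ge_add_one_self)
        finally show ?thesis by (simp add: powr_def)
      qed
    qed (use \<tau> G0 G Q M M0 QM g \<eta>M \<epsilon> C2(1) \<eta> in auto)
    moreover have "Re J \<le> ln (A + 1) * g + g"
    proof -
      have "Re J \<le> ln (A + 1) * gauss_mass B + C4 * (1 + ln \<tau>) * exp (- \<eta> * cosh (pi * h T))"
        unfolding J_def using \<tau>T \<epsilon> \<epsilon>2 \<eta> h0 assms(2) near I(1) F(2) by (intro C4'[rule_format]) auto
      also have "C4 * (1 + ln \<tau>) * exp (- \<eta> * cosh (pi * h T)) \<le> C4 * (1 + ln (2 * T)) * (1 / ln T ^ 2)"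
        using \<tau>T C4 exp_cosh[OF T2(2,3)] by (intro mult_mono) auto
      also have "\<dots> \<le> g" using T6 by simp
      finally show ?thesis by (simp add: g_def)
    qed
    moreover have "cmod D \<le> g"
    proof -
      have "cmod D \<le> C3 / \<tau>" unfolding D_def using \<eta> \<tau>T by (intro C3 \<epsilon>_def y_def) auto
      also have "\<dots> \<le> g"
      proof -
        have "C3 * 2 \<le> T * g" using T5 g by (simp add: field_simps)
        also have "\<dots> \<le> (\<tau> * 2) * g" using \<tau>T g by (intro mult_right_mono) auto
        finally have "C3 \<le> \<tau> * g" by simp
        thus ?thesis using \<tau>T by (simp add: divide_le_eq mult.commute)
      qed
      finally show ?thesis .
    qed
    hence "- Re D \<le> g" using abs_Re_le_cmod[of D] by linarith
    ultimately have "(K - 2) * g \<le> ln (A + 1) * g + g + g" by simp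
    hence "g \<le> 0" by (simp add: K_def algebra_simps)
    thus False using g by simp
  qed
  have "eventually (\<lambda>T. T \<ge> 2 * R + 16 \<and> (ln (ln (ln T)) \<ge> 0 \<and> ln (ln T) > 0 \<and> ln T > 0) \<and> h T + 2 \<le> T / 2 \<and>
      T \<ge> 8 * C5 \<and> T \<ge> 2 * C3 / g \<and> C4 * (1 + ln (2 * T)) / ln T ^ 2 \<le> g \<and> T \<ge> 4 * l) at_top"
  proof (intro eventually_conj eventually_ge_at_top)
    show "eventually (\<lambda>T::real. ln (ln (ln T)) \<ge> 0) at_top" by real_asymp
    show "eventually (\<lambda>T::real. ln (ln T) > 0) at_top" by real_asymp
    show "eventually (\<lambda>T::real. ln T > 0) at_top" by real_asymp
    show "eventually (\<lambda>T. h T + 2 \<le> T / 2) at_top" unfolding h_def by real_asymp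
    have "((\<lambda>T. C4 * ((1 + ln (2 * T)) / ln T ^ 2)) \<longlongrightarrow> C4 * 0) at_top"
      by (intro tendsto_mult tendsto_const) real_asymp
    from order_tendstoD(2)[OF this, of g] g
    show "eventually (\<lambda>T. C4 * (1 + ln (2 * T)) / ln T ^ 2 \<le> g) at_top"
      by (auto elim!: eventually_mono)
  qed
  then obtain T0 where T0: "\<And>T. T \<ge> T0 \<Longrightarrow> T \<ge> 2 * R + 16 \<and> (ln (ln (ln T)) \<ge> 0 \<and> ln (ln T) > 0 \<and> ln T > 0) \<and> h T + 2 \<le> T / 2 \<and>
      T \<ge> 8 * C5 \<and> T \<ge> 2 * C3 / g \<and> C4 * (1 + ln (2 * T)) / ln T ^ 2 \<le> g \<and> T \<ge> 4 * l"
    unfolding eventually_at_top_linorder by blast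
  show ?thesis
  proof (rule exI[of _ c0], intro conjI c0 exI[of _ T0] allI impI)
    fix T assume "T > T0"
    hence "T \<ge> T0" by simp
    from T0[OF this] show "let H = 1 / pi * ln (ln (ln T)) + c0
           in \<exists>t::real. t \<in> {T - H<..<T + H} \<and> cmod (zeta (1 / 2 + \<i> * complex_of_real t)) > A"
      unfolding Let_def by (intro key) auto
  qed
qed

end
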